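(* Let $n\ge1$, $Q=2n+2$, and let $\mathcal S\subset\mathbb H^n$ be a non-characteristic $H$-minimal hypersurface. Let $\rho\in C^1(\mathbb H^n)$ be such that the level sets of $\rho$ are compact, and let $\lambda\in C^1(\mathbb R)$ be non-decreasing, with $\lambda(t)\equiv0$ for $t\le0$. For any $p_0=(x_0,y_0,t_0)\in\mathbb H^n$ let $$\zeta(p)=\sum_{i=1}^n\big((x_i-x_{0,i})X_i+(y_i-y_{0,i})X_{n+i}\big),\qquad f(p)=2(t-t_0)+\langle x,y_0\rangle-\langle x_0,y\rangle .$$ Then for every $r>0$ $$(Q-1)\int_{\mathcal S}\lambda(r-\rho)\,d\sigma_H-\int_{\mathcal S}\lambda'(r-\rho)\Big\{\langle\zeta,\nabla^{H,\mathcal S}\rho\rangle+f\,(T-\overline\omega\,Y)\rho\Big\}\,d\sigma_H\ \le\ 0 .$$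
   Context: The Heisenberg group $\mathbb H^n$ is $\mathbb R^{2n+1}$ with points $p=(x,y,t)$, $x,y\in\mathbb R^n$, $t\in\mathbb R$, and group law $(x,y,t)\cdot(x',y',t')=(x+x',y+y',t+t'+\frac12(\langle x,y'\rangle-\langle x',y\rangle))$. For $i=1,\dots,n$ let $X_i=\partial_{x_i}-\frac{y_i}2\partial_t$, $X_{n+i}=\partial_{y_i}+\frac{x_i}2\partial_t$, $T=\partial_t$. $\mathbb H^n$ carries the left-invariant Riemannian metric $\langle\cdot,\cdot\rangle$ making $X_1,\dots,X_{2n},T$ orthonormal. The horizontal bundle is $H\mathbb H^n=\mathrm{span}\{X_1,\dots,X_{2n}\}$. For a $C^1$ function $F$, $\nabla F=\sum_{j=1}^{2n}(X_jF)X_j+(TF)T$ and $\nabla^HF=\sum_{j=1}^{2n}(X_jF)X_j$. Let $\mathcal S\subset\mathbb H^n$ be a $C^2$ oriented hypersurface with Riemannian unit normal $\boldsymbol\nu$ and Riemannian surface measure $\sigma$. Put $\boldsymbol N^H=\sum_{j=1}^{2n}\langle\boldsymbol\nu,X_j\rangle X_j$ and $W=|\boldsymbol N^H|$. $\mathcal S$ is non-characteristic if $W>0$ everywhere on $\mathcal S$. In this case set $\boldsymbol\nu^H=\boldsymbol N^H/W$, $\overline\omega=\langle\boldsymbol\nu,T\rangle/W$. The horizontal perimeter measure is $d\sigma_H=W\,d\sigma$. For $u\in C^1(\mathcal S)$ with $C^1$ extension $\overline u$, $\nabla^{H,\mathcal S}u=\nabla^H\overline u-\langle\nabla^H\overline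 u,\boldsymbol\nu^H\rangle\boldsymbol\nu^H$. Also $Yf=\langle\nabla f,\boldsymbol\nu^H\rangle$. The horizontal mean curvature at a non-characteristic point is $\mathcal H=\sum_{i=1}^{2n-1}\langle\nabla^H_{\boldsymbol e_i}\boldsymbol e_i,\boldsymbol\nu^H\rangle$, where $\{\boldsymbol e_1,\dots,\boldsymbol e_{2n-1}\}$ is an orthonormal basis of $T\mathcal S\cap H\mathbb H^n$ and the horizontal Levi-Civita connection is $\nabla^H_V\big(\sum_jU_jX_j\big)=\sum_{j=1}^{2n}V(U_j)X_j$. $\mathcal S$ is $H$-minimal if it is a $C^2$ oriented hypersurface with $\mathcal H\equiv0$ on $\mathcal S$.
   Formalization: The hypersurface S is additionally assumed closed in H^n, and the sublevel sets {ρ ≤ c} (not only the level sets) are assumed compact; without these the inequality fails, through boundary flux of S or an infinite first integral. *)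

theory Defs
  imports "HOL-Analysis.Analysis"
begin

definition C1_on :: "'a::real_normed_vector set \<Rightarrow> ('a \<Rightarrow> 'b::real_normed_vector) \<Rightarrow> bool" where
  "C1_on U f \<longleftrightarrow> (\<exists>f' :: 'a \<Rightarrow> 'a \<Rightarrow>\<^sub>L 'b.
     (\<forall>x\<in>U. (f has_derivative blinfun_apply (f' x)) (at x)) \<and> continuous_on U f')"

definition C2_on :: "'a::real_normed_vector set \<Rightarrow> ('a \<Rightarrow> 'b::real_normed_vector) \<Rightarrow> bool" where
  "C2_on U f \<longleftrightarrow> (\<exists>f' :: 'a \<Rightarrow> 'a \<Rightarrow>\<^sub>L 'b.
     (\<forall>x\<in>U. (f has_derivative blinfun_apply (f' x)) (at x)) \<and> C1_on U f')"


section \<open>The Heisenberg group\<close>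

text \<open>Points \<open>(x, y, t)\<close> with \<open>n = CARD('n)\<close>. Tangent vectors at any point are given by
  their components in the coordinate frame, so they have the same type.\<close>

type_synonym 'n heis = "(real^'n) \<times> (real^'n) \<times> real"

text \<open>The horizontal frame is indexed by the sum type: \<open>Inl i\<close> stands for the index \<open>i\<close>
  and \<open>Inr i\<close> for \<open>n + i\<close>.\<close>

fun heis_X :: "'n::finite + 'n \<Rightarrow> 'n heis \<Rightarrow> 'n heis" where
  "heis_X (Inl i) (x, y, t) = (axis i 1, 0, - (y $ i) / 2)"
| "heis_X (Inr i) (x, y, t) = (0, axis i 1, (x $ i) / 2)"

definition heis_T :: "'n::finite heis" where
  "heis_T = (0, 0, 1)"

text \<open>At \<open>(x, y, t)\<close> the coordinate vector \<open>(a, b, c)\<close> equals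
  \<open>\<Sum>i. a\<^sub>i X\<^sub>i + \<Sum>i. b\<^sub>i X\<^sub>n\<^sub>+\<^sub>i + (c + (\<langle>y, a\<rangle> - \<langle>x, b\<rangle>) / 2) T\<close>. Hence the following is
  the metric for which the frame is orthonormal.\<close>

fun heis_metric :: "'n::finite heis \<Rightarrow> 'n heis \<Rightarrow> 'n heis \<Rightarrow> real" where
  "heis_metric (x, y, t) (a, b, c) (a', b', c') =
     a \<bullet> a' + b \<bullet> b' + (c + (y \<bullet> a - x \<bullet> b) / 2) * (c' + (y \<bullet> a' - x \<bullet> b') / 2)"

lemma heis_frame_orthonormal:
  "heis_metric p (heis_X j p) (heis_X k p) = (if j = k then 1 else 0)"
  "heis_metric p (heis_X j p) heis_T = 0"
  "heis_metric p heis_T heis_T = 1"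
proof -
  obtain x y t where p: "p = (x, y, t)"
    by (cases p)
  show "heis_metric p (heis_X j p) (heis_X k p) = (if j = k then 1 else 0)"
    by (cases j; cases k) (simp_all add: p inner_axis, simp_all add: axis_def)
  show "heis_metric p (heis_X j p) heis_T = 0"
    by (cases j) (simp_all add: p heis_T_def inner_axis)
  show "heis_metric p heis_T heis_T = 1"
    by (simp add: p heis_T_def)
qed

definition horizontal_space :: "'n::finite heis \<Rightarrow> 'n heis set" where
  "horizontal_space p = span (range (\<lambda>j. heis_X j p))"

text \<open>\<open>dir_deriv V F p\<close> is \<open>V F\<close> at \<open>p\<close>, for the tangent vector \<open>V\<close> at \<open>p\<close>.\<close>

definition dir_deriv :: "'n::finite heis \<Rightarrow> ('n heis \<Rightarrow> real) \<Rightarrow> 'n heis \<Rightarrow> real" where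
  "dir_deriv V F p = frechet_derivative F (at p) V"

definition hor_grad :: "('n::finite heis \<Rightarrow> real) \<Rightarrow> 'n heis \<Rightarrow> 'n heis" where
  "hor_grad F p = (\<Sum>j\<in>UNIV. dir_deriv (heis_X j p) F p *\<^sub>R heis_X j p)"

definition heis_grad :: "('n::finite heis \<Rightarrow> real) \<Rightarrow> 'n heis \<Rightarrow> 'n heis" where
  "heis_grad F p = hor_grad F p + dir_deriv heis_T F p *\<^sub>R heis_T"

text \<open>The horizontal connection \<open>\<nabla>\<^sup>H\<^sub>V U\<close> at \<open>p\<close>; for horizontal \<open>U\<close> the coefficient \<open>U\<^sub>j\<close>
  is \<open>\<langle>U, X\<^sub>j\<rangle>\<close>.\<close>

definition hor_conn :: "'n::finite heis \<Rightarrow> ('n heis \<Rightarrow> 'n heis) \<Rightarrow> 'n heis \<Rightarrow> 'n heis" where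
  "hor_conn V U p =
     (\<Sum>j\<in>UNIV. dir_deriv V (\<lambda>q. heis_metric q (U q) (heis_X j q)) p *\<^sub>R heis_X j p)"


section \<open>Oriented hypersurfaces\<close>

definition C2_hypersurface :: "'n::finite heis set \<Rightarrow> bool" where
  "C2_hypersurface S \<longleftrightarrow> (\<forall>p\<in>S. \<exists>U (F :: 'n heis \<Rightarrow> real).
     open U \<and> p \<in> U \<and> C2_on U F \<and> (\<forall>q\<in>U. frechet_derivative F (at q) \<noteq> (\<lambda>v. 0)) \<and>
     S \<inter> U = {q\<in>U. F q = 0})"

definition surf_tangent :: "'n::finite heis set \<Rightarrow> 'n heis \<Rightarrow> 'n heis set" where
  "surf_tangent S p = {v. \<exists>c :: real \<Rightarrow> 'n heis.
     c 0 = p \<and> (\<forall>\<^sub>F s in at 0. c s \<in> S) \<and> (c has_vector_derivative v) (at 0)}"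

text \<open>An orientation is a choice of continuous unit normal; \<open>\<nu>\<close> is irrelevant off \<open>S\<close>.\<close>

definition unit_normal :: "'n::finite heis set \<Rightarrow> ('n heis \<Rightarrow> 'n heis) \<Rightarrow> bool" where
  "unit_normal S \<nu> \<longleftrightarrow> continuous_on S \<nu> \<and>
     (\<forall>p\<in>S. heis_metric p (\<nu> p) (\<nu> p) = 1 \<and>
             (\<forall>v\<in>surf_tangent S p. heis_metric p (\<nu> p) v = 0))"

definition hor_normal :: "('n::finite heis \<Rightarrow> 'n heis) \<Rightarrow> 'n heis \<Rightarrow> 'n heis" where
  "hor_normal \<nu> p = (\<Sum>j\<in>UNIV. heis_metric p (\<nu> p) (heis_X j p) *\<^sub>R heis_X j p)"

definition hor_W :: "('n::finite heis \<Rightarrow> 'n heis) \<Rightarrow> 'n heis \<Rightarrow> real" where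
  "hor_W \<nu> p = sqrt (heis_metric p (hor_normal \<nu> p) (hor_normal \<nu> p))"

definition non_characteristic :: "'n::finite heis set \<Rightarrow> ('n heis \<Rightarrow> 'n heis) \<Rightarrow> bool" where
  "non_characteristic S \<nu> \<longleftrightarrow> (\<forall>p\<in>S. hor_W \<nu> p > 0)"

definition unit_hor_normal :: "('n::finite heis \<Rightarrow> 'n heis) \<Rightarrow> 'n heis \<Rightarrow> 'n heis" where
  "unit_hor_normal \<nu> p = hor_normal \<nu> p /\<^sub>R hor_W \<nu> p"

definition omega_bar :: "('n::finite heis \<Rightarrow> 'n heis) \<Rightarrow> 'n heis \<Rightarrow> real" where
  "omega_bar \<nu> p = heis_metric p (\<nu> p) heis_T / hor_W \<nu> p"

text \<open>\<open>\<nabla>\<^sup>H\<^sup>,\<^sup>S u\<close>, computed from a \<open>C\<^sup>1\<close> extension \<open>u\<close> to the ambient space.\<close>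

definition tan_hor_grad ::
    "('n::finite heis \<Rightarrow> 'n heis) \<Rightarrow> ('n heis \<Rightarrow> real) \<Rightarrow> 'n heis \<Rightarrow> 'n heis" where
  "tan_hor_grad \<nu> u p = hor_grad u p
     - heis_metric p (hor_grad u p) (unit_hor_normal \<nu> p) *\<^sub>R unit_hor_normal \<nu> p"

definition Y_deriv :: "('n::finite heis \<Rightarrow> 'n heis) \<Rightarrow> ('n heis \<Rightarrow> real) \<Rightarrow> 'n heis \<Rightarrow> real" where
  "Y_deriv \<nu> F p = heis_metric p (heis_grad F p) (unit_hor_normal \<nu> p)"


section \<open>Horizontal mean curvature\<close>

text \<open>A local orthonormal frame \<open>e\<^sub>1, \<dots>, e\<^sub>2\<^sub>n\<^sub>-\<^sub>1\<close> of \<open>TS \<inter> HH\<^sup>n\<close> on \<open>S \<inter> U\<close>, given by \<open>C\<^sup>1\<close>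
  extensions of its members to \<open>U\<close>. Off \<open>S\<close> nothing but the regularity is required.\<close>

definition hor_tangent_frame ::
    "'n::finite heis set \<Rightarrow> 'n heis set \<Rightarrow> (nat \<Rightarrow> 'n heis \<Rightarrow> 'n heis) \<Rightarrow> bool" where
  "hor_tangent_frame S U e \<longleftrightarrow> open U \<and>
     (\<forall>i\<in>{1..2 * CARD('n) - 1}. C1_on U (e i)) \<and>
     (\<forall>q\<in>S \<inter> U.
        (\<forall>i\<in>{1..2 * CARD('n) - 1}. \<forall>k\<in>{1..2 * CARD('n) - 1}.
           heis_metric q (e i q) (e k q) = (if i = k then 1 else 0)) \<and>
        span ((\<lambda>i. e i q) ` {1..2 * CARD('n) - 1}) = surf_tangent S q \<inter> horizontal_space q)"

text \<open>Since \<open>e\<^sub>i\<close> is tangent to \<open>S\<close>, the sum depends neither on the extension off \<open>S\<close> nor on the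
  frame; on a non-characteristic \<open>C\<^sup>2\<close> hypersurface such frames exist near every point. So the
  relation determines a unique \<open>h\<close>.\<close>

definition has_hor_mean_curvature ::
    "'n::finite heis set \<Rightarrow> ('n heis \<Rightarrow> 'n heis) \<Rightarrow> 'n heis \<Rightarrow> real \<Rightarrow> bool" where
  "has_hor_mean_curvature S \<nu> p h \<longleftrightarrow> (\<exists>U e. p \<in> U \<and> hor_tangent_frame S U e \<and>
     h = (\<Sum>i = 1..2 * CARD('n) - 1.
            heis_metric p (hor_conn (e i p) (e i) p) (unit_hor_normal \<nu> p)))"

definition H_minimal :: "'n::finite heis set \<Rightarrow> ('n heis \<Rightarrow> 'n heis) \<Rightarrow> bool" where
  "H_minimal S \<nu> \<longleftrightarrow> C2_hypersurface S \<and> unit_normal S \<nu> \<and>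
     (\<forall>p\<in>S. has_hor_mean_curvature S \<nu> p 0)"


section \<open>Surface measure and horizontal perimeter\<close>

definition local_param ::
    "'n::finite heis set \<Rightarrow> (real^('n + 'n)) set \<Rightarrow> (real^('n + 'n) \<Rightarrow> 'n heis) \<Rightarrow> bool" where
  "local_param S V \<phi> \<longleftrightarrow> open V \<and> C2_on V \<phi> \<and> (\<forall>u\<in>V. inj (frechet_derivative \<phi> (at u))) \<and>
     openin (top_of_set S) (\<phi> ` V) \<and> (\<exists>\<psi>. homeomorphism V (\<phi> ` V) \<phi> \<psi>)"

definition gram_matrix ::
    "(real^('n + 'n) \<Rightarrow> 'n::finite heis) \<Rightarrow> real^('n + 'n) \<Rightarrow> real^('n + 'n)^('n + 'n)" where
  "gram_matrix \<phi> u = (\<chi> i k. heis_metric (\<phi> u)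
     (frechet_derivative \<phi> (at u) (axis i 1)) (frechet_derivative \<phi> (at u) (axis k 1)))"

text \<open>\<open>\<sigma>\<close> is the Riemannian surface measure of \<open>S\<close>: the Borel measure on the space \<open>S\<close> with
  density \<open>sqrt (det g)\<close> in every local parametrisation. Countably many parametrisations
  cover a \<open>C\<^sup>2\<close> hypersurface, so \<open>\<sigma>\<close> is unique.\<close>

definition surface_measure :: "'n::finite heis set \<Rightarrow> 'n heis measure \<Rightarrow> bool" where
  "surface_measure S \<sigma> \<longleftrightarrow> sets \<sigma> = sets (restrict_space borel S) \<and>
     (\<forall>V \<phi>. local_param S V \<phi> \<longrightarrow> (\<forall>A\<in>sets \<sigma>. A \<subseteq> \<phi> ` V \<longrightarrow>
        emeasure \<sigma> A =
          (\<integral>\<^sup>+ u \<in> {u\<in>V. \<phi> u \<in> A}. ennreal (sqrt (det (gram_matrix \<phi> u))) \<partial>lborel)))"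

definition hor_perimeter ::
    "('n::finite heis \<Rightarrow> 'n heis) \<Rightarrow> 'n heis measure \<Rightarrow> 'n heis measure" where
  "hor_perimeter \<nu> \<sigma> = density \<sigma> (\<lambda>p. ennreal (hor_W \<nu> p))"


section \<open>The dilation field centred at a point\<close>

fun zeta_field :: "'n::finite heis \<Rightarrow> 'n heis \<Rightarrow> 'n heis" where
  "zeta_field (x0, y0, t0) (x, y, t) =
     (\<Sum>i\<in>UNIV. (x $ i - x0 $ i) *\<^sub>R heis_X (Inl i) (x, y, t)
              + (y $ i - y0 $ i) *\<^sub>R heis_X (Inr i) (x, y, t))"

fun f_coeff :: "'n::finite heis \<Rightarrow> 'n heis \<Rightarrow> real" where
  "f_coeff (x0, y0, t0) (x, y, t) = 2 * (t - t0) + x \<bullet> y0 - x0 \<bullet> y"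

end

(*
  The field Z = zeta + f T generates the dilations of the Heisenberg group centred at p0, so it is
  affine with divergence Q and [Z, X_j] = -X_j. Near a point of S write S as a graph {F = 0} in a
  horizontal direction w, put m = |grad^H F|, nu^H = grad^H F / m, and let B = m Z - (Z F) nu^H. Then
  B F = 0, that is, B/m = Z - (Z F / m) nu^H is the projection of Z to TS along nu^H, and the integrand
  is the derivative of rho along this projection. The commutator relation and the symmetry of second
  derivatives give div B = (Q - 1) m - (Z F) div nu^H, where div nu^H = 0 on S by H-minimality. In the
  graph chart the horizontal perimeter has density m with respect to Lebesgue measure, and for a
  compactly supported C^1 function eta the total divergence of eta B integrates to zero. Hence
  (Q - 1) int eta + int (B/m) eta = 0, first for small supports, then by a partition of unity for
  eta = lambda(r - rho). So the inequality is in fact an equality.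
*)
theory Submission
  imports Defs
begin

section \<open>Continuously differentiable functions\<close>

text \<open>\<open>S\<close> is only C^2 and \<open>\<nu>\<close> only continuous on
  \<open>S\<close>, so \<open>\<nu>\<close> is never differentiated. Every differentiated quantity
  comes from a defining function F, whose horizontal gradient is C^1 on a full neighbourhood. There
  \<open>\<nu>\<close> is the Riemannian gradient of F times a scalar of unknown sign; as nu^H
  enters the projection of Z twice, the sign cancels. The direction w is a constant vector, X_k
  frozen at the base point, and not the field X_k. Hence the chart projection is linear, dF w = 1
  identically, and dF does not change along w. With dF w = 1 the Riemannian area element of the
  graph is |grad F|, while W = |grad^H F| / |grad F|; this is why the perimeter has density m.
  Constancy of dF along w is also what equates the divergence in the chart with the ambient one.
  Projecting along nu^H and not along nu is what makes the divergence of nu^H, that is the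
  curvature, the only geometric term. No boundary term arises: \<open>S\<close> is closed and the
  sublevel sets of rho are compact, so lambda(r - rho) has compact support on
  \<open>S\<close>.\<close>

lemma C1_onI:
  assumes "\<And>x. x \<in> U \<Longrightarrow> (f has_derivative blinfun_apply (f' x)) (at x)" "continuous_on U f'"
  shows "C1_on U f"
  unfolding C1_on_def using assms by blast

lemma C2_onI:
  assumes "\<And>x. x \<in> U \<Longrightarrow> (f has_derivative blinfun_apply (f' x)) (at x)" "C1_on U f'"
  shows "C2_on U f"
  unfolding C2_on_def using assms by blast

lemma C1_on_has_derivative:
  assumes "C1_on U f" "x \<in> U"
  shows "(f has_derivative frechet_derivative f (at x)) (at x)"
  using assms unfolding C1_on_def by (auto simp: frechet_derivative_works[symmetric] differentiable_def)

lemma C1_on_differentiable: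
  assumes "C1_on U f" "x \<in> U"
  shows "f differentiable at x"
  using C1_on_has_derivative[OF assms] by (auto simp: differentiable_def)

lemma C1_on_subset: "C1_on U f \<Longrightarrow> V \<subseteq> U \<Longrightarrow> C1_on V f"
  unfolding C1_on_def using continuous_on_subset by (blast dest: subsetD)

lemma C2_on_subset: "C2_on U f \<Longrightarrow> V \<subseteq> U \<Longrightarrow> C2_on V f"
  unfolding C2_on_def using C1_on_subset by (blast dest: subsetD)

lemma C1_on_imp_continuous_on: "C1_on U f \<Longrightarrow> continuous_on U f"
  by (intro continuous_at_imp_continuous_on ballI has_derivative_continuous[OF C1_on_has_derivative])

lemma C2_on_imp_C1_on: "C2_on U f \<Longrightarrow> C1_on U f"
  unfolding C2_on_def C1_on_def[of U f] using C1_on_imp_continuous_on by blast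

lemma C1_on_cong:
  assumes "C1_on U f" "open U" "\<And>x. x \<in> U \<Longrightarrow> f x = g x"
  shows "C1_on U g"
proof -
  obtain f' where f': "\<forall>x\<in>U. (f has_derivative blinfun_apply (f' x)) (at x)" "continuous_on U f'"
    using assms unfolding C1_on_def by blast
  have "\<forall>x\<in>U. (g has_derivative blinfun_apply (f' x)) (at x)"
    using f'(1) assms(2,3) by (auto intro: has_derivative_transform_within_open[OF _ assms(2)])
  then show ?thesis
    using f'(2) unfolding C1_on_def by blast
qed

text \<open>On the overlap the two derivatives agree by uniqueness. Serves to extend compactly
  supported functions by zero, and to divide such a function by a sum of bumps that may vanish off
  its support.\<close>

lemma C1_on_Un:
  assumes "C1_on U f" "C1_on V f" "open U" "open V"
  shows "C1_on (U \<union> V) f"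
proof -
  obtain f' g' where f': "\<forall>x\<in>U. (f has_derivative blinfun_apply (f' x)) (at x)" "continuous_on U f'"
    and g': "\<forall>x\<in>V. (f has_derivative blinfun_apply (g' x)) (at x)" "continuous_on V g'"
    using assms(1,2) unfolding C1_on_def by blast
  define h where "h x = (if x \<in> U then f' x else g' x)" for x
  have hV: "h x = g' x" if "x \<in> V" for x
    using has_derivative_unique[OF f'(1)[rule_format] g'(1)[rule_format]] that
    unfolding h_def by (auto intro!: blinfun_eqI)
  have "continuous_on U h" "continuous_on V h"
    using f'(2) g'(2) hV by (auto simp: h_def cong: continuous_on_cong)
  then have "continuous_on (U \<union> V) h"
    using assms by (intro continuous_on_open_Un)
  moreover have "\<forall>x\<in>U \<union> V. (f has_derivative blinfun_apply (h x)) (at x)"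
    using f' g' hV by (auto simp: h_def)
  ultimately show ?thesis
    by (auto intro: C1_onI)
qed

lemma C1_on_const [intro]: "C1_on U (\<lambda>x. c)"
  unfolding C1_on_def by (rule exI[of _ "\<lambda>x. 0"]) (auto simp: zero_blinfun.rep_eq)

lemma C1_on_bounded_linear:
  assumes "bounded_linear f"
  shows "C1_on U f"
  unfolding C1_on_def
  by (rule exI[of _ "\<lambda>x. Blinfun f"])
    (auto simp: bounded_linear_Blinfun_apply assms bounded_linear_imp_has_derivative)

lemma C1_on_id [intro]: "C1_on U (\<lambda>x. x)"
  by (intro C1_on_bounded_linear bounded_linear_ident)

lemma C1_on_compose:
  assumes "C1_on U f" "C1_on V g" "f ` U \<subseteq> V"
  shows "C1_on U (\<lambda>x. g (f x))"
proof -
  obtain f' g' where f': "\<forall>x\<in>U. (f has_derivative blinfun_apply (f' x)) (at x)" "continuous_on U f'"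
    and g': "\<forall>x\<in>V. (g has_derivative blinfun_apply (g' x)) (at x)" "continuous_on V g'"
    using assms unfolding C1_on_def by blast
  have "((\<lambda>x. g (f x)) has_derivative blinfun_apply (g' (f x) o\<^sub>L f' x)) (at x)" if "x \<in> U" for x
    by (rule has_derivative_eq_rhs[OF has_derivative_compose[OF f'(1)[rule_format, OF that] g'(1)[rule_format]]])
      (use assms(3) that in auto)
  moreover have "continuous_on U (\<lambda>x. g' (f x) o\<^sub>L f' x)"
    by (intro continuous_intros f' continuous_on_compose2[OF g'(2) C1_on_imp_continuous_on[OF assms(1)]] assms)
  ultimately show ?thesis
    by (rule C1_onI)
qed

lemma C1_on_linear_compose:
  assumes "bounded_linear g" "C1_on U f"
  shows "C1_on U (\<lambda>x. g (f x))"
  using C1_on_compose[OF assms(2) C1_on_bounded_linear[OF assms(1)], of UNIV] by simp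

lemma C1_on_bilinear:
  fixes f :: "'a::real_normed_vector \<Rightarrow> 'b::real_normed_vector"
    and g :: "'a \<Rightarrow> 'c::real_normed_vector"
    and pr :: "'b \<Rightarrow> 'c \<Rightarrow> 'd::real_normed_vector"
  assumes "bounded_bilinear pr" "C1_on U f" "C1_on U g"
  shows "C1_on U (\<lambda>x. pr (f x) (g x))"
proof -
  interpret pr: bounded_bilinear pr by fact
  obtain f' g' where f': "\<forall>x\<in>U. (f has_derivative blinfun_apply (f' x)) (at x)" "continuous_on U f'"
    and g': "\<forall>x\<in>U. (g has_derivative blinfun_apply (g' x)) (at x)" "continuous_on U g'"
    using assms unfolding C1_on_def by blast
  define h where "h x = (pr.prod_right (f x) o\<^sub>L g' x) + (pr.prod_left (g x) o\<^sub>L f' x)" for x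
  have "((\<lambda>x. pr (f x) (g x)) has_derivative blinfun_apply (h x)) (at x)" if "x \<in> U" for x
    by (rule has_derivative_eq_rhs[OF pr.FDERIV[OF f'(1)[rule_format, OF that] g'(1)[rule_format, OF that]]])
      (simp add: fun_eq_iff h_def blinfun.add_left pr.prod_right.rep_eq pr.prod_left.rep_eq)
  moreover have "continuous_on U h"
    unfolding h_def
    by (intro continuous_intros f' g' C1_on_imp_continuous_on[OF assms(2)] C1_on_imp_continuous_on[OF assms(3)]
      bounded_linear.continuous_on[OF pr.bounded_linear_prod_right]
      bounded_linear.continuous_on[OF pr.bounded_linear_prod_left])
  ultimately show ?thesis
    by (rule C1_onI)
qed

lemma C1_on_Pair:
  assumes "C1_on U f" "C1_on U g"
  shows "C1_on U (\<lambda>x. (f x, g x))"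
proof -
  obtain f' g' where f': "\<forall>x\<in>U. (f has_derivative blinfun_apply (f' x)) (at x)" "continuous_on U f'"
    and g': "\<forall>x\<in>U. (g has_derivative blinfun_apply (g' x)) (at x)" "continuous_on U g'"
    using assms unfolding C1_on_def by blast
  have l: "bounded_linear (\<lambda>x. (x, 0))" "bounded_linear (\<lambda>x. (0, x))"
    by (intro bounded_linear_Pair bounded_linear_ident bounded_linear_zero)+
  define h where "h x = (Blinfun (\<lambda>x. (x,0)) o\<^sub>L f' x) + (Blinfun (\<lambda>x. (0,x)) o\<^sub>L g' x)" for x
  have "((\<lambda>x. (f x, g x)) has_derivative blinfun_apply (h x)) (at x)" if "x \<in> U" for x
    by (rule has_derivative_eq_rhs[OF has_derivative_Pair[OF f'(1)[rule_format, OF that] g'(1)[rule_format, OF that]]])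
      (simp add: fun_eq_iff h_def blinfun.add_left bounded_linear_Blinfun_apply l)
  moreover have "continuous_on U h"
    unfolding h_def by (intro continuous_intros f' g')
  ultimately show ?thesis
    by (rule C1_onI)
qed

lemma C1_on_add: "C1_on U f \<Longrightarrow> C1_on U g \<Longrightarrow> C1_on U (\<lambda>x. f x + g x)"
  using C1_on_linear_compose[OF bounded_linear_add[OF bounded_linear_fst bounded_linear_snd] C1_on_Pair, of U f g]
  by simp

lemma C1_on_minus: "C1_on U f \<Longrightarrow> C1_on U (\<lambda>x. - f x)"
  using C1_on_linear_compose[OF bounded_linear_minus[OF bounded_linear_ident]] .

lemma C1_on_diff: "C1_on U f \<Longrightarrow> C1_on U g \<Longrightarrow> C1_on U (\<lambda>x. f x - g x)"
  using C1_on_add[OF _ C1_on_minus, of U f g] by simp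

lemma C1_on_sum:
  "(\<And>i. i \<in> I \<Longrightarrow> C1_on U (f i)) \<Longrightarrow> C1_on U (\<lambda>x. \<Sum>i\<in>I. f i x)"
  by (induction I rule: infinite_finite_induct) (auto intro: C1_on_add)

lemmas C1_on_scaleR = C1_on_bilinear[OF bounded_bilinear_scaleR]
lemmas C1_on_inner = C1_on_bilinear[OF bounded_bilinear_inner]
lemmas C1_on_mult = C1_on_bilinear[OF bounded_bilinear_mult]

lemma C1_on_vec:
  fixes f :: "'a::real_normed_vector \<Rightarrow> real^'b"
  assumes "\<And>i. C1_on A (\<lambda>x. f x $ i)"
  shows "C1_on A f"
proof -
  have "C1_on A (\<lambda>x. \<Sum>i\<in>UNIV. f x $ i *\<^sub>R (axis i 1 :: real^'b))"
    by (intro C1_on_sum C1_on_scaleR assms C1_on_const)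
  moreover have "(\<lambda>x. \<Sum>i\<in>UNIV. f x $ i *\<^sub>R axis i 1) = f"
    by (rule ext) (simp add: basis_expansion scalar_mult_eq_scaleR[symmetric])
  ultimately show ?thesis by simp
qed

lemma C1_on_real:
  fixes f :: "real \<Rightarrow> real"
  assumes "\<And>x. x \<in> U \<Longrightarrow> (f has_field_derivative f' x) (at x)" "continuous_on U f'"
  shows "C1_on U f"
  unfolding C1_on_def
proof (intro exI[of _ "\<lambda>x. blinfun_mult_right (f' x)"] conjI ballI)
  show "(f has_derivative blinfun_apply (blinfun_mult_right (f' x))) (at x)" if "x \<in> U" for x
    using assms(1)[OF that] unfolding has_field_derivative_def by (simp add: blinfun_mult_right.rep_eq)
  show "continuous_on U (\<lambda>x. blinfun_mult_right (f' x))"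
    by (intro bounded_linear.continuous_on[OF bounded_linear_blinfun_mult_right] assms)
qed

lemma C1_on_inverse:
  fixes f :: "'a::real_normed_vector \<Rightarrow> real"
  assumes "C1_on U f" "\<And>x. x \<in> U \<Longrightarrow> f x \<noteq> 0"
  shows "C1_on U (\<lambda>x. inverse (f x))"
proof (rule C1_on_compose[OF assms(1)])
  show "C1_on (- {0}) (inverse :: real \<Rightarrow> real)"
    by (rule C1_on_real) (auto intro!: DERIV_inverse continuous_intros)
qed (use assms in auto)

lemma C1_on_divide:
  fixes f g :: "'a::real_normed_vector \<Rightarrow> real"
  assumes "C1_on U f" "C1_on U g" "\<And>x. x \<in> U \<Longrightarrow> g x \<noteq> 0"
  shows "C1_on U (\<lambda>x. f x / g x)"
  unfolding divide_inverse by (intro C1_on_mult C1_on_inverse assms)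

lemma C1_on_sqrt:
  fixes f :: "'a::real_normed_vector \<Rightarrow> real"
  assumes "C1_on U f" "\<And>x. x \<in> U \<Longrightarrow> f x > 0"
  shows "C1_on U (\<lambda>x. sqrt (f x))"
proof (rule C1_on_compose[OF assms(1)])
  show "C1_on {0<..} sqrt"
    by (rule C1_on_real[of _ _ "\<lambda>x. inverse (sqrt x) / 2"])
      (auto intro!: DERIV_real_sqrt continuous_intros)
qed (use assms in auto)

lemma continuous_on_frechet_derivative:
  assumes "C1_on U f" "continuous_on U v"
  shows "continuous_on U (\<lambda>x. frechet_derivative f (at x) (v x))"
proof -
  obtain f' where f': "\<forall>x\<in>U. (f has_derivative blinfun_apply (f' x)) (at x)" "continuous_on U f'"
    using assms unfolding C1_on_def by blast
  have "continuous_on U (\<lambda>x. f' x (v x))"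
    by (intro continuous_intros f' assms)
  moreover have "f' x (v x) = frechet_derivative f (at x) (v x)" if "x \<in> U" for x
    using frechet_derivative_at[OF f'(1)[rule_format, OF that]] by simp
  ultimately show ?thesis
    by (rule continuous_on_eq)
qed

lemma C1_on_frechet_derivative:
  assumes "C2_on U f" "C1_on U v" "open U"
  shows "C1_on U (\<lambda>x. frechet_derivative f (at x) (v x))"
proof -
  obtain f' where f': "\<forall>x\<in>U. (f has_derivative blinfun_apply (f' x)) (at x)" "C1_on U f'"
    using assms unfolding C2_on_def by blast
  have "C1_on U (\<lambda>x. f' x (v x))"
    by (intro C1_on_bilinear[OF bounded_bilinear_blinfun_apply] f' assms)
  then show ?thesis
    by (rule C1_on_cong[OF _ assms(3)]) (simp add: frechet_derivative_at[OF f'(1)[rule_format]])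
qed

lemma C2_on_bounded_linear:
  assumes "bounded_linear f"
  shows "C2_on U f"
  unfolding C2_on_def
  by (rule exI[of _ "\<lambda>x. Blinfun f"])
    (auto simp: bounded_linear_Blinfun_apply assms bounded_linear_imp_has_derivative)

lemma C2_on_add:
  assumes "C2_on U f" "C2_on U g"
  shows "C2_on U (\<lambda>x. f x + g x)"
proof -
  obtain f' g' where f': "\<forall>x\<in>U. (f has_derivative blinfun_apply (f' x)) (at x)" "C1_on U f'"
    and g': "\<forall>x\<in>U. (g has_derivative blinfun_apply (g' x)) (at x)" "C1_on U g'"
    using assms unfolding C2_on_def by blast
  show ?thesis
    unfolding C2_on_def
    by (rule exI[of _ "\<lambda>x. f' x + g' x"])
      (use f' g' in \<open>auto intro!: C1_on_add has_derivative_add simp: plus_blinfun.rep_eq\<close>)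
qed

lemma C2_on_compose:
  assumes "C2_on U f" "C2_on V g" "f ` U \<subseteq> V"
  shows "C2_on U (\<lambda>x. g (f x))"
proof -
  obtain f' g' where f': "\<forall>x\<in>U. (f has_derivative blinfun_apply (f' x)) (at x)" "C1_on U f'"
    and g': "\<forall>x\<in>V. (g has_derivative blinfun_apply (g' x)) (at x)" "C1_on V g'"
    using assms unfolding C2_on_def by blast
  have "((\<lambda>x. g (f x)) has_derivative blinfun_apply (g' (f x) o\<^sub>L f' x)) (at x)" if "x \<in> U" for x
    by (rule has_derivative_eq_rhs[OF has_derivative_compose[OF f'(1)[rule_format, OF that] g'(1)[rule_format]]])
      (use assms(3) that in auto)
  moreover have "C1_on U (\<lambda>x. g' (f x) o\<^sub>L f' x)"
    by (intro C1_on_bilinear[OF bounded_bilinear_blinfun_compose] f'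
      C1_on_compose[OF C2_on_imp_C1_on[OF assms(1)] g'(2) assms(3)])
  ultimately show ?thesis
    by (rule C2_onI)
qed

lemma C2_on_linear_compose:
  assumes "bounded_linear g" "C2_on U f"
  shows "C2_on U (\<lambda>x. g (f x))"
  using C2_on_compose[OF assms(2) C2_on_bounded_linear[OF assms(1)], of UNIV] by simp

section \<open>Calculus and determinants\<close>

text \<open>Inverse function theorem for \<open>(u, s) \<mapsto> (u, F (u, s))\<close>. The
  equivalence in the conclusion leaves no zeros in \<open>U'\<close> besides the graph, as a chart
  of a zero set requires.\<close>

lemma implicit_function_C2:
  fixes F :: "'a::euclidean_space \<times> real \<Rightarrow> real"
  assumes U: "open U" and F: "C2_on U F" and q0: "(u0, s0) \<in> U"
    and "frechet_derivative F (at (u0, s0)) (0, 1) \<noteq> 0" "F (u0, s0) = 0"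
  obtains U' V g where "open U'" "U' \<subseteq> U" "(u0, s0) \<in> U'" "open V" "C2_on V g"
    "\<And>u s. (u, s) \<in> U' \<and> F (u, s) = 0 \<longleftrightarrow> u \<in> V \<and> s = g u"
proof -
  obtain F' where F': "\<And>x. x \<in> U \<Longrightarrow> (F has_derivative blinfun_apply (F' x)) (at x)" "C1_on U F'"
    using F unfolding C2_on_def by blast
  have fF: "frechet_derivative F (at x) = blinfun_apply (F' x)" if "x \<in> U" for x
    using frechet_derivative_at[OF F'(1)[OF that]] by simp
  have contF': "continuous_on U F'"
    using C1_on_imp_continuous_on[OF F'(2)] .
  define U1 where "U1 = {q \<in> U. F' q (0, 1) \<noteq> 0}"
  have "continuous_on U (\<lambda>q. F' q (0, 1))"
    by (intro continuous_intros contF')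
  then have oU1: "open U1"
    using U continuous_open_preimage[of U "\<lambda>q. F' q (0, 1)" "- {0}"]
    by (auto simp: U1_def vimage_def Int_def)
  have q1: "(u0, s0) \<in> U1"
    using assms fF by (simp add: U1_def)
  define Ph where "Ph q = (fst q, F q)" for q
  have "C1_on U1 Ph"
    unfolding Ph_def
    by (intro C1_on_Pair C1_on_bounded_linear bounded_linear_fst C1_on_subset[OF C2_on_imp_C1_on[OF F]])
      (auto simp: U1_def)
  then obtain Ph' where Ph': "\<And>x. x \<in> U1 \<Longrightarrow> (Ph has_derivative blinfun_apply (Ph' x)) (at x)"
    "continuous_on U1 Ph'"
    unfolding C1_on_def by blast
  have Ph'_eq: "blinfun_apply (Ph' x) = (\<lambda>h. (fst h, F' x h))" if "x \<in> U1" for x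
  proof (rule has_derivative_unique[OF Ph'(1)[OF that]])
    show "(Ph has_derivative (\<lambda>h. (fst h, F' x h))) (at x)"
      unfolding Ph_def using that
      by (intro has_derivative_Pair F' bounded_linear_imp_has_derivative bounded_linear_fst) (auto simp: U1_def)
  qed
  define q where "q = (u0, s0)"
  \<comment> \<open>Inverse of \<open>h \<mapsto> (fst h, F' q h)\<close>, found by solving for the
    last coordinate; the inverse function theorem asks for it.\<close>
  define iv where "iv h = (fst h, (snd h - F' q (fst h, 0)) / F' q (0, 1))" for h
  have split: "F' x (a, b) = F' x (a, 0) + b * F' x (0, 1)" for x a b
    using blinfun.add_right[of "F' x" "(a, 0)" "b *\<^sub>R (0, 1)"] blinfun.scaleR_right[of "F' x" b "(0,1)"] by simp
  have "linear iv"
  proof (rule linearI)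
    fix x y :: "'a \<times> real" and c :: real
    have "F' q (fst x + fst y, 0) = F' q (fst x, 0) + F' q (fst y, 0)"
      using blinfun.add_right[of "F' q" "(fst x, 0)" "(fst y, 0)"] by simp
    then show "iv (x + y) = iv x + iv y"
      by (simp add: iv_def field_simps diff_divide_distrib add_divide_distrib)
    have "F' q (c *\<^sub>R fst x, 0) = c * F' q (fst x, 0)"
      using blinfun.scaleR_right[of "F' q" c "(fst x, 0)"] by simp
    then show "iv (c *\<^sub>R x) = c *\<^sub>R iv x"
      by (simp add: iv_def field_simps diff_divide_distrib)
  qed
  then have blin: "bounded_linear iv"
    by (rule linear_conv_bounded_linear[THEN iffD1])
  have q1': "q \<in> U1" "q \<in> U" "F' q (0, 1) \<noteq> 0"
    using q1 by (auto simp: q_def U1_def)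
  have "Blinfun iv o\<^sub>L Ph' q = id_blinfun"
  proof (rule blinfun_eqI)
    fix h
    show "blinfun_apply (Blinfun iv o\<^sub>L Ph' q) h = blinfun_apply id_blinfun h"
      using q1' split[of q "fst h" "snd h"]
      by (simp add: bounded_linear_Blinfun_apply[OF blin] Ph'_eq iv_def)
  qed
  from inverse_function_theorem[OF oU1 Ph' q1'(1) this]
  obtain U' V2 G G' where U': "open U'" "U' \<subseteq> U1" "q \<in> U'" and V2: "open V2" "Ph q \<in> V2"
    and hom: "homeomorphism U' V2 Ph G"
    and G': "\<And>y. y \<in> V2 \<Longrightarrow> (G has_derivative (G' y)) (at y)"
     "\<And>y. y \<in> V2 \<Longrightarrow> G' y = inv (blinfun_apply (Ph' (G y)))"
     "\<And>y. y \<in> V2 \<Longrightarrow> bij (blinfun_apply (Ph' (G y)))"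
    by blast
  \<comment> \<open>Points of \<open>V2\<close> with second component 0 correspond to the zeros of
    \<open>F\<close> in \<open>U'\<close>; \<open>g\<close> is the last coordinate of the local
    inverse there.\<close>
  define V where "V = (\<lambda>u. (u, 0)) -` V2"
  define g where "g u = snd (G (u, 0))" for u
  have oV: "open V"
    unfolding V_def by (intro open_vimage V2 continuous_intros)
  have Gm: "G y \<in> U'" "Ph (G y) = y" if "y \<in> V2" for y
    using hom that homeomorphism_image2[OF hom] homeomorphism_apply2[OF hom] by blast+
  have gU: "(u, g u) \<in> U'" "F (u, g u) = 0" "G (u, 0) = (u, g u)" if "u \<in> V" for u
  proof -
    have *: "G (u, 0) \<in> U'" "Ph (G (u, 0)) = (u, 0)"
      using that Gm by (auto simp: V_def)
    then show eq: "G (u, 0) = (u, g u)"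
      by (auto simp: Ph_def g_def prod_eq_iff)
    show "(u, g u) \<in> U'" "F (u, g u) = 0"
      using * unfolding eq by (auto simp: Ph_def)
  qed
  have iff: "(u, s) \<in> U' \<and> F (u, s) = 0 \<longleftrightarrow> u \<in> V \<and> s = g u" for u s
  proof
    assume *: "(u, s) \<in> U' \<and> F (u, s) = 0"
    then have "Ph (u, s) = (u, 0)" by (simp add: Ph_def)
    then have "(u, 0) \<in> V2" "G (u, 0) = (u, s)"
      using homeomorphism_image1[OF hom] homeomorphism_apply1[OF hom] * by (metis image_eqI)+
    then show "u \<in> V \<and> s = g u"
      by (simp add: V_def g_def)
  qed (use gU in auto)
  \<comment> \<open>Implicit differentiation: \<open>F' (u, g u) (h, g' u h) = 0\<close>. As
    \<open>g'\<close> is an expression in \<open>F'\<close> and \<open>g\<close>, regularity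
    bootstraps: \<open>g\<close> continuous makes \<open>g'\<close> continuous, so \<open>g\<close>
    is C^1, so \<open>g'\<close> is C^1.\<close>
  define g' where "g' u = (- inverse (F' (u, g u) (0, 1))) *\<^sub>R (F' (u, g u) o\<^sub>L Blinfun (\<lambda>h. (h, 0)))" for u
  have bl0: "bounded_linear (\<lambda>h. (h, 0))"
    by (intro bounded_linear_Pair bounded_linear_ident bounded_linear_zero)
  have g'_apply: "g' u h = - F' (u, g u) (h, 0) / F' (u, g u) (0, 1)" for u h
    by (simp add: g'_def blinfun.bilinear_simps bounded_linear_Blinfun_apply[OF bl0] divide_inverse)
  have dg: "(g has_derivative blinfun_apply (g' u)) (at u)" if u: "u \<in> V" for u
  proof -
    have y: "(u, 0) \<in> V2" using u by (simp add: V_def)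
    have qU: "(u, g u) \<in> U1" using gU[OF u] U' by blast
    then have nz: "F' (u, g u) (0, 1) \<noteq> 0" by (simp add: U1_def)
    have "(g has_derivative (\<lambda>h. snd (G' (u, 0) (h, 0)))) (at u)"
      unfolding g_def
      by (intro has_derivative_snd has_derivative_compose[where f = "\<lambda>u. (u, 0)", OF _ G'(1)[OF y]]
          bounded_linear_imp_has_derivative[OF bl0])
    moreover have "G' (u, 0) (h, 0) = (h, g' u h)" for h
    proof -
      have "Ph' (G (u, 0)) (h, g' u h) = (h, 0)"
        using split[of "(u, g u)" h "g' u h"] nz by (simp add: gU[OF u] Ph'_eq[OF qU] g'_apply)
      then show ?thesis
        using G'(2,3)[OF y] by (metis bij_inv_eq_iff)
    qed
    ultimately show ?thesis
      by simp
  qed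
  have contg: "continuous_on V g"
    by (intro continuous_at_imp_continuous_on ballI has_derivative_continuous[OF dg])
  have im: "(\<lambda>u. (u, g u)) ` V \<subseteq> U"
    using gU U' by (auto simp: U1_def)
  have nz: "F' (u, g u) (0, 1) \<noteq> 0" if "u \<in> V" for u
    using gU[OF that] U' by (auto simp: U1_def)
  have "continuous_on V g'"
    unfolding g'_def using nz im
    by (intro continuous_intros contg continuous_on_compose2[OF contF']) auto
  then have "C1_on V g"
    by (intro C1_onI[OF dg])
  then have pg: "C1_on V (\<lambda>u. (u, g u))"
    by (intro C1_on_Pair C1_on_id)
  have "C1_on V (\<lambda>u. F' (u, g u))"
    by (rule C1_on_compose[OF pg F'(2) im])
  then have "C1_on V g'"
    unfolding g'_def using nz
    by (intro C1_on_scaleR C1_on_minus C1_on_inverse C1_on_bilinear[OF bounded_bilinear_blinfun_apply]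
        C1_on_bilinear[OF bounded_bilinear_blinfun_compose] C1_on_const) auto
  then have "C2_on V g"
    by (intro C2_onI[OF dg])
  moreover have "U' \<subseteq> U" using U' by (auto simp: U1_def)
  ultimately show ?thesis
    using that[OF U'(1) _ _ oV _ iff] U'(3) by (auto simp: q_def)
qed

text \<open>The mean value theorem in direction \<open>v\<close> reduces the second difference to a
  difference of \<open>f'\<close> at two points. Both values are linearised at \<open>x\<close>, the
  only point where \<open>f'\<close> is known to be differentiable; the contributions of
  \<open>v\<close> cancel and \<open>h *\<^sub>R D w\<close> remains.\<close>

lemma second_difference_quotient_tendsto:
  fixes f :: "'a::real_normed_vector \<Rightarrow> real"
  assumes "open V" "x \<in> V" "\<And>y. y \<in> V \<Longrightarrow> (f has_derivative blinfun_apply (f' y)) (at y)"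
    and D: "(f' has_derivative D) (at x)"
  shows "((\<lambda>h. (f (x + h *\<^sub>R v + h *\<^sub>R w) - f (x + h *\<^sub>R v) - f (x + h *\<^sub>R w) + f x) / h\<^sup>2)
    \<longlongrightarrow> blinfun_apply (D w) v) (at_right 0)"
proof (rule tendstoI)
  fix e :: real assume e: "e > 0"
  interpret D: bounded_linear D using has_derivative_bounded_linear[OF D] .
  define C where "C = norm v + norm w"
  \<comment> \<open>Accuracy for the linearisation of \<open>f'\<close>: the final error is at most
    \<open>2 * k * C * norm v\<close>, which this \<open>k\<close> keeps within
    \<open>e / 2\<close>. The added ones avoid division by zero.\<close>
  define k where "k = e / (4 * (C + 1) * (norm v + 1))"
  have C0: "C \<ge> 0" by (simp add: C_def)
  have k0: "k > 0" using e C0 by (simp add: k_def add_nonneg_pos)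
  obtain d0 where d0: "d0 > 0" "\<And>y. norm (y - x) < d0 \<Longrightarrow> norm (f' y - f' x - D (y - x)) \<le> k * norm (y - x)"
    using D k0 unfolding has_derivative_at_alt by blast
  obtain d1 where d1: "d1 > 0" "ball x d1 \<subseteq> V"
    using assms(1,2) open_contains_ball by blast
  define d where "d = min d0 d1"
  have d: "d > 0" using d0 d1 by (simp add: d_def)
  \<comment> \<open>For \<open>h < B\<close> the whole parallelogram spanned at \<open>x\<close> by
    \<open>h *\<^sub>R v\<close> and \<open>h *\<^sub>R w\<close> stays within distance
    \<open>d\<close> of \<open>x\<close>.\<close>
  define B where "B = d / (C + 1)"
  have B: "B > 0" using d C0 by (simp add: B_def add_nonneg_pos)
  have "dist ((f (x + h *\<^sub>R v + h *\<^sub>R w) - f (x + h *\<^sub>R v) - f (x + h *\<^sub>R w) + f x) / h\<^sup>2) (D w v) < e"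
    if h: "0 < h" "h < B" for h
  proof -
    have near: "norm (s *\<^sub>R v + t *\<^sub>R w) < d" "norm (s *\<^sub>R v + t *\<^sub>R w) \<le> h * C"
      if "0 \<le> s" "s \<le> h" "0 \<le> t" "t \<le> h" for s t
    proof -
      have "norm (s *\<^sub>R v + t *\<^sub>R w) \<le> s * norm v + t * norm w"
        using norm_triangle_ineq[of "s *\<^sub>R v" "t *\<^sub>R w"] that by simp
      also have "\<dots> \<le> h * norm v + h * norm w"
        using that by (intro add_mono mult_right_mono) auto
      finally show le: "norm (s *\<^sub>R v + t *\<^sub>R w) \<le> h * C" by (simp add: C_def algebra_simps)
      have "h * C \<le> h * (C + 1)" using h by simp
      also have "\<dots> < d" using h C0 unfolding B_def by (simp add: pos_less_divide_eq add_nonneg_pos)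
      finally show "norm (s *\<^sub>R v + t *\<^sub>R w) < d" using le by simp
    qed
    have inV: "x + s *\<^sub>R v + t *\<^sub>R w \<in> V" if "0 \<le> s" "s \<le> h" "0 \<le> t" "t \<le> h" for s t
      using near(1)[OF that] d1 by (intro subsetD[OF d1(2)]) (auto simp: d_def dist_norm add.assoc simp flip: norm_minus_cancel[of "_ + _"])
    define \<psi> where "\<psi> s = f (x + s *\<^sub>R v + h *\<^sub>R w) - f (x + s *\<^sub>R v)" for s
    have "\<exists>z>0. z < h \<and> \<psi> h - \<psi> 0 = (h - 0) * (f' (x + z *\<^sub>R v + h *\<^sub>R w) v - f' (x + z *\<^sub>R v) v)"
    proof (rule MVT2[OF h(1)])
      fix s assume s: "0 \<le> s" "s \<le> h"
      have 1: "(f has_derivative f' (x + s *\<^sub>R v + h *\<^sub>R w)) (at (x + s *\<^sub>R v + h *\<^sub>R w))"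
        using inV[of s h] s h assms(3) by simp
      have 2: "(f has_derivative f' (x + s *\<^sub>R v)) (at (x + s *\<^sub>R v))"
        using inV[of s 0] s h assms(3) by simp
      have 3: "((\<lambda>s. x + s *\<^sub>R v + h *\<^sub>R w) has_derivative (\<lambda>t. t *\<^sub>R v)) (at s)"
        "((\<lambda>s. x + s *\<^sub>R v) has_derivative (\<lambda>t. t *\<^sub>R v)) (at s)"
        by (auto intro!: derivative_eq_intros)
      have "(\<psi> has_derivative (\<lambda>t. f' (x + s *\<^sub>R v + h *\<^sub>R w) (t *\<^sub>R v) - f' (x + s *\<^sub>R v) (t *\<^sub>R v))) (at s)"
        unfolding \<psi>_def
        by (intro has_derivative_diff has_derivative_compose[OF 3(1) 1] has_derivative_compose[OF 3(2) 2])
      then show "(\<psi> has_field_derivative (f' (x + s *\<^sub>R v + h *\<^sub>R w) v - f' (x + s *\<^sub>R v) v)) (at s)"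
        unfolding has_field_derivative_def
        by (rule has_derivative_eq_rhs) (simp add: fun_eq_iff blinfun.bilinear_simps algebra_simps)
    qed
    then obtain z where z: "0 < z" "z < h"
      and eq: "\<psi> h - \<psi> 0 = h * (f' (x + z *\<^sub>R v + h *\<^sub>R w) v - f' (x + z *\<^sub>R v) v)" by auto
    let ?y = "z *\<^sub>R v + h *\<^sub>R w" and ?y' = "z *\<^sub>R v + 0 *\<^sub>R w"
    have b1: "norm (f' (x + ?y) - f' x - D ?y) \<le> k * (h * C)"
      using d0(2)[of "x + ?y"] near[of z h] z h k0
      by (auto simp: d_def intro: order.trans mult_left_mono)
    have b2: "norm (f' (x + ?y') - f' x - D ?y') \<le> k * (h * C)"
      using d0(2)[of "x + ?y'"] near[of z 0] z h k0
      by (auto simp: d_def intro: order.trans mult_left_mono)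
    define E where "E = f' (x + ?y) - f' (x + ?y') - h *\<^sub>R D w"
    have "E = (f' (x + ?y) - f' x - D ?y) - (f' (x + ?y') - f' x - D ?y')"
      unfolding E_def by (simp add: D.add D.scaleR)
    then have nE: "norm E \<le> 2 * (k * (h * C))"
      using norm_triangle_ineq4[of "f' (x + ?y) - f' x - D ?y" "f' (x + ?y') - f' x - D ?y'"] b1 b2 by simp
    have "\<psi> h - \<psi> 0 = h * (h * D w v + E v)"
      unfolding eq E_def by (simp add: blinfun.bilinear_simps add.assoc)
    then have "(f (x + h *\<^sub>R v + h *\<^sub>R w) - f (x + h *\<^sub>R v) - f (x + h *\<^sub>R w) + f x) / h\<^sup>2 - D w v = E v / h"
      using h by (simp add: \<psi>_def field_simps power2_eq_square)
    moreover have "\<bar>E v / h\<bar> \<le> 2 * k * C * norm v"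
    proof -
      have "\<bar>E v\<bar> \<le> norm E * norm v" using norm_blinfun[of E v] by simp
      also have "\<dots> \<le> 2 * (k * (h * C)) * norm v" by (intro mult_right_mono nE) auto
      finally show ?thesis using h by (simp add: field_simps)
    qed
    moreover have "2 * k * C * norm v < e"
    proof -
      have "C * norm v \<le> (C + 1) * (norm v + 1)" using C0 by (intro mult_mono) auto
      then have "2 * k * (C * norm v) \<le> 2 * k * ((C + 1) * (norm v + 1))"
        using k0 by simp
      also have "\<dots> = e / 2"
      proof -
        have "(C + 1) * (norm v + 1) \<noteq> 0" using C0 by (simp add: add_nonneg_eq_0_iff)
        then show ?thesis unfolding k_def by (simp add: field_simps)
      qed
      finally show ?thesis using e by (simp add: mult.assoc)
    qed
    ultimately show ?thesis by (simp add: dist_real_def)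
  qed
  then show "\<forall>\<^sub>F h in at_right 0. dist ((f (x + h *\<^sub>R v + h *\<^sub>R w) - f (x + h *\<^sub>R v) - f (x + h *\<^sub>R w) + f x) / h\<^sup>2) (D w v) < e"
    unfolding eventually_at_right_field using B by auto
qed

text \<open>The second difference quotient is symmetric in \<open>v\<close> and \<open>w\<close>,
  hence so is its limit.\<close>

lemma second_derivative_symmetric:
  fixes f :: "'a::real_normed_vector \<Rightarrow> real"
  assumes "open V" "x \<in> V" "\<And>y. y \<in> V \<Longrightarrow> (f has_derivative blinfun_apply (f' y)) (at y)"
    and D: "(f' has_derivative D) (at x)"
  shows "blinfun_apply (D w) v = blinfun_apply (D v) w"
proof -
  have "((\<lambda>h. (f (x + h *\<^sub>R v + h *\<^sub>R w) - f (x + h *\<^sub>R v) - f (x + h *\<^sub>R w) + f x) / h\<^sup>2)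
    \<longlongrightarrow> blinfun_apply (D v) w) (at_right 0)"
    using second_difference_quotient_tendsto[OF assms, of w v] by (simp add: algebra_simps)
  then show ?thesis
    using tendsto_unique[OF _ second_difference_quotient_tendsto[OF assms, of v w]] by simp
qed

section \<open>Determinants of rank-one perturbations\<close>

lemma sum_delta_plus:
  fixes f g :: "'i::finite \<Rightarrow> real"
  shows "(\<Sum>l\<in>UNIV. f l * ((if l = i then 1 else 0) + g l)) = f i + (\<Sum>l\<in>UNIV. f l * g l)"
proof -
  have "(\<Sum>l\<in>UNIV. f l * ((if l = i then 1 else 0) + g l)) =
    (\<Sum>l\<in>UNIV. (if l = i then f l else 0) + f l * g l)"
    by (intro sum.cong refl) (simp add: algebra_simps)
  then show ?thesis by (simp add: sum.distrib)
qed

text \<open>Expand row \<open>k\<close> in the standard basis: every term except the one for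
  \<open>axis k 1\<close> has two equal rows.\<close>

lemma det_replace_row:
  fixes c :: "real^'n"
  shows "det (\<chi> i. if i = k then c else axis i 1) = c $ k"
proof -
  have c: "c = (\<Sum>j\<in>UNIV. (c $ j) *s axis j 1)"
    by (simp add: vec_eq_iff axis_def if_distrib cong: if_cong)
  have "det (\<chi> i. if i = k then c else axis i 1) =
    det (\<chi> i. if i = k then (\<Sum>j\<in>UNIV. (c $ j) *s axis j 1) else axis i 1)"
    by (subst c) (rule refl)
  also have "\<dots> = (\<Sum>j\<in>UNIV. det (\<chi> i. if i = k then (c $ j) *s axis j 1 else axis i 1))"
    by (rule det_linear_row_sum) simp
  also have "\<dots> = (\<Sum>j\<in>UNIV. c $ j * det (\<chi> i. if i = k then axis j 1 else axis i 1))"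
    by (simp add: det_row_mul)
  also have "\<dots> = (\<Sum>j\<in>UNIV. if j = k then c $ j else 0)"
  proof (intro sum.cong refl)
    fix j
    have I: "(\<chi> i. if i = k then axis k 1 else axis i 1) = (mat 1 :: real^'n^'n)"
      by (simp add: vec_eq_iff mat_def axis_def)
    have "det (\<chi> i. if i = k then axis j 1 else axis i 1) = (0::real)" if "j \<noteq> k"
      by (rule det_identical_rows[OF that]) (use that in \<open>simp add: row_def\<close>)
    then show "c $ j * det (\<chi> i. if i = k then axis j 1 else axis i 1) = (if j = k then c $ j else 0)"
      using I by (cases "j = k") (auto simp: det_I)
  qed
  finally show ?thesis by simp
qed

text \<open>Matrix determinant lemma. If \<open>u $ k \<noteq> 0\<close>, the basis with
  \<open>u\<close> in place of the \<open>k\<close>-th unit vector turns the perturbation into a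
  change of one row: \<open>?A ** P = P ** R\<close>, and \<open>det_replace_row\<close> evaluates
  both \<open>P\<close> and \<open>R\<close>.\<close>

lemma det_identity_plus_rank_one:
  fixes u v :: "real^'n"
  shows "det (\<chi> i j. (if i = j then 1 else 0) + u $ i * v $ j) = 1 + u \<bullet> v"
proof (cases "u = 0")
  case True
  have "(\<chi> i j. (if i = j then 1 else 0) + u $ i * v $ j) = (mat 1 :: real^'n^'n)"
    by (simp add: vec_eq_iff mat_def True)
  then show ?thesis by (simp add: True det_I)
next
  case False
  then obtain k where k: "u $ k \<noteq> 0" by (auto simp: vec_eq_iff)
  define P where "P = transpose (\<chi> i. if i = k then u else axis i 1)"
  have P: "P $ i $ j = (if j = k then u $ i else if i = j then 1 else 0)" for i j
    by (simp add: P_def transpose_def axis_def)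
  have detP: "det P = u $ k"
    unfolding P_def det_transpose det_replace_row ..
  define w where "w = transpose P *v v"
  define R where "R = (\<chi> i. if i = k then axis k 1 + w else axis i 1)"
  let ?A = "\<chi> i j. (if i = j then 1 else 0) + u $ i * v $ j"
  have wj: "w $ j = (\<Sum>l\<in>UNIV. v $ l * P $ l $ j)" for j
    by (simp add: w_def matrix_vector_mult_def transpose_def mult.commute)
  have "?A ** P = P ** R"
  proof -
    have "(?A ** P) $ i $ j = P $ i $ j + u $ i * w $ j" for i j
    proof -
      have "(?A ** P) $ i $ j = (\<Sum>l\<in>UNIV. P $ l $ j * ((if l = i then 1 else 0) + u $ i * v $ l))"
        by (simp add: matrix_matrix_mult_def mult.commute eq_commute[of i])
      then show ?thesis
        by (simp add: sum_delta_plus wj sum_distrib_left mult_ac)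
    qed
    moreover have "(P ** R) $ i $ j = P $ i $ j + u $ i * w $ j" for i j
    proof -
      have e: "P $ i $ l * (if l = k then w $ j else 0) = (if l = k then P $ i $ l * w $ j else 0)" for l
        by simp
      have "(P ** R) $ i $ j = (\<Sum>l\<in>UNIV. P $ i $ l * ((if l = j then 1 else 0) + (if l = k then w $ j else 0)))"
        unfolding matrix_matrix_mult_def R_def
        by (simp, intro sum.cong refl) (auto simp: axis_def)
      also have "\<dots> = P $ i $ j + (\<Sum>l\<in>UNIV. if l = k then P $ i $ l * w $ j else 0)"
        by (simp only: sum_delta_plus e)
      also have "\<dots> = P $ i $ j + u $ i * w $ j"
        by (simp add: P)
      finally show ?thesis .
    qed
    ultimately show ?thesis by (simp add: vec_eq_iff)
  qed
  then have "det (?A ** P) = det (P ** R)"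
    by (rule arg_cong)
  then have "det ?A * det P = det P * det R"
    by (simp only: det_mul)
  then have "det ?A = det R" using detP k by simp
  also have "\<dots> = 1 + w $ k"
    unfolding R_def det_replace_row by simp
  also have "w $ k = u \<bullet> v"
    by (simp add: wj P inner_vec_def mult.commute)
  finally show ?thesis .
qed

text \<open>The matrix is the product of \<open>transpose A\<close>, the identity plus the square of
  \<open>\<gamma>\<close>, and \<open>A\<close>. It is the Gram matrix of vectors that consist of a
  column of \<open>A\<close> and one further component depending on it linearly through
  \<open>\<gamma>\<close>.\<close>

lemma det_gram_plus_rank_one:
  fixes A :: "real^'n^'n" and \<gamma> :: "real^'n"
  shows "det (\<chi> i j. column i A \<bullet> column j A + (\<gamma> \<bullet> column i A) * (\<gamma> \<bullet> column j A)) =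
    (det A)\<^sup>2 * (1 + \<gamma> \<bullet> \<gamma>)"
proof -
  let ?R = "\<chi> i j. (if i = j then 1 else 0) + \<gamma> $ i * \<gamma> $ j"
  have "(\<chi> i j. column i A \<bullet> column j A + (\<gamma> \<bullet> column i A) * (\<gamma> \<bullet> column j A)) = transpose A ** ?R ** A"
    (is "?G = _")
  proof -
    have "(transpose A ** ?R ** A) $ i $ j = ?G $ i $ j" for i j
    proof -
      have "(transpose A ** ?R ** A) $ i $ j = (\<Sum>l\<in>UNIV. (\<Sum>m\<in>UNIV. A $ m $ i * ((if m = l then 1 else 0) + \<gamma> $ m * \<gamma> $ l)) * A $ l $ j)"
        by (simp add: matrix_matrix_mult_def transpose_def)
      also have "\<dots> = (\<Sum>l\<in>UNIV. A $ l $ i * A $ l $ j + (\<gamma> \<bullet> column i A) * (\<gamma> $ l * A $ l $ j))"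
        unfolding sum_delta_plus
        by (intro sum.cong refl)
          (simp add: inner_vec_def column_def algebra_simps sum_distrib_left sum_distrib_right)
      also have "\<dots> = ?G $ i $ j"
        by (simp add: sum.distrib inner_vec_def column_def sum_distrib_left)
      finally show ?thesis .
    qed
    then show ?thesis by (simp add: vec_eq_iff)
  qed
  then show ?thesis
    by (simp add: det_mul det_transpose det_identity_plus_rank_one power2_eq_square)
qed


text \<open>Difference quotients integrate to zero by translation invariance of Lebesgue measure,
  and dominated convergence passes to the derivative. Applied to one coordinate at a time, this
  takes the place of the divergence theorem.\<close>

lemma integral_directional_derivative_zero:
  fixes f :: "'a::euclidean_space \<Rightarrow> real"
  assumes f: "C1_on UNIV f" and K: "compact K" and zero: "\<And>x. x \<notin> K \<Longrightarrow> f x = 0"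
  shows "integrable lborel (\<lambda>x. frechet_derivative f (at x) v)"
    and "(\<integral>x. frechet_derivative f (at x) v \<partial>lborel) = 0"
proof -
  let ?D = "\<lambda>x. frechet_derivative f (at x) v"
  define h where "h n = inverse (real (Suc n))" for n
  define q where "q n x = (f (x + h n *\<^sub>R v) - f x) / h n" for n x
  have h: "h n > 0" "h n \<le> 1" for n by (auto simp: h_def field_simps)
  have cD: "continuous_on UNIV ?D"
    by (intro continuous_on_frechet_derivative[OF f] continuous_intros)
  have cf: "continuous_on UNIV f"
    by (rule C1_on_imp_continuous_on[OF f])
  have D0: "?D x = 0" if "x \<notin> K" for x
  proof -
    have "open (- K)" using K compact_imp_closed by auto
    then have "(f has_derivative (\<lambda>_. 0)) (at x)"
      by (rule has_derivative_transform_within_open[OF has_derivative_const]) (use that zero in auto)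
    from frechet_derivative_at[OF this] show ?thesis by metis
  qed
  have "bounded (?D ` K)"
    by (intro compact_imp_bounded compact_continuous_image K continuous_on_subset[OF cD]) auto
  then obtain B0 where B0: "\<And>x. x \<in> K \<Longrightarrow> \<bar>?D x\<bar> \<le> B0"
    unfolding bounded_iff by auto
  define B where "B = max B0 0"
  have B: "\<bar>?D x\<bar> \<le> B" "B \<ge> 0" for x
    using B0[of x] D0[of x] by (cases "x \<in> K"; auto simp: B_def)+
  \<comment> \<open>The steps \<open>h n\<close> are at most 1, so all difference quotients vanish
    outside this sweep of \<open>K\<close> along \<open>v\<close>, and
    \<open>B * indicator C x\<close> dominates them.\<close>
  define C where "C = (\<lambda>(x, t). x - t *\<^sub>R v) ` (K \<times> {0..1})"
  have cC: "compact C"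
    unfolding C_def by (intro compact_continuous_image compact_Times K)
      (auto simp: case_prod_unfold intro!: continuous_intros)
  have q_bound: "\<bar>q n x\<bar> \<le> B * indicator C x" for n x
  proof (cases "x \<in> C")
    case True
    have "norm (f (x + h n *\<^sub>R v) - f (x + 0 *\<^sub>R v)) \<le> B * norm (h n - 0)"
    proof (rule differentiable_bound[where S = UNIV and f' = "\<lambda>t s. frechet_derivative f (at (x + t *\<^sub>R v)) (s *\<^sub>R v)"])
      fix t :: real
      have "((\<lambda>t. x + t *\<^sub>R v) has_derivative (\<lambda>s. s *\<^sub>R v)) (at t)"
        by (auto intro!: derivative_eq_intros)
      from has_derivative_compose[OF this C1_on_has_derivative[OF f UNIV_I]]
      show d: "((\<lambda>t. f (x + t *\<^sub>R v)) has_derivative (\<lambda>s. frechet_derivative f (at (x + t *\<^sub>R v)) (s *\<^sub>R v))) (at t)" .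
      have "linear (frechet_derivative f (at (x + t *\<^sub>R v)))"
        by (intro linear_frechet_derivative C1_on_differentiable[OF f]) auto
      then have "norm (frechet_derivative f (at (x + t *\<^sub>R v)) (s *\<^sub>R v)) \<le> B * norm s" for s
        using mult_right_mono[OF B(1)[of "x + t *\<^sub>R v"], of "\<bar>s\<bar>"] by (simp add: linear_cmul abs_mult mult.commute)
      then show "onorm (\<lambda>s. frechet_derivative f (at (x + t *\<^sub>R v)) (s *\<^sub>R v)) \<le> B"
        by (intro onorm_bound B(2)) auto
    qed auto
    then show ?thesis
      using True h[of n] by (simp add: q_def field_simps)
  next
    case False
    have "x \<notin> K"
      using False unfolding C_def by (force simp: image_iff intro!: bexI[of _ "(x, 0)"])
    moreover have "x + h n *\<^sub>R v \<notin> K"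
      using False h[of n] unfolding C_def by (force simp: image_iff intro!: bexI[of _ "(x + h n *\<^sub>R v, h n)"])
    ultimately show ?thesis
      using False zero by (simp add: q_def)
  qed
  have fint: "integrable lborel f"
  proof -
    have "integrable lborel (\<lambda>x. indicator K x *\<^sub>R f x)"
      by (intro borel_integrable_compact K continuous_on_subset[OF cf]) auto
    moreover have "(\<lambda>x. indicator K x *\<^sub>R f x) = f"
      using zero by (auto simp: fun_eq_iff indicator_def)
    ultimately show ?thesis by simp
  qed
  have mf: "f \<in> borel_measurable borel" using cf by (rule borel_measurable_continuous_onI)
  have shift: "integrable lborel (\<lambda>x. f (x + c))" "(\<integral>x. f (x + c) \<partial>lborel) = (\<integral>x. f x \<partial>lborel)" for c
  proof -
    have "integrable (distr lborel borel ((+) c)) f"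
      using fint by (simp add: lborel_distr_plus)
    then show "integrable lborel (\<lambda>x. f (x + c))"
      by (subst (asm) integrable_distr_eq) (auto simp: mf add.commute)
    have "(\<integral>x. f x \<partial>distr lborel borel ((+) c)) = (\<integral>x. f (c + x) \<partial>lborel)"
      by (rule integral_distr) (auto simp: mf)
    then show "(\<integral>x. f (x + c) \<partial>lborel) = (\<integral>x. f x \<partial>lborel)"
      by (simp add: lborel_distr_plus add.commute)
  qed
  have q_int: "(\<integral>x. q n x \<partial>lborel) = 0" for n
    unfolding q_def using shift fint by simp
  have lim: "(\<lambda>n. q n x) \<longlonglongrightarrow> ?D x" for x
  proof -
    have 1: "((\<lambda>t. x + t *\<^sub>R v) has_derivative (\<lambda>s. s *\<^sub>R v)) (at 0)"
      by (auto intro!: derivative_eq_intros)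
    have "(f has_derivative frechet_derivative f (at x)) (at (x + 0 *\<^sub>R v))"
      using C1_on_has_derivative[OF f UNIV_I, of x] by simp
    from has_derivative_compose[OF 1 this]
    have "((\<lambda>t. f (x + t *\<^sub>R v)) has_derivative (\<lambda>s. frechet_derivative f (at x) (s *\<^sub>R v))) (at 0)" .
    moreover have "linear (frechet_derivative f (at x))"
      by (intro linear_frechet_derivative C1_on_differentiable[OF f]) auto
    ultimately have "((\<lambda>t. f (x + t *\<^sub>R v)) has_field_derivative ?D x) (at 0)"
      unfolding has_field_derivative_def
      by (auto elim!: has_derivative_eq_rhs simp: linear_cmul fun_eq_iff mult.commute)
    then have "((\<lambda>t. (f (x + t *\<^sub>R v) - f x) / t) \<longlongrightarrow> ?D x) (at 0)"
      unfolding DERIV_def by simp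
    moreover have "h \<longlonglongrightarrow> 0"
      using LIMSEQ_inverse_real_of_nat unfolding h_def[abs_def] .
    then have "filterlim h (at 0) sequentially"
      unfolding filterlim_at using h(1)[THEN less_imp_neq, symmetric] by (auto intro!: always_eventually)
    ultimately show ?thesis
      unfolding q_def by (rule filterlim_compose)
  qed
  have meas: "?D \<in> borel_measurable lborel" "\<And>n. q n \<in> borel_measurable lborel"
    unfolding q_def using cD cf h(1)[THEN less_imp_neq, symmetric]
    by (auto intro!: borel_measurable_continuous_onI continuous_intros continuous_on_compose2[OF cf])
  have dom: "integrable lborel (\<lambda>x. B * indicator C x)"
    using cC by (intro integrable_mult_right integrable_real_indicator)
      (use emeasure_bounded_finite[OF compact_imp_bounded[OF cC]] in \<open>auto simp: borel_compact\<close>)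
  have bd: "AE x in lborel. norm (q n x) \<le> B * indicator C x" for n
    using q_bound by simp
  show "integrable lborel ?D"
    by (rule integrable_dominated_convergence[where s = q and w = "\<lambda>x. B * indicator C x"])
      (use meas dom lim bd in auto)
  have "(\<lambda>n. \<integral>x. q n x \<partial>lborel) \<longlonglongrightarrow> (\<integral>x. ?D x \<partial>lborel)"
    by (rule integral_dominated_convergence[where s = q and w = "\<lambda>x. B * indicator C x"])
      (use meas dom lim bd in auto)
  then show "(\<integral>x. ?D x \<partial>lborel) = 0"
    by (simp add: q_int LIMSEQ_const_iff)
qed

text \<open>Building block for cut-off functions: C^1 bumps suffice, and squaring the positive part
  removes its corner at 0.\<close>

lemma C1_on_positive_part_square: "C1_on UNIV (\<lambda>x::real. (max 0 x)\<^sup>2)"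
proof (rule C1_on_real)
  show "((\<lambda>x. (max 0 x)\<^sup>2) has_field_derivative 2 * max 0 x) (at x)" for x :: real
  proof (cases "x = 0")
    case True
    have "((\<lambda>h::real. (max 0 h)\<^sup>2 / h) \<longlongrightarrow> 0) (at 0)"
    proof (rule Lim_null_comparison)
      show "\<forall>\<^sub>F h in at 0. norm ((max 0 h)\<^sup>2 / h) \<le> \<bar>h\<bar>"
        by (rule always_eventually) (auto simp: max_def power2_eq_square)
      show "((\<lambda>h::real. \<bar>h\<bar>) \<longlongrightarrow> 0) (at 0)"
        by (auto intro!: tendsto_eq_intros)
    qed
    then show ?thesis
      unfolding True DERIV_def by simp
  next
    case False
    show ?thesis
    proof (cases "x > 0")
      case True
      have "((\<lambda>x. x\<^sup>2) has_field_derivative 2 * max 0 x) (at x)"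
        using True by (auto intro!: derivative_eq_intros)
      then show ?thesis
        by (rule has_field_derivative_transform_within_open[of _ _ _ "{0<..}"]) (use True in auto)
    next
      case F: False
      have "((\<lambda>x. 0) has_field_derivative 2 * max 0 x) (at x)"
        using F by (auto intro!: derivative_eq_intros)
      then show ?thesis
        by (rule has_field_derivative_transform_within_open[of _ _ _ "{..<0}"]) (use F False in auto)
    qed
  qed
qed (intro continuous_intros)

text \<open>The trace read in the oblique splitting of the space into the range of \<open>L\<close>
  and the line of \<open>w\<close>, with coordinate maps \<open>P\<close> and \<open>s\<close>. Each
  \<open>D b\<close> is decomposed, and linearity then recombines the sums over
  \<open>Basis\<close>.\<close>

lemma trace_split:
  fixes D :: "'a::euclidean_space \<Rightarrow> 'a" and P :: "'a \<Rightarrow> real^'m"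
  assumes D: "linear D" and P: "linear P" and s: "linear s"
    and decomp: "\<And>v. v = L (P v) + s v *\<^sub>R w" and L: "linear L"
  shows "(\<Sum>b\<in>Basis. D b \<bullet> b) = (\<Sum>i\<in>UNIV. P (D (L (axis i 1))) $ i) + s (D w)"
proof -
  have Lx: "L x = (\<Sum>i\<in>UNIV. x $ i *\<^sub>R L (axis i 1))" for x
  proof -
    have "L x = L (\<Sum>i\<in>UNIV. x $ i *\<^sub>R axis i 1)"
      by (simp add: basis_expansion scalar_mult_eq_scaleR[symmetric])
    then show ?thesis by (simp add: linear_sum[OF L] linear_cmul[OF L])
  qed
  have "(\<Sum>b\<in>Basis. D b \<bullet> b) = (\<Sum>b\<in>Basis. (\<Sum>i\<in>UNIV. P (D b) $ i * (L (axis i 1) \<bullet> b)) + s (D b) * (w \<bullet> b))"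
  proof (intro sum.cong refl)
    fix b
    show "D b \<bullet> b = (\<Sum>i\<in>UNIV. P (D b) $ i * (L (axis i 1) \<bullet> b)) + s (D b) * (w \<bullet> b)"
      by (subst decomp[of "D b"], subst Lx) (simp add: inner_add_left inner_sum_left)
  qed
  also have "\<dots> = (\<Sum>i\<in>UNIV. \<Sum>b\<in>Basis. (L (axis i 1) \<bullet> b) * P (D b) $ i) + (\<Sum>b\<in>Basis. (w \<bullet> b) * s (D b))"
    by (simp add: sum.distrib mult.commute) (rule sum.swap)
  also have "\<dots> = (\<Sum>i\<in>UNIV. P (D (L (axis i 1))) $ i) + s (D w)"
  proof -
    have "(\<Sum>b\<in>Basis. (w \<bullet> b) * s (D b)) = s (D w)"
      by (subst (2) euclidean_representation[of w, symmetric])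
        (simp add: linear_sum[OF D] linear_cmul[OF D] linear_sum[OF s] linear_cmul[OF s])
    moreover have "(\<Sum>b\<in>Basis. (x \<bullet> b) * P (D b) $ i) = P (D x) $ i" for x i
      by (subst (2) euclidean_representation[of x, symmetric])
        (simp add: linear_sum[OF D] linear_cmul[OF D] linear_sum[OF P] linear_cmul[OF P])
    ultimately show ?thesis by simp
  qed
  finally show ?thesis .
qed

section \<open>The frame and the dilation field\<close>

text \<open>Coefficients along the \<open>heis_X j\<close>. These fields have constant x and y
  parts, so no base point enters, in contrast to the coefficient of \<open>heis_T\<close>.\<close>

definition hcomp :: "'n::finite heis \<Rightarrow> real^('n + 'n)" where
  "hcomp v = (\<chi> j. case j of Inl i \<Rightarrow> fst v $ i | Inr i \<Rightarrow> fst (snd v) $ i)"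

text \<open>The contact form dt + (y dx - x dy) / 2 at \<open>q\<close>, whose kernel is the
  horizontal space.\<close>

definition vcomp :: "'n::finite heis \<Rightarrow> 'n heis \<Rightarrow> real" where
  "vcomp q v = snd (snd v) + (fst (snd q) \<bullet> fst v - fst q \<bullet> fst (snd v)) / 2"

lemma sum_UNIV_sum_type:
  fixes f :: "'a::finite + 'b::finite \<Rightarrow> 'c::comm_monoid_add"
  shows "(\<Sum>j\<in>UNIV. f j) = (\<Sum>i\<in>UNIV. f (Inl i)) + (\<Sum>i\<in>UNIV. f (Inr i))"
  by (simp add: UNIV_Plus_UNIV[symmetric] sum.Plus del: UNIV_Plus_UNIV)

lemma hcomp_inner: "hcomp v \<bullet> hcomp v' = fst v \<bullet> fst v' + fst (snd v) \<bullet> fst (snd v')"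
  by (simp add: hcomp_def inner_vec_def sum_UNIV_sum_type)

lemma heis_metric_eq: "heis_metric q v v' = hcomp v \<bullet> hcomp v' + vcomp q v * vcomp q v'"
  by (cases q; cases v; cases v') (simp add: hcomp_inner vcomp_def)

lemma hcomp_linear: "linear hcomp"
  by (rule linearI) (auto simp: hcomp_def vec_eq_iff split: sum.split)

lemma vcomp_linear: "linear (vcomp q)"
  by (rule linearI) (auto simp: vcomp_def algebra_simps add_divide_distrib diff_divide_distrib)

lemmas hcomp_simps [simp] = linear_0[OF hcomp_linear] linear_add[OF hcomp_linear] linear_diff[OF hcomp_linear]
  linear_cmul[OF hcomp_linear] linear_neg[OF hcomp_linear]
lemmas vcomp_simps [simp] = linear_0[OF vcomp_linear] linear_add[OF vcomp_linear] linear_diff[OF vcomp_linear]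
  linear_cmul[OF vcomp_linear] linear_neg[OF vcomp_linear]

lemma bounded_linear_hcomp_nth: "bounded_linear (\<lambda>q. hcomp q $ j)"
  using bounded_linear_compose[OF bounded_linear_vec_nth linear_conv_bounded_linear[THEN iffD1, OF hcomp_linear]] .

lemma hcomp_heis_X [simp]: "hcomp (heis_X j q) = axis j 1"
  by (cases q; cases j) (auto simp: hcomp_def vec_eq_iff axis_def split: sum.split)

lemma vcomp_heis_X [simp]: "vcomp q (heis_X j q) = 0"
  by (cases q; cases j) (auto simp: vcomp_def inner_axis)

lemma hcomp_heis_T [simp]: "hcomp heis_T = 0"
  by (auto simp: hcomp_def heis_T_def vec_eq_iff split: sum.split)

lemma vcomp_heis_T [simp]: "vcomp q heis_T = 1"
  by (auto simp: vcomp_def heis_T_def)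

lemma heis_vec_eqI: "hcomp v = hcomp v' \<Longrightarrow> vcomp q v = vcomp q v' \<Longrightarrow> v = v'"
proof -
  assume h: "hcomp v = hcomp v'" and v: "vcomp q v = vcomp q v'"
  have "fst v $ i = fst v' $ i" "fst (snd v) $ i = fst (snd v') $ i" for i
    using arg_cong[OF h, of "\<lambda>x. x $ Inl i"] arg_cong[OF h, of "\<lambda>x. x $ Inr i"] by (simp_all add: hcomp_def)
  then have "fst v = fst v'" "fst (snd v) = fst (snd v')" by (simp_all add: vec_eq_iff)
  with v show ?thesis by (auto simp: vcomp_def prod_eq_iff)
qed

lemma hcomp_frame_sum [simp]: "hcomp (\<Sum>j\<in>UNIV. c j *\<^sub>R heis_X j q) = (\<chi> j. c j)"
  by (simp add: linear_sum[OF hcomp_linear] vec_eq_iff axis_def if_distrib cong: if_cong)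

lemma vcomp_frame_sum [simp]: "vcomp q (\<Sum>j\<in>UNIV. c j *\<^sub>R heis_X j q) = 0"
  by (simp add: linear_sum[OF vcomp_linear])

lemma heis_frame_expansion: "v = (\<Sum>j\<in>UNIV. hcomp v $ j *\<^sub>R heis_X j q) + vcomp q v *\<^sub>R heis_T"
  by (rule heis_vec_eqI[of _ _ q]) simp_all

lemma linear_heis_frame:
  fixes h :: "'n::finite heis \<Rightarrow> 'b::real_vector"
  assumes "linear h"
  shows "h v = (\<Sum>j\<in>UNIV. hcomp v $ j *\<^sub>R h (heis_X j q)) + vcomp q v *\<^sub>R h heis_T"
  by (subst heis_frame_expansion[of v q]) (simp add: linear_add[OF assms] linear_sum[OF assms] linear_cmul[OF assms])

lemma metric_heis_X [simp]: "heis_metric q v (heis_X j q) = hcomp v $ j"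
  by (simp add: heis_metric_eq inner_axis)

lemma hcomp_hor_normal [simp]: "hcomp (hor_normal \<nu> p) = hcomp (\<nu> p)"
  and vcomp_hor_normal [simp]: "vcomp p (hor_normal \<nu> p) = 0"
  by (simp_all add: hor_normal_def)

lemma hor_W_eq: "hor_W \<nu> p = norm (hcomp (\<nu> p))"
  by (simp add: hor_W_def heis_metric_eq norm_eq_sqrt_inner)

lemma hcomp_unit_hor_normal: "hcomp (unit_hor_normal \<nu> p) = hcomp (\<nu> p) /\<^sub>R norm (hcomp (\<nu> p))"
  and vcomp_unit_hor_normal [simp]: "vcomp p (unit_hor_normal \<nu> p) = 0"
  by (simp_all add: unit_hor_normal_def hor_W_eq)

lemma omega_bar_eq: "omega_bar \<nu> p = vcomp p (\<nu> p) / norm (hcomp (\<nu> p))"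
  by (simp add: omega_bar_def hor_W_eq heis_metric_eq)

lemma vcomp_zeta_field [simp]: "vcomp q (zeta_field p0 q) = 0"
  and hcomp_zeta_field [simp]: "hcomp (zeta_field p0 q) = hcomp q - hcomp p0"
proof -
  obtain x0 y0 t0 x y t where p: "p0 = (x0, y0, t0)" "q = (x, y, t)"
    by (cases p0; cases q)
  have "zeta_field p0 q = (\<Sum>j\<in>UNIV. (hcomp q - hcomp p0) $ j *\<^sub>R heis_X j q)"
    by (simp add: p sum_UNIV_sum_type sum.distrib[symmetric] hcomp_def)
  then show "vcomp q (zeta_field p0 q) = 0" "hcomp (zeta_field p0 q) = hcomp q - hcomp p0"
    by (simp_all only: vcomp_frame_sum hcomp_frame_sum) (simp add: vec_eq_iff)
qed

text \<open>The generator of the dilations centred at \<open>p0\<close>, which is affine in coordinates.\<close>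

definition dilation_field :: "'n::finite heis \<Rightarrow> 'n heis \<Rightarrow> 'n heis" where
  "dilation_field p0 p = zeta_field p0 p + f_coeff p0 p *\<^sub>R heis_T"

text \<open>Derivative of the field whose coordinate expression is (x - x0, y - y0, 2 (t - t0) +
  (<x, y0> - <x0, y>) / 2).\<close>

definition dilation_linear :: "'n::finite heis \<Rightarrow> 'n heis \<Rightarrow> 'n heis" where
  "dilation_linear p0 v =
    (fst v, fst (snd v), 2 * snd (snd v) + (fst v \<bullet> fst (snd p0) - fst p0 \<bullet> fst (snd v)) / 2)"

definition heis_X_linear :: "'n::finite + 'n \<Rightarrow> 'n heis \<Rightarrow> 'n heis" where
  "heis_X_linear j v = (0, 0, case j of Inl i \<Rightarrow> - (fst (snd v) $ i) / 2 | Inr i \<Rightarrow> (fst v $ i) / 2)"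

lemma hcomp_dilation_field [simp]: "hcomp (dilation_field p0 q) = hcomp q - hcomp p0"
  and vcomp_dilation_field [simp]: "vcomp q (dilation_field p0 q) = f_coeff p0 q"
  by (simp_all add: dilation_field_def)

lemma dilation_field_affine: "dilation_field p0 q = dilation_linear p0 (q - p0)"
proof (rule heis_vec_eqI[of _ _ q])
  show "hcomp (dilation_field p0 q) = hcomp (dilation_linear p0 (q - p0))"
    by (simp add: dilation_linear_def) (simp add: hcomp_def vec_eq_iff split: sum.split)
  show "vcomp q (dilation_field p0 q) = vcomp q (dilation_linear p0 (q - p0))"
    unfolding vcomp_dilation_field
    by (cases p0; cases q) (simp add: dilation_linear_def vcomp_def inner_diff_left inner_diff_right inner_commute field_simps)
qed

lemma heis_X_affine: "heis_X j q = heis_X j 0 + heis_X_linear j q"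
  by (cases q; cases j) (simp_all add: heis_X_linear_def zero_prod_def)

lemma dilation_linear_linear: "linear (dilation_linear p0)"
  by (rule linearI) (auto simp: dilation_linear_def algebra_simps inner_add_left inner_add_right add_divide_distrib diff_divide_distrib)

lemma heis_X_linear_linear: "linear (heis_X_linear j)"
  by (rule linearI) (auto simp: heis_X_linear_def add_divide_distrib split: sum.split)

lemmas bounded_linear_dilation_linear = linear_conv_bounded_linear[THEN iffD1, OF dilation_linear_linear]
lemmas bounded_linear_heis_X_linear = linear_conv_bounded_linear[THEN iffD1, OF heis_X_linear_linear]

lemma dilation_field_has_derivative: "(dilation_field p0 has_derivative dilation_linear p0) (at q)"
proof -
  have "((\<lambda>q. dilation_linear p0 (q - p0)) has_derivative dilation_linear p0) (at q)"
    by (rule has_derivative_eq_rhs[OF bounded_linear.has_derivative[OF bounded_linear_dilation_linear]])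
      (auto intro!: derivative_eq_intros)
  then show ?thesis by (simp add: dilation_field_affine[abs_def])
qed

lemma heis_X_has_derivative: "(heis_X j has_derivative heis_X_linear j) (at q)"
proof -
  have "((\<lambda>q. heis_X j 0 + heis_X_linear j q) has_derivative heis_X_linear j) (at q)"
    using bounded_linear_imp_has_derivative[OF bounded_linear_heis_X_linear, of j]
    by (auto intro!: derivative_eq_intros)
  then show ?thesis by (subst heis_X_affine[abs_def])
qed

lemma C1_on_heis_X: "C1_on U (heis_X j)"
  by (subst heis_X_affine[abs_def])
    (intro C1_on_add C1_on_const C1_on_bounded_linear bounded_linear_heis_X_linear)

lemma C1_on_dilation_field: "C1_on U (dilation_field p0)"
  unfolding dilation_field_affine[abs_def]
  by (intro C1_on_linear_compose[OF bounded_linear_dilation_linear] C1_on_diff C1_on_id C1_on_const)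

text \<open>The left side is the Lie bracket [Z, X_j] in coordinates; horizontal directions have
  weight 1 under dilations. This is the source of the -1 in Q - 1.\<close>

lemma dilation_commutator:
  "heis_X_linear j (dilation_field p0 q) - dilation_linear p0 (heis_X j q) = - heis_X j q"
  by (cases q; cases p0; cases j)
    (simp_all add: dilation_field_affine heis_X_linear_def dilation_linear_def inner_axis inner_axis' field_simps)

lemma sum_Basis_prod:
  "(\<Sum>b\<in>(Basis :: ('a::euclidean_space \<times> 'b::euclidean_space) set). f b) =
    (\<Sum>i\<in>Basis. f (i, 0)) + (\<Sum>i\<in>Basis. f (0, i))"
proof -
  have "inj_on (\<lambda>u::'a. (u, 0::'b)) Basis" "inj_on (\<lambda>u::'b. (0::'a, u)) Basis"
    by (auto intro!: inj_onI)
  then show ?thesis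
    unfolding Basis_prod_def
    by (subst sum.union_disjoint) (auto simp: sum.reindex)
qed

lemma trace_heis_X_linear: "(\<Sum>b\<in>Basis. heis_X_linear j b \<bullet> b) = 0"
  by (cases j) (auto simp: heis_X_linear_def sum_Basis_prod simp del: split_paired_Ex)

text \<open>Weight 1 for each of the 2n horizontal coordinates and weight 2 for t: the homogeneous
  dimension Q.\<close>

lemma trace_dilation_linear:
  "(\<Sum>b\<in>Basis. dilation_linear (p0 :: 'n::finite heis) b \<bullet> b) = 2 * real CARD('n) + 2"
  by (simp add: dilation_linear_def sum_Basis_prod inner_Basis)

section \<open>The integrand as one derivative, and minimality as a divergence\<close>

lemma hor_grad_eq: "hor_grad F p = (\<Sum>j\<in>UNIV. frechet_derivative F (at p) (heis_X j p) *\<^sub>R heis_X j p)"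
  by (simp add: hor_grad_def dir_deriv_def)

text \<open>Pairing a horizontal vector with \<open>hor_grad\<close> is differentiation along it, so
  by linearity all first-order terms in \<open>\<rho>\<close> merge into the derivative along one
  vector.\<close>

lemma integrand_eq:
  assumes "\<rho> differentiable at p"
  shows "heis_metric p (zeta_field p0 p) (tan_hor_grad \<nu> \<rho> p)
     + f_coeff p0 p * (dir_deriv heis_T \<rho> p - omega_bar \<nu> p * Y_deriv \<nu> \<rho> p)
   = frechet_derivative \<rho> (at p) (dilation_field p0 p
       - ((hcomp p - hcomp p0) \<bullet> hcomp (unit_hor_normal \<nu> p) + f_coeff p0 p * omega_bar \<nu> p)
         *\<^sub>R unit_hor_normal \<nu> p)"
proof -
  have lin: "linear (frechet_derivative \<rho> (at p))"
    using assms by (rule linear_frechet_derivative)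
  define N where "N = unit_hor_normal \<nu> p"
  have hor: "hcomp (hor_grad \<rho> p) \<bullet> hcomp v = frechet_derivative \<rho> (at p) v" if "vcomp p v = 0" for v
    using that unfolding hor_grad_eq linear_heis_frame[OF lin, of v p]
    by (simp add: inner_vec_def mult.commute)
  have vh: "vcomp p (hor_grad \<rho> p) = 0" by (simp add: hor_grad_def)
  have vN: "vcomp p N = 0" by (simp add: N_def)
  have 1: "heis_metric p (hor_grad \<rho> p) N = frechet_derivative \<rho> (at p) N"
    using hor[OF vN] by (simp add: heis_metric_eq vh)
  have 2: "Y_deriv \<nu> \<rho> p = frechet_derivative \<rho> (at p) N"
    unfolding Y_deriv_def heis_grad_def N_def[symmetric] using hor[OF vN] by (simp add: heis_metric_eq vh vN)
  have 3: "heis_metric p (zeta_field p0 p) (tan_hor_grad \<nu> \<rho> p) =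
    frechet_derivative \<rho> (at p) (zeta_field p0 p) - frechet_derivative \<rho> (at p) N * ((hcomp p - hcomp p0) \<bullet> hcomp N)"
    unfolding tan_hor_grad_def N_def[symmetric] 1 using hor[of "zeta_field p0 p"]
    by (simp add: heis_metric_eq vh vN inner_diff_right inner_commute)
  show ?thesis
    unfolding 2 3 N_def[symmetric]
    by (simp add: dilation_field_def dir_deriv_def linear_add[OF lin] linear_diff[OF lin] linear_cmul[OF lin] algebra_simps)
qed

text \<open>Differentiating the orthogonality of \<open>e i\<close> and \<open>nn\<close> along
  \<open>S\<close> moves the derivative from the frame to \<open>nn\<close>, so up to sign the
  curvature is the tangential part of the divergence of \<open>nn\<close>. The remaining diagonal
  entry, in direction \<open>nn\<close>, vanishes because \<open>nn\<close> has constant length on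
  an open set. Only on \<open>S\<close> is \<open>nn\<close> related to
  \<open>\<nu>\<close>.\<close>

lemma hor_divergence_zero:
  fixes S :: "'n::finite heis set" and nn :: "'n heis \<Rightarrow> real^('n + 'n)"
  assumes H: "has_hor_mean_curvature S \<nu> p 0" and p: "p \<in> S" "p \<in> U" and U: "open U"
    and un: "unit_normal S \<nu>"
    and nn: "nn differentiable at p" "\<And>q. q \<in> U \<Longrightarrow> norm (nn q) = 1"
    and c: "\<And>q. q \<in> S \<inter> U \<Longrightarrow> \<exists>c. c \<noteq> 0 \<and> hcomp (\<nu> q) = c *\<^sub>R nn q"
  shows "(\<Sum>j\<in>UNIV. frechet_derivative nn (at p) (heis_X j p) $ j) = 0"
proof -
  define I where "I = {1..2 * CARD('n) - 1}"
  obtain U2 e where e: "p \<in> U2" "hor_tangent_frame S U2 e"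
    and H0: "0 = (\<Sum>i\<in>I. heis_metric p (hor_conn (e i p) (e i) p) (unit_hor_normal \<nu> p))"
    using H unfolding has_hor_mean_curvature_def I_def by blast
  have oU2: "open U2" and eC1: "\<And>i. i \<in> I \<Longrightarrow> C1_on U2 (e i)"
    and eo: "\<And>q i k. q \<in> S \<inter> U2 \<Longrightarrow> i \<in> I \<Longrightarrow> k \<in> I \<Longrightarrow> heis_metric q (e i q) (e k q) = (if i = k then 1 else 0)"
    and esp: "\<And>q. q \<in> S \<inter> U2 \<Longrightarrow> span ((\<lambda>i. e i q) ` I) = surf_tangent S q \<inter> horizontal_space q"
    using e(2) unfolding hor_tangent_frame_def I_def by auto
  let ?D = "frechet_derivative nn (at p)"
  have dnn: "(nn has_derivative ?D) (at p)" using nn(1) by (simp add: frechet_derivative_works)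
  have linD: "linear ?D" by (rule linear_frechet_derivative[OF nn(1)])
  define E where "E i = hcomp (e i p)" for i
  have et: "e i q \<in> surf_tangent S q" and eh: "vcomp q (e i q) = 0" if "q \<in> S \<inter> U2" "i \<in> I" for q i
  proof -
    have "e i q \<in> span ((\<lambda>i. e i q) ` I)" using that by (intro span_base) auto
    then have *: "e i q \<in> surf_tangent S q" "e i q \<in> horizontal_space q" using esp[OF that(1)] by auto
    then show "e i q \<in> surf_tangent S q" by simp
    have "subspace {v. vcomp q v = 0}" by (intro subspaceI) auto
    then show "vcomp q (e i q) = 0"
      using *(2) span_minimal[of "range (\<lambda>j. heis_X j q)" "{v. vcomp q v = 0}"]
      unfolding horizontal_space_def by (auto simp: image_subset_iff)
  qed
  have perp: "hcomp (e i q) \<bullet> nn q = 0" if qi: "q \<in> S \<inter> (U2 \<inter> U)" "i \<in> I" for q i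
  proof -
    obtain c where c: "c \<noteq> 0" "hcomp (\<nu> q) = c *\<^sub>R nn q" using assms(8)[of q] qi by auto
    have "heis_metric q (\<nu> q) (e i q) = 0"
      using un et[of q i] that unfolding unit_normal_def by auto
    then show ?thesis
      using eh[of q i] that c by (simp add: heis_metric_eq inner_commute)
  qed
  obtain c where c0: "c \<noteq> 0" "hcomp (\<nu> p) = c *\<^sub>R nn p" using c[of p] p by auto
  \<comment> \<open>The sign of \<open>c\<close>: the horizontal normal at \<open>p\<close> is given
    by \<open>nn p\<close> or its opposite, depending on the orientation.\<close>
  define s where "s = c / \<bar>c\<bar>"
  have s: "s \<noteq> 0" "hcomp (unit_hor_normal \<nu> p) = s *\<^sub>R nn p"
    using c0 nn(2)[of p] p by (auto simp: s_def hcomp_unit_hor_normal divide_inverse_commute)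
  have term1: "heis_metric p (hor_conn (e i p) (e i) p) (unit_hor_normal \<nu> p) = - s * (E i \<bullet> ?D (e i p))"
    if i: "i \<in> I" for i
  proof -
    let ?G = "frechet_derivative (e i) (at p)"
    have de: "(e i has_derivative ?G) (at p)"
      using C1_on_has_derivative[OF eC1[OF i] e(1)] .
    have dh: "((\<lambda>q. hcomp (e i q)) has_derivative (\<lambda>v. hcomp (?G v))) (at p)"
      by (rule bounded_linear.has_derivative[OF linear_conv_bounded_linear[THEN iffD1, OF hcomp_linear] de])
    have dj: "((\<lambda>q. hcomp (e i q) $ j) has_derivative (\<lambda>v. hcomp (?G v) $ j)) (at p)" for j
      by (rule bounded_linear.has_derivative[OF bounded_linear_vec_nth dh])
    have conn: "hor_conn (e i p) (e i) p = (\<Sum>j\<in>UNIV. hcomp (?G (e i p)) $ j *\<^sub>R heis_X j p)"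
      unfolding hor_conn_def dir_deriv_def metric_heis_X frechet_derivative_at[OF dj, symmetric] ..
    have hc: "hcomp (hor_conn (e i p) (e i) p) = hcomp (?G (e i p))"
      unfolding conn hcomp_frame_sum by (simp add: vec_eq_iff)
    \<comment> \<open>Orthogonality to \<open>nn\<close> is known on \<open>S\<close> only, so it is
      differentiated along a curve in \<open>S\<close> with velocity \<open>e i p\<close>.\<close>
    obtain cc where cc: "cc 0 = p" "\<forall>\<^sub>F s in at 0. cc s \<in> S" "(cc has_vector_derivative (e i p)) (at 0)"
      using et[of p i] p e(1) i unfolding surf_tangent_def by auto
    have dcc: "(cc has_derivative (\<lambda>t. t *\<^sub>R e i p)) (at 0)"
      using cc(3) by (simp add: has_vector_derivative_def)
    have "((\<lambda>q. hcomp (e i q) \<bullet> nn q) has_derivative (\<lambda>v. hcomp (e i p) \<bullet> ?D v + hcomp (?G v) \<bullet> nn p)) (at p)"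
      by (rule has_derivative_inner[OF dh dnn])
    then have d1: "((\<lambda>t. hcomp (e i (cc t)) \<bullet> nn (cc t)) has_derivative
        (\<lambda>t. hcomp (e i p) \<bullet> ?D (t *\<^sub>R e i p) + hcomp (?G (t *\<^sub>R e i p)) \<bullet> nn p)) (at 0)"
      using cc(1) by (intro has_derivative_compose[OF dcc]) simp
    have "isCont cc 0" using has_derivative_continuous[OF dcc] .
    then have "\<forall>\<^sub>F t in at 0. cc t \<in> U2 \<inter> U"
      using cc(1) e(1) p(2) oU2 U by (intro topological_tendstoD) (auto simp: isCont_def)
    then have "\<forall>\<^sub>F t in at 0. hcomp (e i (cc t)) \<bullet> nn (cc t) = 0"
      using cc(2) by eventually_elim (use perp i in auto)
    then have d2: "((\<lambda>t. hcomp (e i (cc t)) \<bullet> nn (cc t)) has_derivative (\<lambda>t. 0)) (at 0)"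
      by (intro has_derivative_transform_eventually[OF has_derivative_const])
        (use perp[of p i] cc(1) p e(1) i in \<open>auto elim: eventually_mono\<close>)
    have "E i \<bullet> ?D (e i p) + hcomp (?G (e i p)) \<bullet> nn p = 0"
      using fun_cong[OF has_derivative_unique[OF d1 d2], of 1] by (simp add: E_def)
    then have "hcomp (?G (e i p)) \<bullet> nn p = - (E i \<bullet> ?D (e i p))" by simp
    then show ?thesis
      by (simp add: heis_metric_eq hc s(2))
  qed
  have sum0: "(\<Sum>i\<in>I. E i \<bullet> ?D (e i p)) = 0"
    using H0 s(1) by (simp add: term1 sum_negf sum_distrib_left[symmetric])
  \<comment> \<open>The derivative of \<open>nn\<close> in horizontal directions as an endomorphism
    of the 2n-dimensional coefficient space; the sum to be computed is its trace.\<close>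
  define DD where "DD a = ?D (\<Sum>j\<in>UNIV. a $ j *\<^sub>R heis_X j p)" for a :: "real^('n+'n)"
  have linDD: "linear DD"
    unfolding DD_def
    by (intro linear_compose[OF _ linD, unfolded o_def] linear_compose_sum ballI linear_compose_scale_right)
      (auto intro!: linearI simp: scaleR_left_distrib)
  have DDe: "DD (E i) = ?D (e i p)" if "i \<in> I" for i
    using heis_frame_expansion[of "e i p" p] eh[of p i] that p e(1) by (simp add: DD_def E_def)
  have DDX: "DD (axis j 1) = ?D (heis_X j p)" for j
    by (simp add: DD_def axis_def if_distrib[of "\<lambda>x. x *\<^sub>R _"] cong: if_cong)
  have npp: "nn p \<bullet> ?D v = 0" for v
  proof -
    have "((\<lambda>q. nn q \<bullet> nn q) has_derivative (\<lambda>v. nn p \<bullet> ?D v + ?D v \<bullet> nn p)) (at p)"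
      by (rule has_derivative_inner[OF dnn dnn])
    moreover have "((\<lambda>q. nn q \<bullet> nn q) has_derivative (\<lambda>v. 0)) (at p)"
      by (rule has_derivative_transform_within_open[OF has_derivative_const U p(2)])
        (use nn(2) in \<open>simp add: norm_eq_1\<close>)
    ultimately show ?thesis
      using fun_cong[OF has_derivative_unique, of _ _ _ _ v] by (fastforce simp: inner_commute)
  qed
  \<comment> \<open>The 2n - 1 frame vectors and the normal form an orthonormal basis of the
    coefficient space, in which the trace of \<open>DD\<close> is evaluated.\<close>
  define B where "B = insert (nn p) (E ` I)"
  have En: "E i \<bullet> E k = (if i = k then 1 else 0)" if "i \<in> I" "k \<in> I" for i k
    using eo[of p i k] that p e(1) eh by (simp add: heis_metric_eq E_def)
  have En0: "E i \<bullet> nn p = 0" if "i \<in> I" for i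
    using perp[of p i] that p e(1) by (simp add: E_def)
  have injE: "inj_on E I"
  proof (rule inj_onI)
    fix i k assume "i \<in> I" "k \<in> I" "E i = E k"
    then show "i = k" using En[of i k] En[of i i] by (auto split: if_splits)
  qed
  have nnp: "nn p \<bullet> nn p = 1" using nn(2)[OF p(2)] by (simp add: norm_eq_1)
  have nE: "nn p \<notin> E ` I" using En0 nnp by auto
  have po: "pairwise orthogonal B"
    unfolding B_def pairwise_def orthogonal_def using En En0 by (auto simp: inner_commute)
  have nB: "norm b = 1" if "b \<in> B" for b
    using that En nn(2)[OF p(2)] by (auto simp: B_def norm_eq_1)
  have finI: "finite I" by (simp add: I_def)
  have fB: "finite B" by (simp add: B_def finI)
  have "card B = 2 * CARD('n)"
    unfolding B_def using nE finI card_image[OF injE] zero_less_card_finite[where 'a='n] by (simp add: I_def)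
  moreover have "independent B"
    by (rule pairwise_orthogonal_independent[OF po]) (use nB in force)
  ultimately have "span B = UNIV"
    using card_eq_dim[of B UNIV] fB by (auto simp: dim_UNIV)
  then have exp: "(\<Sum>b\<in>B. (x \<bullet> b) *\<^sub>R b) = x" for x
    by (intro orthonormal_basis_expand[OF po nB]) (auto simp: fB)
  have "(\<Sum>j\<in>UNIV. ?D (heis_X j p) $ j) = (\<Sum>j\<in>UNIV. DD (axis j 1) \<bullet> axis j 1)"
    by (simp add: DDX inner_axis)
  also have "\<dots> = (\<Sum>j\<in>UNIV. \<Sum>b\<in>B. (axis j 1 \<bullet> b) * (DD (axis j 1) \<bullet> b))"
    by (intro sum.cong refl, subst (2) exp[symmetric]) (simp add: inner_sum_right)
  also have "\<dots> = (\<Sum>b\<in>B. \<Sum>j\<in>UNIV. (b $ j) * (DD (axis j 1) \<bullet> b))"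
    by (subst sum.swap) (simp add: inner_axis')
  also have "\<dots> = (\<Sum>b\<in>B. DD b \<bullet> b)"
  proof (intro sum.cong refl)
    fix b :: "real^('n+'n)"
    have "DD b = DD (\<Sum>j\<in>UNIV. b $ j *\<^sub>R axis j 1)"
      by (simp add: basis_expansion scalar_mult_eq_scaleR[symmetric])
    then show "(\<Sum>j\<in>UNIV. (b $ j) * (DD (axis j 1) \<bullet> b)) = DD b \<bullet> b"
      by (simp add: linear_sum[OF linDD] linear_cmul[OF linDD] inner_sum_left)
  qed
  also have "\<dots> = (\<Sum>i\<in>I. DD (E i) \<bullet> E i)"
    unfolding B_def using nE finI npp
    by (simp add: sum.reindex[OF injE] DD_def inner_commute[of _ "nn p"])
  also have "\<dots> = 0"
    using sum0 by (simp add: DDe inner_commute)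
  finally show ?thesis .
qed

section \<open>Intrinsic graph charts\<close>

text \<open>Parameters share the index type of the horizontal frame: slot \<open>k\<close>, whose
  horizontal coordinate is set to zero, carries t instead.\<close>

definition slice_lift :: "'n::finite + 'n \<Rightarrow> real^('n + 'n) \<Rightarrow> 'n heis" where
  "slice_lift k u = (\<chi> i. if Inl i = k then 0 else u $ Inl i, \<chi> i. if Inr i = k then 0 else u $ Inr i, u $ k)"

text \<open>Projection onto the slice along \<open>w\<close>, meant for
  \<open>hcomp w = axis k 1\<close>; apart from the dropped coordinate only t has to be
  corrected.\<close>

definition slice_proj :: "'n::finite + 'n \<Rightarrow> 'n heis \<Rightarrow> 'n heis \<Rightarrow> real^('n + 'n)" where
  "slice_proj k w q = (\<chi> j. if j = k then snd (snd q) - hcomp q $ k * snd (snd w) else hcomp q $ j)"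

lemma hcomp_slice_lift: "hcomp (slice_lift k u) $ j = (if j = k then 0 else u $ j)"
  by (cases j) (auto simp: slice_lift_def hcomp_def)

lemma slice_lift_linear: "linear (slice_lift k)"
  by (rule linearI) (auto simp: slice_lift_def vec_eq_iff)

lemma slice_proj_linear: "linear (slice_proj k w)"
  by (rule linearI) (auto simp: slice_proj_def vec_eq_iff algebra_simps)

lemmas bounded_linear_slice_lift = linear_conv_bounded_linear[THEN iffD1, OF slice_lift_linear]
lemmas bounded_linear_slice_proj = linear_conv_bounded_linear[THEN iffD1, OF slice_proj_linear]

lemma slice_proj_lift [simp]: "slice_proj k w (slice_lift k u) = u"
  by (simp add: slice_proj_def vec_eq_iff hcomp_slice_lift) (simp add: slice_lift_def)

lemma slice_decomp:
  assumes "hcomp w = axis k 1"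
  shows "slice_lift k (slice_proj k w v) + hcomp v $ k *\<^sub>R w = v"
proof (rule heis_vec_eqI[of _ _ 0])
  show "hcomp (slice_lift k (slice_proj k w v) + hcomp v $ k *\<^sub>R w) = hcomp v"
    by (simp add: assms vec_eq_iff hcomp_slice_lift) (auto simp: slice_proj_def axis_def)
  show "vcomp 0 (slice_lift k (slice_proj k w v) + hcomp v $ k *\<^sub>R w) = vcomp 0 v"
    by (simp add: vcomp_def slice_lift_def slice_proj_def)
qed

lemma slice_proj_direction: "hcomp w = axis k 1 \<Longrightarrow> slice_proj k w w = 0"
  by (auto simp: slice_proj_def vec_eq_iff axis_def)

lemma slice_lift_axis: "slice_lift k (axis k 1) = heis_T"
  by (auto simp: slice_lift_def heis_T_def vec_eq_iff axis_def)

text \<open>The vector \<open>w\<close> is constant while \<open>heis_X k\<close> varies, so the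
  projection to the parameters is linear; \<open>pos\<close> secures a nonvanishing horizontal
  gradient throughout \<open>U\<close>. \<open>U\<close> need not be a product: it projects into
  \<open>V\<close> and contains the graph. By \<open>closed\<close>, compact subsets of
  \<open>U\<close> meet \<open>S\<close> in compact sets.\<close>

locale heis_graph =
  fixes S :: "'n::finite heis set" and \<nu> :: "'n heis \<Rightarrow> 'n heis" and k :: "'n + 'n" and w :: "'n heis"
    and V :: "(real^('n + 'n)) set" and g :: "real^('n + 'n) \<Rightarrow> real" and U :: "'n heis set"
  assumes w: "hcomp w = axis k 1"
    and oV: "open V" and g: "C2_on V g" and oU: "open U"
    and UV: "\<And>q. q \<in> U \<Longrightarrow> slice_proj k w q \<in> V"
    and VU: "\<And>u. u \<in> V \<Longrightarrow> slice_lift k u + g u *\<^sub>R w \<in> U"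
    and S_graph: "\<And>q. q \<in> U \<Longrightarrow> q \<in> S \<longleftrightarrow> hcomp q $ k = g (slice_proj k w q)"
    and pos: "\<And>q. q \<in> U \<Longrightarrow>
      frechet_derivative (\<lambda>q. hcomp q $ k - g (slice_proj k w q)) (at q) (heis_X k q) > 0"
    and minimal: "H_minimal S \<nu>"
    and nonchar: "non_characteristic S \<nu>"
    and closed: "closed S"
begin

abbreviation "P \<equiv> slice_proj k w"

definition F where "F q = hcomp q $ k - g (P q)"
definition dF where "dF q = frechet_derivative F (at q)"
definition \<phi> where "\<phi> u = slice_lift k u + g u *\<^sub>R w"
text \<open>With \<open>m\<close>, \<open>nn\<close> and \<open>N\<close> this yields a C^1
  substitute on \<open>U\<close> for the horizontal normal, which is given on \<open>S\<close> only
  and is merely continuous there.\<close>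

definition hg :: "'n heis \<Rightarrow> real^('n + 'n)" where "hg q = (\<chi> j. dF q (heis_X j q))"
definition m where "m q = norm (hg q)"
definition nn where "nn q = hg q /\<^sub>R m q"
definition N where "N q = (\<Sum>j\<in>UNIV. nn q $ j *\<^sub>R heis_X j q)"

section \<open>Regularity of the defining function and its horizontal gradient\<close>

lemma P_linear: "linear P" by (rule slice_proj_linear)

lemma P_phi [simp]: "P (\<phi> u) = u"
  using w by (simp add: \<phi>_def linear_add[OF P_linear] linear_cmul[OF P_linear] slice_proj_direction)

lemma hcomp_phi [simp]: "hcomp (\<phi> u) $ k = g u"
  using w by (simp add: \<phi>_def hcomp_slice_lift)

lemma phi_mem: "u \<in> V \<Longrightarrow> \<phi> u \<in> S \<inter> U"
  using VU[of u] S_graph[of "\<phi> u"] by (simp add: \<phi>_def[symmetric])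

lemma phi_P: "q \<in> S \<inter> U \<Longrightarrow> \<phi> (P q) = q"
  using S_graph[of q] slice_decomp[OF w, of q] by (simp add: \<phi>_def)

lemma phi_image: "\<phi> ` V = S \<inter> U"
proof
  show "\<phi> ` V \<subseteq> S \<inter> U" using phi_mem by blast
  show "S \<inter> U \<subseteq> \<phi> ` V" using phi_P UV by (metis IntD2 image_eqI subsetI)
qed

lemma F_C2: "C2_on U F"
proof -
  have 1: "C2_on U (\<lambda>q. - g (P q))"
    by (intro C2_on_linear_compose[OF bounded_linear_minus[OF bounded_linear_ident]]
        C2_on_compose[OF C2_on_bounded_linear[OF bounded_linear_slice_proj] g]) (use UV in auto)
  show ?thesis
    unfolding F_def[abs_def] using C2_on_add[OF C2_on_bounded_linear[OF bounded_linear_hcomp_nth] 1] by simp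
qed

lemma g_deriv: "u \<in> V \<Longrightarrow> (g has_derivative frechet_derivative g (at u)) (at u)"
  using C1_on_has_derivative[OF C2_on_imp_C1_on[OF g]] .

lemma g_linear: "u \<in> V \<Longrightarrow> linear (frechet_derivative g (at u))"
  using has_derivative_linear[OF g_deriv] .

lemma F_deriv: "q \<in> U \<Longrightarrow> (F has_derivative dF q) (at q)"
  unfolding dF_def using C1_on_has_derivative[OF C2_on_imp_C1_on[OF F_C2]] .

lemma dF_linear: "q \<in> U \<Longrightarrow> linear (dF q)"
  using has_derivative_linear[OF F_deriv] .

lemma dF_eq:
  assumes "q \<in> U"
  shows "dF q v = hcomp v $ k - frechet_derivative g (at (P q)) (P v)"
proof -
  have "(F has_derivative (\<lambda>v. hcomp v $ k - frechet_derivative g (at (P q)) (P v))) (at q)"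
    unfolding F_def
    by (intro has_derivative_diff bounded_linear_imp_has_derivative[OF bounded_linear_hcomp_nth]
      has_derivative_compose[OF bounded_linear_imp_has_derivative[OF bounded_linear_slice_proj] g_deriv[OF UV[OF assms]]])
  from has_derivative_unique[OF F_deriv[OF assms] this] show ?thesis by simp
qed

text \<open>\<open>P\<close> annihilates \<open>w\<close>, so this normalisation is exact on all of
  \<open>U\<close>; the area element depends on it.\<close>

lemma dF_w: "q \<in> U \<Longrightarrow> dF q w = 1"
  using linear_0[OF g_linear[OF UV]] by (simp add: dF_eq w slice_proj_direction[OF w])

lemma hg_k_pos: "q \<in> U \<Longrightarrow> hg q $ k > 0"
  using pos[of q] by (simp add: hg_def dF_def F_def[abs_def])

lemma m_pos: "q \<in> U \<Longrightarrow> m q > 0"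
  using hg_k_pos[of q] by (cases "hg q = 0") (simp_all add: m_def)

lemma dF_C1: "C1_on U v \<Longrightarrow> C1_on U (\<lambda>q. dF q (v q))"
  unfolding dF_def by (rule C1_on_frechet_derivative[OF F_C2 _ oU])

lemma hg_C1: "C1_on U hg"
  by (rule C1_on_vec) (auto simp: hg_def intro!: dF_C1 C1_on_heis_X)

lemma m_C1: "C1_on U m"
  unfolding m_def[abs_def] norm_eq_sqrt_inner
  by (intro C1_on_sqrt C1_on_inner hg_C1) (use m_pos in \<open>auto simp: m_def\<close>)

lemma nn_C1: "C1_on U nn"
  unfolding nn_def[abs_def]
  by (intro C1_on_scaleR C1_on_inverse m_C1 hg_C1) (use m_pos in force)

lemma nn_nth_C1: "C1_on U (\<lambda>q. nn q $ j)"
  by (intro C1_on_linear_compose[OF bounded_linear_vec_nth] nn_C1)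

lemma norm_nn: "q \<in> U \<Longrightarrow> norm (nn q) = 1"
  using m_pos[of q] by (simp add: nn_def m_def)

lemma N_C1: "C1_on U N"
  unfolding N_def[abs_def] by (intro C1_on_sum C1_on_scaleR nn_nth_C1 C1_on_heis_X)

lemma dF_N: "q \<in> U \<Longrightarrow> dF q (N q) = m q"
proof -
  assume q: "q \<in> U"
  have "dF q (N q) = nn q \<bullet> hg q"
    using q by (simp add: N_def linear_sum[OF dF_linear] linear_cmul[OF dF_linear] hg_def inner_vec_def)
  also have "\<dots> = m q"
    using m_pos[OF q] by (simp add: nn_def m_def power2_norm_eq_inner[symmetric] power2_eq_square)
  finally show ?thesis .
qed

section \<open>The graph as a local parametrisation\<close>

lemma phi_deriv:
  "u \<in> V \<Longrightarrow> (\<phi> has_derivative (\<lambda>h. slice_lift k h + frechet_derivative g (at u) h *\<^sub>R w)) (at u)"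
  unfolding \<phi>_def
  by (intro has_derivative_add bounded_linear_imp_has_derivative[OF bounded_linear_slice_lift]
      bounded_linear.has_derivative[OF bounded_linear_scaleR_left] g_deriv)

lemma phi_C2: "C2_on V \<phi>"
  unfolding \<phi>_def[abs_def]
  by (intro C2_on_add C2_on_bounded_linear[OF bounded_linear_slice_lift]
      C2_on_linear_compose[OF bounded_linear_scaleR_left] g)

lemma phi_frechet:
  "u \<in> V \<Longrightarrow> frechet_derivative \<phi> (at u) h = slice_lift k h + frechet_derivative g (at u) h *\<^sub>R w"
  by (rule fun_cong[OF frechet_derivative_at[OF phi_deriv], symmetric])

lemma phi_local_param: "local_param S V \<phi>"
  unfolding local_param_def
proof (intro conjI ballI oV phi_C2)
  fix u assume u: "u \<in> V"
  have "P (frechet_derivative \<phi> (at u) h) = h" for h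
    by (simp add: phi_frechet[OF u] linear_add[OF P_linear] linear_cmul[OF P_linear] slice_proj_direction[OF w])
  then show "inj (frechet_derivative \<phi> (at u))" by (metis injI)
next
  show "openin (top_of_set S) (\<phi> ` V)"
    unfolding phi_image using oU by (simp add: openin_open_Int)
  show "\<exists>\<psi>. homeomorphism V (\<phi> ` V) \<phi> \<psi>"
  proof (intro exI[of _ P] homeomorphismI)
    show "continuous_on V \<phi>" by (intro C1_on_imp_continuous_on C2_on_imp_C1_on phi_C2)
    show "continuous_on (\<phi> ` V) P" by (intro linear_continuous_on bounded_linear_slice_proj)
  qed auto
qed

lemma phi_tangent: 
  assumes u: "u \<in> V"
  shows "slice_lift k h + frechet_derivative g (at u) h *\<^sub>R w \<in> surf_tangent S (\<phi> u)"
  unfolding surf_tangent_def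
proof (intro CollectI exI[of _ "\<lambda>s. \<phi> (u + s *\<^sub>R h)"] conjI)
  have l: "((\<lambda>s. u + s *\<^sub>R h) has_derivative (\<lambda>s. s *\<^sub>R h)) (at 0)"
    by (auto intro!: derivative_eq_intros)
  have "\<forall>\<^sub>F s in at 0. u + s *\<^sub>R h \<in> V"
    using has_derivative_continuous[OF l] u oV by (intro topological_tendstoD) (auto simp: isCont_def)
  then show "\<forall>\<^sub>F s in at 0. \<phi> (u + s *\<^sub>R h) \<in> S"
    by eventually_elim (use phi_mem in auto)
  have "(\<phi> has_derivative (\<lambda>h. slice_lift k h + frechet_derivative g (at u) h *\<^sub>R w)) (at (u + 0 *\<^sub>R h))"
    using phi_deriv[OF u] by simp
  from has_derivative_compose[OF l this]
  show "((\<lambda>s. \<phi> (u + s *\<^sub>R h)) has_vector_derivative (slice_lift k h + frechet_derivative g (at u) h *\<^sub>R w)) (at 0)"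
    unfolding has_vector_derivative_def
    by (rule has_derivative_eq_rhs)
      (simp add: fun_eq_iff linear_cmul[OF slice_lift_linear] linear_cmul[OF g_linear[OF u]] algebra_simps)
qed simp

section \<open>Normal and area element in the chart\<close>

lemma unit_normal_S: "unit_normal S \<nu>"
  using minimal by (simp add: H_minimal_def)

definition c where "c q = heis_metric q (\<nu> q) w"

text \<open>Split \<open>v\<close> into the tangent vector of the graph over \<open>P v\<close> and
  \<open>dF q v\<close> times \<open>w\<close>; the normal annihilates the first. So
  \<open>\<nu>\<close> is \<open>c\<close> times the Riemannian gradient of \<open>F\<close>, with
  the sign of \<open>c\<close> left open.\<close>

lemma metric_nu:
  assumes q: "q \<in> S \<inter> U"
  shows "heis_metric q (\<nu> q) v = c q * dF q v"
proof -
  have PV: "P q \<in> V" using UV q by auto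
  let ?t = "slice_lift k (P v) + frechet_derivative g (at (P q)) (P v) *\<^sub>R w"
  have 0: "heis_metric q (\<nu> q) ?t = 0"
    using phi_tangent[OF PV, of "P v"] unit_normal_S q unfolding unit_normal_def phi_P[OF q] by auto
  have v: "v = ?t + dF q v *\<^sub>R w"
    using slice_decomp[OF w, of v] q by (simp add: dF_eq algebra_simps)
  have "heis_metric q (\<nu> q) v = heis_metric q (\<nu> q) ?t + dF q v * heis_metric q (\<nu> q) w"
    by (subst v) (simp add: heis_metric_eq algebra_simps inner_add_right)
  then show ?thesis using 0 by (simp add: c_def)
qed

lemma hcomp_nu: "q \<in> S \<inter> U \<Longrightarrow> hcomp (\<nu> q) = c q *\<^sub>R hg q"
  using metric_nu[of q "heis_X _ q"] by (simp add: vec_eq_iff hg_def)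

lemma vcomp_nu: "q \<in> S \<inter> U \<Longrightarrow> vcomp q (\<nu> q) = c q * dF q heis_T"
  using metric_nu[of q heis_T] by (simp add: heis_metric_eq)

text \<open>Unit length of \<open>\<nu>\<close>: the absolute value of \<open>c\<close> is the
  reciprocal of the Riemannian length of the gradient of \<open>F\<close>.\<close>

lemma c_norm: 
  assumes q: "q \<in> S \<inter> U"
  shows "(c q)\<^sup>2 * ((m q)\<^sup>2 + (dF q heis_T)\<^sup>2) = 1"
proof -
  have "heis_metric q (\<nu> q) (\<nu> q) = 1"
    using unit_normal_S q by (auto simp: unit_normal_def)
  moreover have "(m q)\<^sup>2 = hg q \<bullet> hg q"
    by (simp add: m_def power2_norm_eq_inner)
  ultimately show ?thesis
    by (simp add: heis_metric_eq hcomp_nu[OF q] vcomp_nu[OF q] power2_eq_square[of "c q"]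
        power2_eq_square[of "dF q heis_T"] algebra_simps)
qed

lemma c_nz: "q \<in> S \<inter> U \<Longrightarrow> c q \<noteq> 0"
  using c_norm[of q] by auto

text \<open>The area element is the Riemannian length of the gradient of \<open>F\<close>, because
  \<open>dF q w = 1\<close> and the frame has determinant 1 in coordinates. The computation is
  \<open>det_gram_plus_rank_one\<close> with \<open>det A = x\<close>, the derivative of
  \<open>F\<close> along \<open>heis_X k\<close>.\<close>

lemma det_gram:
  assumes u: "u \<in> V"
  shows "det (gram_matrix \<phi> u) = (m (\<phi> u))\<^sup>2 + (dF (\<phi> u) heis_T)\<^sup>2"
proof -
  define q where "q = \<phi> u"
  have q: "q \<in> U" "P q = u" using phi_mem[OF u] by (auto simp: q_def)
  define J where "J h = slice_lift k h + frechet_derivative g (at u) h *\<^sub>R w" for h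
  have J: "frechet_derivative \<phi> (at u) = J" using phi_frechet[OF u] by (auto simp: J_def)
  have dFJ: "dF q (J h) = 0" for h
    using q by (simp add: dF_eq J_def linear_add[OF P_linear] linear_cmul[OF P_linear] slice_proj_direction[OF w] w hcomp_slice_lift)
  have hJ: "hcomp (J h) $ j = (if j = k then frechet_derivative g (at u) h else h $ j)" for h j
    by (simp add: J_def w hcomp_slice_lift axis_def)
  define x where "x = hg q $ k"
  have x: "x > 0" using hg_k_pos q by (simp add: x_def)
  \<comment> \<open>Row \<open>k\<close> of \<open>A\<close> holds the vertical components of the columns of \<open>J\<close>; the \<open>k\<close>-th horizontal
    component is then a linear function \<open>\<gamma>\<close> of the column, since \<open>dF\<close> vanishes on the range of \<open>J\<close>.\<close>
  define A where "A = (\<chi> i. if i = k then (\<chi> l. vcomp q (J (axis l 1))) else axis i 1)"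
  define \<gamma> where "\<gamma> = (\<chi> j. if j = k then - dF q heis_T / x else - hg q $ j / x)"
  have colA: "column l A $ j = (if j = k then vcomp q (J (axis l 1)) else hcomp (J (axis l 1)) $ j)" for l j
    by (simp add: column_def A_def hJ axis_def)
  have inner_split: "(\<Sum>j\<in>UNIV. f j) = f k + (\<Sum>j\<in>UNIV - {k}. f j)" for f :: "'n + 'n \<Rightarrow> real"
    by (rule sum.remove) auto
  have \<gamma>A: "\<gamma> \<bullet> column l A = hcomp (J (axis l 1)) $ k" for l
  proof -
    let ?v = "J (axis l 1)"
    have "0 = (\<Sum>j\<in>UNIV. hcomp ?v $ j * hg q $ j) + vcomp q ?v * dF q heis_T"
      using linear_heis_frame[OF dF_linear[OF q(1)], of ?v q] dFJ by (simp add: hg_def)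
    then have "hcomp ?v $ k * x = - (\<Sum>j\<in>UNIV - {k}. hcomp ?v $ j * hg q $ j) - vcomp q ?v * dF q heis_T"
      by (simp add: inner_split x_def)
    moreover have "\<gamma> \<bullet> column l A = (- (\<Sum>j\<in>UNIV - {k}. hcomp ?v $ j * hg q $ j) - vcomp q ?v * dF q heis_T) / x"
      unfolding inner_vec_def inner_split
      by (simp add: colA \<gamma>_def sum_divide_distrib sum_negf diff_divide_distrib mult.commute)
    ultimately have "\<gamma> \<bullet> column l A = (hcomp ?v $ k * x) / x" by simp
    then show ?thesis using x by simp
  qed
  have "gram_matrix \<phi> u = (\<chi> i l. column i A \<bullet> column l A + (\<gamma> \<bullet> column i A) * (\<gamma> \<bullet> column l A))"
    unfolding gram_matrix_def J q_def[symmetric] heis_metric_eq \<gamma>A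
    by (simp add: vec_eq_iff inner_vec_def inner_split colA)
  then have "det (gram_matrix \<phi> u) = (det A)\<^sup>2 * (1 + \<gamma> \<bullet> \<gamma>)"
    by (simp add: det_gram_plus_rank_one)
  moreover have "det A = x"
  proof -
    have "det A = vcomp q (J (axis k 1))"
      unfolding A_def det_replace_row by simp
    also have "\<dots> = 1 + frechet_derivative g (at u) (axis k 1) * vcomp q w"
      by (simp add: J_def slice_lift_axis)
    also have "\<dots> = x"
    proof -
      \<comment> \<open>\<open>w\<close> and \<open>heis_X k q\<close> differ by a vertical vector,
        so \<open>dF q w = 1\<close> expresses \<open>x\<close> as
        \<open>1 - vcomp q w * dF q heis_T\<close>; the vertical derivative of \<open>F\<close> is
        minus the \<open>k\<close>-th partial derivative of \<open>g\<close>.\<close>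
      have "w = heis_X k q + vcomp q w *\<^sub>R heis_T"
        by (rule heis_vec_eqI[of _ _ q]) (simp_all add: w)
      then have "dF q w = dF q (heis_X k q + vcomp q w *\<^sub>R heis_T)"
        by (rule arg_cong)
      also have "\<dots> = x + vcomp q w * dF q heis_T"
        by (simp add: linear_add[OF dF_linear[OF q(1)]] linear_cmul[OF dF_linear[OF q(1)]] hg_def x_def)
      finally have "dF q w = x + vcomp q w * dF q heis_T" .
      moreover have "P heis_T = axis k 1"
        using slice_proj_lift[of k w "axis k 1"] by (simp add: slice_lift_axis)
      then have "dF q heis_T = - frechet_derivative g (at u) (axis k 1)"
        using q by (simp add: dF_eq)
      ultimately show ?thesis using dF_w[OF q(1)] by (simp add: mult.commute)
    qed
    finally show ?thesis .
  qed
  moreover have "x\<^sup>2 * (1 + \<gamma> \<bullet> \<gamma>) = (m q)\<^sup>2 + (dF q heis_T)\<^sup>2"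
  proof -
    have "x\<^sup>2 * (\<gamma> \<bullet> \<gamma>) = (dF q heis_T)\<^sup>2 + (\<Sum>j\<in>UNIV - {k}. hg q $ j * hg q $ j)"
      unfolding inner_vec_def inner_split using x
      by (simp add: \<gamma>_def distrib_left sum_distrib_left power2_eq_square)
    moreover have "(m q)\<^sup>2 = x\<^sup>2 + (\<Sum>j\<in>UNIV - {k}. hg q $ j * hg q $ j)"
      unfolding m_def power2_norm_eq_inner inner_vec_def inner_split by (simp add: x_def power2_eq_square)
    ultimately show ?thesis by (simp add: distrib_left)
  qed
  ultimately show ?thesis by (simp add: q_def)
qed

text \<open>\<open>hor_W\<close> is the ratio of the horizontal to the full gradient length of
  \<open>F\<close>; the area element is the full length, which cancels.\<close>

lemma W_sqrt_det:
  assumes u: "u \<in> V"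
  shows "hor_W \<nu> (\<phi> u) * sqrt (det (gram_matrix \<phi> u)) = m (\<phi> u)"
proof -
  let ?q = "\<phi> u"
  have q: "?q \<in> S \<inter> U" by (rule phi_mem[OF u])
  have "\<bar>c ?q\<bar> * sqrt (det (gram_matrix \<phi> u)) = sqrt ((c ?q)\<^sup>2 * ((m ?q)\<^sup>2 + (dF ?q heis_T)\<^sup>2))"
    by (simp add: det_gram[OF u] real_sqrt_mult)
  then have "\<bar>c ?q\<bar> * sqrt (det (gram_matrix \<phi> u)) = 1"
    by (simp add: c_norm[OF q])
  moreover have "hor_W \<nu> ?q = m ?q * \<bar>c ?q\<bar>"
    by (simp add: hor_W_eq hcomp_nu[OF q] m_def)
  ultimately show ?thesis by simp
qed

lemma div_nn:
  assumes q: "q \<in> S \<inter> U"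
  shows "(\<Sum>j\<in>UNIV. frechet_derivative nn (at q) (heis_X j q) $ j) = 0"
proof (rule hor_divergence_zero[OF _ _ _ oU unit_normal_S])
  show "has_hor_mean_curvature S \<nu> q 0" "q \<in> S" "q \<in> U"
    using minimal q by (auto simp: H_minimal_def)
  then show "nn differentiable at q"
    using C1_on_differentiable[OF nn_C1] by simp
  show "\<exists>c. c \<noteq> 0 \<and> hcomp (\<nu> r) = c *\<^sub>R nn r" if "r \<in> S \<inter> U" for r
    using c_nz[OF that] m_pos[of r] that
    by (intro exI[of _ "c r * m r"]) (auto simp: hcomp_nu nn_def)
qed (rule norm_nn)

end

section \<open>First variation in a chart\<close>

lemma trace_rank_one:
  fixes v :: "'a::euclidean_space"
  assumes "linear \<alpha>"
  shows "(\<Sum>b\<in>Basis. (\<alpha> b *\<^sub>R v) \<bullet> b) = \<alpha> v"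
  by (subst (2) euclidean_representation[of v, symmetric])
    (simp add: linear_sum[OF assms] linear_cmul[OF assms] mult.commute)

text \<open>The projection of Z to the tangent space of \<open>S\<close> along the horizontal
  normal: the coefficient is <Z, nu> / W, and <nu^H, nu> = W.\<close>

definition tangent_dilation :: "('n::finite heis \<Rightarrow> 'n heis) \<Rightarrow> 'n heis \<Rightarrow> 'n heis \<Rightarrow> 'n heis" where
  "tangent_dilation \<nu> p0 p = dilation_field p0 p
     - ((hcomp p - hcomp p0) \<bullet> hcomp (unit_hor_normal \<nu> p) + f_coeff p0 p * omega_bar \<nu> p)
       *\<^sub>R unit_hor_normal \<nu> p"

section \<open>Continuity of the projected dilation field on the surface\<close>

lemma continuous_on_hcomp: "continuous_on A f \<Longrightarrow> continuous_on A (\<lambda>q. hcomp (f q))"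
  by (rule bounded_linear.continuous_on[OF linear_conv_bounded_linear[THEN iffD1, OF hcomp_linear]])

lemma continuous_on_vcomp: "continuous_on A f \<Longrightarrow> continuous_on A (\<lambda>q. vcomp q (f q))"
  unfolding vcomp_def by (intro continuous_intros) auto

lemma continuous_on_hor_W: "unit_normal S \<nu> \<Longrightarrow> continuous_on S (hor_W \<nu>)"
  unfolding hor_W_eq[abs_def] unit_normal_def by (intro continuous_intros continuous_on_hcomp) auto

lemma continuous_on_heis_X: "continuous_on A (heis_X j)"
  by (intro C1_on_imp_continuous_on C1_on_heis_X)

lemma continuous_on_tangent_dilation:
  assumes un: "unit_normal S \<nu>" and nc: "non_characteristic S \<nu>"
  shows "continuous_on S (tangent_dilation \<nu> p0)"
proof -
  have cn: "continuous_on S (\<lambda>q. hcomp (\<nu> q))" "continuous_on S (\<lambda>q. vcomp q (\<nu> q))"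
    using un by (auto simp: unit_normal_def intro: continuous_on_hcomp continuous_on_vcomp)
  have pos: "norm (hcomp (\<nu> q)) \<noteq> 0" if "q \<in> S" for q
    using nc that unfolding non_characteristic_def hor_W_eq by fastforce
  have hN: "continuous_on S (\<lambda>q. hcomp (unit_hor_normal \<nu> q))"
    unfolding hcomp_unit_hor_normal by (intro continuous_intros cn) (use pos in auto)
  have eq: "(\<Sum>j\<in>UNIV. hcomp (unit_hor_normal \<nu> q) $ j *\<^sub>R heis_X j q) = unit_hor_normal \<nu> q" for q
    using heis_frame_expansion[of "unit_hor_normal \<nu> q" q] by simp
  have "continuous_on S (\<lambda>q. \<Sum>j\<in>UNIV. hcomp (unit_hor_normal \<nu> q) $ j *\<^sub>R heis_X j q)"
    by (intro continuous_intros continuous_on_heis_X hN)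
  then have cN: "continuous_on S (\<lambda>q. unit_hor_normal \<nu> q)"
    unfolding eq .
  have cZ: "continuous_on S (dilation_field p0)"
    by (intro C1_on_imp_continuous_on C1_on_dilation_field)
  then have cf: "continuous_on S (\<lambda>q. f_coeff p0 q)"
    using continuous_on_vcomp[OF cZ] by simp
  have co: "continuous_on S (\<lambda>q. omega_bar \<nu> q)"
    unfolding omega_bar_eq by (intro continuous_intros cn) (use pos in auto)
  show ?thesis
    unfolding tangent_dilation_def[abs_def]
    by (intro continuous_intros cN cZ cf co hN continuous_on_hcomp)
qed

context heis_graph
begin

text \<open>Equals \<open>m\<close> times \<open>tangent_dilation\<close> on \<open>S\<close>, but
  is C^1 on all of \<open>U\<close>, so that it has a divergence. The factor \<open>m\<close> is the
  density of the perimeter in the chart.\<close>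

definition B where "B p0 q = m q *\<^sub>R dilation_field p0 q - dF q (dilation_field p0 q) *\<^sub>R N q"

lemma B_C1: "C1_on U (B p0)"
  unfolding B_def[abs_def]
  by (intro C1_on_diff C1_on_scaleR m_C1 dF_C1 N_C1 C1_on_dilation_field)

lemma dF_B: "q \<in> U \<Longrightarrow> dF q (B p0 q) = 0"
  by (simp add: B_def linear_diff[OF dF_linear] linear_cmul[OF dF_linear] dF_N)

lemma nn_inner_hg: "q \<in> U \<Longrightarrow> nn q \<bullet> hg q = m q"
  using m_pos[of q] by (simp add: nn_def m_def power2_norm_eq_inner[symmetric] power2_eq_square)

text \<open>The horizontal normal occurs once in the coefficient and once as the direction, so the
  sign \<open>s\<close> that relates it to \<open>N\<close> enters squared and the orientation drops
  out.\<close>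

lemma B_eq:
  assumes q: "q \<in> S \<inter> U"
  shows "m q *\<^sub>R tangent_dilation \<nu> p0 q = B p0 q"
proof -
  have qU: "q \<in> U" using q by auto
  define s where "s = c q / \<bar>c q\<bar>"
  have m: "m q > 0" using m_pos[OF qU] .
  have ss: "s * s = 1" using c_nz[OF q] by (simp add: s_def)
  have nrm: "norm (hcomp (\<nu> q)) = \<bar>c q\<bar> * m q" by (simp add: hcomp_nu[OF q] m_def)
  have hN: "hcomp (unit_hor_normal \<nu> q) = s *\<^sub>R nn q"
    by (simp add: hcomp_unit_hor_normal nrm) (simp add: hcomp_nu[OF q] nn_def s_def field_simps)
  have N: "unit_hor_normal \<nu> q = s *\<^sub>R N q"
    by (rule heis_vec_eqI[of _ _ q]) (simp_all add: hN N_def vec_eq_iff)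
  have om: "omega_bar \<nu> q = s * dF q heis_T / m q"
    by (simp add: omega_bar_eq nrm) (simp add: vcomp_nu[OF q] s_def)
  have dFZ: "dF q (dilation_field p0 q) = (hcomp q - hcomp p0) \<bullet> hg q + f_coeff p0 q * dF q heis_T"
    by (subst linear_heis_frame[OF dF_linear[OF qU], of _ q]) (simp add: hg_def inner_vec_def)
  have co: "(hcomp q - hcomp p0) \<bullet> hcomp (unit_hor_normal \<nu> q) + f_coeff p0 q * omega_bar \<nu> q
    = s * dF q (dilation_field p0 q) / m q"
    unfolding hN om dFZ by (simp add: nn_def distrib_left add_divide_distrib divide_inverse mult_ac)
  have "m q * (s * y / m q * s) = (s * s) * y" for y
    using m by simp
  then have "m q * (s * y / m q * s) = y" for y
    unfolding ss by simp
  then show ?thesis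
    unfolding tangent_dilation_def co unfolding B_def N by (simp only: scaleR_diff_right scaleR_scaleR)
qed

text \<open>Product rule: m div Z + Z m - (Z F) div N - N (Z F). Here div Z = 2n + 2, div N = 0 on
  \<open>S\<close>, and Z m - N (Z F) = -m.\<close>

lemma divergence_B:
  assumes q: "q \<in> S \<inter> U"
  shows "\<exists>B'. (B p0 has_derivative B') (at q) \<and> (\<Sum>b\<in>Basis. B' b \<bullet> b) = (2 * real CARD('n) + 1) * m q"
proof -
  have qU: "q \<in> U" using q by simp
  obtain F' where F': "\<And>x. x \<in> U \<Longrightarrow> (F has_derivative blinfun_apply (F' x)) (at x)" "C1_on U F'"
    using F_C2 unfolding C2_on_def by blast
  obtain F'' where F'': "\<And>x. x \<in> U \<Longrightarrow> (F' has_derivative blinfun_apply (F'' x)) (at x)"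
    using F'(2) unfolding C1_on_def by blast
  define D where "D = F'' q"
  have D: "(F' has_derivative blinfun_apply D) (at q)" using F''[OF qU] by (simp add: D_def)
  have sym: "blinfun_apply (blinfun_apply D v) v' = blinfun_apply (blinfun_apply D v') v" for v v'
    by (rule second_derivative_symmetric[OF oU qU F'(1) D])
  have dFF': "dF x = blinfun_apply (F' x)" if "x \<in> U" for x
    using has_derivative_unique[OF F_deriv[OF that] F'(1)[OF that]] .
  have dv: "((\<lambda>x. dF x (v x)) has_derivative (\<lambda>h. blinfun_apply (blinfun_apply D h) (v q) + dF q (v' h))) (at q)"
    if v: "(v has_derivative v') (at q)" for v v'
  proof -
    have "((\<lambda>x. blinfun_apply (F' x) (v x)) has_derivative
        (\<lambda>h. blinfun_apply (blinfun_apply D h) (v q) + dF q (v' h))) (at q)"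
      by (rule has_derivative_eq_rhs[OF bounded_bilinear.FDERIV[OF bounded_bilinear_blinfun_apply D v]])
        (simp add: dFF'[OF qU] fun_eq_iff)
    then show ?thesis
      by (rule has_derivative_transform_within_open[OF _ oU qU]) (simp add: dFF')
  qed
  define Z where "Z = dilation_field p0 q"
  define dZ where "dZ = dilation_linear p0"
  define hg' where "hg' = frechet_derivative hg (at q)"
  define m' where "m' = frechet_derivative m (at q)"
  define nn' where "nn' = frechet_derivative nn (at q)"
  have dhg: "(hg has_derivative hg') (at q)" and dm: "(m has_derivative m') (at q)"
    and dnn: "(nn has_derivative nn') (at q)"
    unfolding hg'_def m'_def nn'_def
    by (rule C1_on_has_derivative[OF _ qU], rule hg_C1 m_C1 nn_C1)+
  have hg'_nth: "hg' h $ j = D h (heis_X j q) + dF q (heis_X_linear j h)" for h j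
  proof -
    have 1: "((\<lambda>x. hg x $ j) has_derivative (\<lambda>h. hg' h $ j)) (at q)"
      by (rule bounded_linear.has_derivative[OF bounded_linear_vec_nth dhg])
    have 2: "((\<lambda>x. hg x $ j) has_derivative (\<lambda>h. D h (heis_X j q) + dF q (heis_X_linear j h))) (at q)"
      using dv[OF heis_X_has_derivative] by (simp add: hg_def)
    show ?thesis
      using fun_cong[OF has_derivative_unique[OF 1 2]] .
  qed
  have hg0: "hg q \<noteq> 0" using m_pos[OF qU] by (auto simp: m_def)
  \<comment> \<open>A norm changes only through the component along \<open>nn\<close>. So Z m is the
    sum of nn_j Z (X_j F), which matches N (Z F), the sum of nn_j X_j (Z F), term by term.\<close>
  have m'_eq: "m' h = nn q \<bullet> hg' h" for h
  proof -
    have "((\<lambda>x. norm (hg x)) has_derivative (\<lambda>h. hg' h \<bullet> sgn (hg q))) (at q)"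
      using has_derivative_compose[OF dhg has_derivative_norm[OF hg0]] by (simp add: inner_commute)
    then have "m' h = hg' h \<bullet> sgn (hg q)"
      using has_derivative_unique[OF dm] by (simp add: m_def[abs_def])
    then show ?thesis by (simp add: sgn_div_norm nn_def m_def inner_commute)
  qed
  define N' where "N' h = (\<Sum>j\<in>UNIV. nn q $ j *\<^sub>R heis_X_linear j h + nn' h $ j *\<^sub>R heis_X j q)" for h
  have dN: "(N has_derivative N') (at q)"
    unfolding N_def N'_def
    by (intro has_derivative_sum has_derivative_scaleR heis_X_has_derivative
      bounded_linear.has_derivative[OF bounded_linear_vec_nth dnn])
  define B' where "B' h = (m q *\<^sub>R dZ h + m' h *\<^sub>R Z) - (dF q Z *\<^sub>R N' h + (D h Z + dF q (dZ h)) *\<^sub>R N q)" for h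
  have dB: "(B p0 has_derivative B') (at q)"
    unfolding B_def B'_def Z_def dZ_def
    by (intro has_derivative_diff has_derivative_scaleR dm dN dv dilation_field_has_derivative)
  have linm: "linear m'" using has_derivative_linear[OF dm] .
  have linnn: "linear (\<lambda>h. nn' h $ j)" for j
    using has_derivative_linear[OF bounded_linear.has_derivative[OF bounded_linear_vec_nth dnn]] .
  have linD: "linear (\<lambda>h. D h Z + dF q (dZ h))"
    using has_derivative_linear[OF dv[OF dilation_field_has_derivative]] by (simp add: Z_def dZ_def)
  have trZ: "(\<Sum>b\<in>Basis. dZ b \<bullet> b) = 2 * real CARD('n) + 2"
    by (simp add: dZ_def trace_dilation_linear)
  \<comment> \<open>The fields \<open>heis_X j\<close> are divergence free, so only the horizontal
    divergence of the coefficients \<open>nn\<close> is left, and minimality makes it zero.\<close>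
  have trN: "(\<Sum>b\<in>Basis. N' b \<bullet> b) = 0"
  proof -
    have "(\<Sum>b\<in>Basis. N' b \<bullet> b) = (\<Sum>j\<in>UNIV. nn q $ j * (\<Sum>b\<in>Basis. heis_X_linear j b \<bullet> b)
       + (\<Sum>b\<in>Basis. (nn' b $ j *\<^sub>R heis_X j q) \<bullet> b))"
      unfolding N'_def inner_sum_left
      by (subst sum.swap) (simp add: inner_add_left sum.distrib sum_distrib_left)
    then show ?thesis
      by (simp only: trace_rank_one[OF linnn] trace_heis_X_linear) (simp add: nn'_def div_nn[OF q])
  qed
  have "(\<Sum>b\<in>Basis. B' b \<bullet> b) = m q * (\<Sum>b\<in>Basis. dZ b \<bullet> b) + (\<Sum>b\<in>Basis. (m' b *\<^sub>R Z) \<bullet> b)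
    - (dF q Z * (\<Sum>b\<in>Basis. N' b \<bullet> b) + (\<Sum>b\<in>Basis. ((D b Z + dF q (dZ b)) *\<^sub>R N q) \<bullet> b))"
    unfolding B'_def inner_diff_left inner_add_left sum.distrib sum_subtractf
    by (simp add: sum_distrib_left)
  also have "\<dots> = m q * (2 * real CARD('n) + 2) + m' Z - (D (N q) Z + dF q (dZ (N q)))"
    by (simp only: trace_rank_one[OF linm] trace_rank_one[OF linD] trN trZ mult_zero_right add_0)
  also have "m' Z - (D (N q) Z + dF q (dZ (N q))) = - m q"
  proof -
    have 1: "D (N q) Z + dF q (dZ (N q)) = (\<Sum>j\<in>UNIV. nn q $ j * (D (heis_X j q) Z + dF q (dZ (heis_X j q))))"
      unfolding N_def by (simp only: linear_sum[OF linD] linear_cmul[OF linD] real_scaleR_def)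
    \<comment> \<open>By symmetry the second derivatives of \<open>F\<close> cancel; what is left is
      the bracket [Z, X_j] applied to \<open>F\<close>.\<close>
    have "m' Z - (D (N q) Z + dF q (dZ (N q))) =
      (\<Sum>j\<in>UNIV. nn q $ j * dF q (heis_X_linear j Z - dZ (heis_X j q)))"
      unfolding m'_eq 1 inner_vec_def hg'_nth
      by (simp add: sum_subtractf[symmetric] sym[of Z] linear_diff[OF dF_linear[OF qU]] algebra_simps)
    also have "\<dots> = (\<Sum>j\<in>UNIV. - (nn q $ j * hg q $ j))"
      unfolding Z_def dZ_def dilation_commutator by (simp add: linear_neg[OF dF_linear[OF qU]] hg_def)
    also have "\<dots> = - m q"
      using nn_inner_hg[OF qU] by (simp add: inner_vec_def sum_negf)
    finally show ?thesis .
  qed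
  then have "m q * (2 * real CARD('n) + 2) + m' Z - (D (N q) Z + dF q (dZ (N q))) = (2 * real CARD('n) + 1) * m q"
    by (simp add: algebra_simps)
  finally show ?thesis using dB by blast
qed

text \<open>The chart components of \<open>\<eta> B\<close> have divergence \<open>div (\<eta> B)\<close>: the missing normal term is
  supplied by differentiating \<open>dF (\<eta> B) = 0\<close> in the direction \<open>w\<close>, along which \<open>dF\<close> is constant.\<close>

lemma chart_divergence:
  assumes u: "u \<in> V" and \<eta>: "C1_on UNIV \<eta>"
  shows "\<exists>a'. ((\<lambda>u. P (\<eta> (\<phi> u) *\<^sub>R B p0 (\<phi> u))) has_derivative a') (at u) \<and>
    (\<Sum>i\<in>UNIV. a' (axis i 1) $ i) =
      (2 * real CARD('n) + 1) * m (\<phi> u) * \<eta> (\<phi> u) + frechet_derivative \<eta> (at (\<phi> u)) (B p0 (\<phi> u))"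
proof -
  define q where "q = \<phi> u"
  have q: "q \<in> S \<inter> U" "q \<in> U" "P q = u" using phi_mem[OF u] by (auto simp: q_def)
  obtain B' where B': "(B p0 has_derivative B') (at q)"
    "(\<Sum>b\<in>Basis. B' b \<bullet> b) = (2 * real CARD('n) + 1) * m q"
    using divergence_B[OF q(1)] by blast
  define x where "x = frechet_derivative \<eta> (at q)"
  have dx: "(\<eta> has_derivative x) (at q)"
    unfolding x_def by (rule C1_on_has_derivative[OF \<eta> UNIV_I])
  define A where "A q = \<eta> q *\<^sub>R B p0 q" for q
  define A' where "A' h = \<eta> q *\<^sub>R B' h + x h *\<^sub>R B p0 q" for h
  have dA: "(A has_derivative A') (at q)"
    unfolding A_def A'_def by (intro has_derivative_scaleR dx B')
  have linA: "linear A'" using has_derivative_linear[OF dA] .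
  define J where "J h = slice_lift k h + frechet_derivative g (at u) h *\<^sub>R w" for h
  have da: "((\<lambda>u. P (A (\<phi> u))) has_derivative (\<lambda>h. P (A' (J h)))) (at u)"
    by (intro bounded_linear.has_derivative[OF bounded_linear_slice_proj]
        has_derivative_compose[OF phi_deriv[OF u, folded J_def] dA[unfolded q_def]])
  have tang: "dF q (A' w) = 0"
  proof -
    have l: "((\<lambda>s. q + s *\<^sub>R w) has_derivative (\<lambda>s. s *\<^sub>R w)) (at 0)"
      by (auto intro!: derivative_eq_intros)
    have ev: "\<forall>\<^sub>F s in at 0. q + s *\<^sub>R w \<in> U"
      using has_derivative_continuous[OF l] q oU by (intro topological_tendstoD) (auto simp: isCont_def)
    have 0: "dF q (A (q + s *\<^sub>R w)) = 0" if "q + s *\<^sub>R w \<in> U" for s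
    proof -
      have "dF q v = dF (q + s *\<^sub>R w) v" for v
        using q that by (simp add: dF_eq linear_add[OF P_linear] linear_cmul[OF P_linear] slice_proj_direction[OF w])
      then show ?thesis
        using that by (simp add: A_def linear_cmul[OF dF_linear] dF_B)
    qed
    have "(A has_derivative A') (at (q + 0 *\<^sub>R w))" using dA by simp
    from has_derivative_compose[OF l this]
    have "((\<lambda>s. A (q + s *\<^sub>R w)) has_derivative (\<lambda>s. A' (s *\<^sub>R w))) (at 0)" .
    from bounded_linear.has_derivative[OF has_derivative_bounded_linear[OF F_deriv[OF q(2)]] this]
    have d1: "((\<lambda>s. dF q (A (q + s *\<^sub>R w))) has_derivative (\<lambda>s. dF q (A' (s *\<^sub>R w)))) (at 0)" .
    have d2: "((\<lambda>s. dF q (A (q + s *\<^sub>R w))) has_derivative (\<lambda>s. 0)) (at 0)"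
      by (intro has_derivative_transform_eventually[OF has_derivative_const])
        (use 0 0[of 0] ev q in \<open>auto elim: eventually_mono\<close>)
    show ?thesis using fun_cong[OF has_derivative_unique[OF d1 d2], of 1] by simp
  qed
  have "(\<Sum>i\<in>UNIV. P (A' (J (axis i 1))) $ i)
    = (\<Sum>i\<in>UNIV. P (A' (slice_lift k (axis i 1))) $ i) + (\<Sum>i\<in>UNIV. frechet_derivative g (at u) (axis i 1) * P (A' w) $ i)"
    by (simp add: J_def linear_add[OF linA] linear_cmul[OF linA] linear_add[OF P_linear] linear_cmul[OF P_linear] sum.distrib)
  also have "(\<Sum>i\<in>UNIV. frechet_derivative g (at u) (axis i 1) * P (A' w) $ i) = frechet_derivative g (at u) (P (A' w))"
  proof -
    have "frechet_derivative g (at u) (P (A' w)) = frechet_derivative g (at u) (\<Sum>i\<in>UNIV. P (A' w) $ i *\<^sub>R axis i 1)"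
      by (simp add: basis_expansion scalar_mult_eq_scaleR[symmetric])
    then show ?thesis
      by (simp add: linear_sum[OF g_linear[OF u]] linear_cmul[OF g_linear[OF u]] mult.commute)
  qed
  \<comment> \<open>By \<open>tang\<close> the chain-rule term from the slope of the graph equals
    the \<open>w\<close> component of \<open>A' w\<close>, the diagonal entry that
    \<open>trace_split\<close> still needs.\<close>
  also have "\<dots> = hcomp (A' w) $ k"
    using tang q by (simp add: dF_eq)
  also have "(\<Sum>i\<in>UNIV. P (A' (slice_lift k (axis i 1))) $ i) + hcomp (A' w) $ k = (\<Sum>b\<in>Basis. A' b \<bullet> b)"
    by (rule trace_split[OF linA P_linear _ _ slice_lift_linear, symmetric])
      (simp_all add: slice_decomp[OF w] bounded_linear.linear[OF bounded_linear_hcomp_nth])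
  also have "\<dots> = \<eta> q * (\<Sum>b\<in>Basis. B' b \<bullet> b) + (\<Sum>b\<in>Basis. (x b *\<^sub>R B p0 q) \<bullet> b)"
    by (simp add: A'_def inner_add_left sum.distrib sum_distrib_left)
  also have "\<dots> = (2 * real CARD('n) + 1) * m q * \<eta> q + x (B p0 q)"
    by (simp only: trace_rank_one[OF has_derivative_linear[OF dx]] B'(2)) simp
  finally show ?thesis
    using da unfolding A_def q_def x_def by blast
qed

text \<open>The chart components of \<open>\<eta>\<close> times \<open>B\<close> extend by zero to
  C^1 functions on the whole parameter space, and each of their partial derivatives integrates to
  zero.\<close>

lemma chart_integral_zero:
  assumes \<eta>: "C1_on UNIV \<eta>" and K: "compact K" "K \<subseteq> U" and zero: "\<And>q. q \<notin> K \<Longrightarrow> \<eta> q = 0"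
  shows "(\<integral>u. indicator V u * ((2 * real CARD('n) + 1) * m (\<phi> u) * \<eta> (\<phi> u)
      + frechet_derivative \<eta> (at (\<phi> u)) (B p0 (\<phi> u))) \<partial>lborel) = 0"
proof -
  \<comment> \<open>Compact because \<open>S\<close> is closed; it contains the parameters where
    \<open>\<eta>\<close> is nonzero on the graph.\<close>
  define K' where "K' = P ` (K \<inter> S)"
  have cK': "compact K'"
    unfolding K'_def using K closed
    by (intro compact_continuous_image compact_Int_closed linear_continuous_on bounded_linear_slice_proj)
  have K'V: "K' \<subseteq> V" using UV K by (auto simp: K'_def)
  have phi_K: "\<eta> (\<phi> u) = 0" if "u \<notin> K'" "u \<in> V" for u
  proof (rule zero)
    show "\<phi> u \<notin> K" using that phi_mem[of u] P_phi[of u] unfolding K'_def by (metis IntD1 IntI image_eqI)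
  qed
  define a where "a u = (if u \<in> V then P (\<eta> (\<phi> u) *\<^sub>R B p0 (\<phi> u)) else 0)" for u
  have a0: "a u = 0" if "u \<notin> K'" for u
    using phi_K[OF that] linear_0[OF P_linear] by (simp add: a_def)
  have im: "\<phi> ` V \<subseteq> U" using phi_mem by auto
  have pC1: "C1_on V \<phi>" by (rule C2_on_imp_C1_on[OF phi_C2])
  have aC1: "C1_on UNIV (\<lambda>u. a u $ i)" for i
  proof -
    have "C1_on V (\<lambda>u. P (\<eta> (\<phi> u) *\<^sub>R B p0 (\<phi> u)) $ i)"
      by (intro C1_on_linear_compose[OF bounded_linear_vec_nth] C1_on_linear_compose[OF bounded_linear_slice_proj]
        C1_on_scaleR C1_on_compose[OF pC1 \<eta>] C1_on_compose[OF pC1 B_C1] im) auto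
    then have 1: "C1_on V (\<lambda>u. a u $ i)"
      by (rule C1_on_cong[OF _ oV]) (simp add: a_def)
    have oK: "open (- K')" using cK' compact_imp_closed by auto
    have 2: "C1_on (- K') (\<lambda>u. a u $ i)"
      by (rule C1_on_cong[OF C1_on_const[of _ 0] oK]) (simp add: a0)
    have "V \<union> - K' = UNIV" using K'V by auto
    then show ?thesis using C1_on_Un[OF 1 2 oV oK] by simp
  qed
  have "(\<Sum>i\<in>UNIV. frechet_derivative (\<lambda>u. a u $ i) (at u) (axis i 1)) =
     indicator V u * ((2 * real CARD('n) + 1) * m (\<phi> u) * \<eta> (\<phi> u)
      + frechet_derivative \<eta> (at (\<phi> u)) (B p0 (\<phi> u)))" for u
  proof (cases "u \<in> V")
    case True
    obtain a' where a': "((\<lambda>u. P (\<eta> (\<phi> u) *\<^sub>R B p0 (\<phi> u))) has_derivative a') (at u)"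
      "(\<Sum>i\<in>UNIV. a' (axis i 1) $ i) =
      (2 * real CARD('n) + 1) * m (\<phi> u) * \<eta> (\<phi> u) + frechet_derivative \<eta> (at (\<phi> u)) (B p0 (\<phi> u))"
      using chart_divergence[OF True \<eta>] by blast
    have "(a has_derivative a') (at u)"
      by (rule has_derivative_transform_within_open[OF a'(1) oV True]) (simp add: a_def)
    then have "((\<lambda>u. a u $ i) has_derivative (\<lambda>h. a' h $ i)) (at u)" for i
      by (rule bounded_linear.has_derivative[OF bounded_linear_vec_nth])
    then have "frechet_derivative (\<lambda>u. a u $ i) (at u) (axis i 1) = a' (axis i 1) $ i" for i
      by (rule fun_cong[OF frechet_derivative_at, symmetric])
    then show ?thesis using True a'(2) by simp
  next
    case False
    have "((\<lambda>u. a u $ i) has_derivative (\<lambda>h. 0)) (at u)" for i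
      by (rule has_derivative_transform_within_open[OF has_derivative_const, of "- K'"])
        (use cK' compact_imp_closed False K'V a0 in auto)
    then have "frechet_derivative (\<lambda>u. a u $ i) (at u) (axis i 1) = 0" for i
      by (rule fun_cong[OF frechet_derivative_at, symmetric])
    then show ?thesis using False by simp
  qed
  note eq = this
  have a0': "a u $ i = 0" if "u \<notin> K'" for u i using a0[OF that] by simp
  note int = integral_directional_derivative_zero[OF aC1 cK' a0']
  show ?thesis
    unfolding eq[symmetric] by (subst Bochner_Integration.integral_sum) (auto simp: int)
qed

text \<open>\<open>\<sigma>\<close> restricted to \<open>S \<inter> U\<close> and the image under
  the chart of Lebesgue measure with the Gram density agree on all measurable sets, by the defining
  property of \<open>surface_measure\<close>. The factor \<open>hor_W\<close> then turns this
  density into \<open>m\<close>.\<close>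

lemma perimeter_integral:
  fixes h :: "'n heis \<Rightarrow> real"
  assumes \<sigma>: "surface_measure S \<sigma>" and K: "compact K" "K \<subseteq> U" and ne: "p \<in> S"
    and h: "continuous_on S h" and zero: "\<And>q. q \<in> S \<Longrightarrow> q \<notin> K \<Longrightarrow> h q = 0"
  shows "integrable (hor_perimeter \<nu> \<sigma>) h"
    and "integrable lborel (\<lambda>u. indicator V u * (m (\<phi> u) * h (\<phi> u)))"
    and "(\<integral>q. h q \<partial>hor_perimeter \<nu> \<sigma>) = (\<integral>u. indicator V u * (m (\<phi> u) * h (\<phi> u)) \<partial>lborel)"
proof -
  have sets_\<sigma>: "sets \<sigma> = sets (restrict_space borel S)"
    and em: "\<And>A. A \<in> sets \<sigma> \<Longrightarrow> A \<subseteq> \<phi> ` V \<Longrightarrow> emeasure \<sigma> A =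
      (\<integral>\<^sup>+ u \<in> {u\<in>V. \<phi> u \<in> A}. ennreal (sqrt (det (gram_matrix \<phi> u))) \<partial>lborel)"
    using \<sigma> phi_local_param unfolding surface_measure_def by blast+
  have sp: "space \<sigma> = S" using sets_eq_imp_space_eq[OF sets_\<sigma>] by (simp add: space_restrict_space)
  have meas_\<sigma>: "borel_measurable \<sigma> = borel_measurable (restrict_space borel S)"
    by (rule measurable_cong_sets[OF sets_\<sigma> refl])
  have contm: "continuous_on V (\<lambda>u. m (\<phi> u))"
    by (intro C1_on_imp_continuous_on C1_on_compose[OF C2_on_imp_C1_on[OF phi_C2] m_C1]) (use phi_mem in auto)
  have contT: "continuous_on V (\<lambda>u. dF (\<phi> u) heis_T)"
    by (intro C1_on_imp_continuous_on C1_on_compose[OF C2_on_imp_C1_on[OF phi_C2] dF_C1[OF C1_on_const]])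
      (use phi_mem in auto)
  have contphi: "continuous_on V \<phi>"
    by (intro C1_on_imp_continuous_on C2_on_imp_C1_on phi_C2)
  define dens where "dens u = indicator V u * sqrt (det (gram_matrix \<phi> u))" for u
  have dens_m: "dens \<in> borel_measurable borel"
  proof -
    have *: "continuous_on V (\<lambda>u. sqrt (det (gram_matrix \<phi> u)))"
      by (subst continuous_on_cong[OF refl, of _ _ "\<lambda>u. sqrt ((m (\<phi> u))\<^sup>2 + (dF (\<phi> u) heis_T)\<^sup>2)"])
        (auto simp: det_gram intro!: continuous_intros contm contT)
    show ?thesis
      using borel_measurable_continuous_on_indicator[OF _ *] oV by (simp add: dens_def[abs_def])
  qed
  have dens_nn: "dens u \<ge> 0" for u
    by (cases "u \<in> V") (auto simp: dens_def det_gram)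
  \<comment> \<open>Off \<open>V\<close> the default is a point of \<open>S\<close>, so that the map
    is measurable into \<open>\<sigma>\<close>; the density \<open>dens\<close> vanishes
    there.\<close>
  define \<phi>' where "\<phi>' u = (if u \<in> V then \<phi> u else p)" for u
  have \<phi>'_m: "\<phi>' \<in> measurable lborel \<sigma>"
  proof -
    have "\<phi>' \<in> measurable borel (restrict_space borel S)"
    proof (rule measurable_restrict_space2)
      show "\<phi>' \<in> space borel \<rightarrow> S" using ne phi_mem by (auto simp: \<phi>'_def)
      show "\<phi>' \<in> borel_measurable borel"
        unfolding \<phi>'_def[abs_def] by (rule borel_measurable_continuous_on_if) (use oV contphi in auto)
    qed
    then show ?thesis
      using measurable_cong_sets[OF sets_lborel sets_\<sigma>] by blast
  qed
  have SU: "S \<inter> U \<in> sets \<sigma>"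
    unfolding sets_\<sigma> using oU by (auto simp: sets_restrict_space)
  define M1 where "M1 = density \<sigma> (\<lambda>q. ennreal (indicator (S \<inter> U) q))"
  define M2 where "M2 = distr (density lborel (\<lambda>u. ennreal (dens u))) \<sigma> \<phi>'"
  have "M1 = M2"
  proof (rule measure_eqI)
    show "sets M1 = sets M2" by (simp add: M1_def M2_def)
    fix A assume "A \<in> sets M1"
    then have A: "A \<in> sets \<sigma>" by (simp add: M1_def)
    have "emeasure M1 A = (\<integral>\<^sup>+q. indicator (A \<inter> (S \<inter> U)) q \<partial>\<sigma>)"
    proof -
      have "(\<lambda>q. ennreal (indicator (S \<inter> U) q)) \<in> borel_measurable \<sigma>" using SU by simp
      from emeasure_density[OF this A] show ?thesis
        unfolding M1_def by (auto intro!: nn_integral_cong split: split_indicator)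
    qed
    also have "\<dots> = emeasure \<sigma> (A \<inter> (S \<inter> U))"
      using A SU by (subst nn_integral_indicator) auto
    also have "\<dots> = (\<integral>\<^sup>+ u \<in> {u\<in>V. \<phi> u \<in> A \<inter> (S \<inter> U)}. ennreal (sqrt (det (gram_matrix \<phi> u))) \<partial>lborel)"
      using A SU by (intro em) (auto simp: phi_image)
    also have "\<dots> = (\<integral>\<^sup>+u. ennreal (dens u) * indicator (\<phi>' -` A) u \<partial>lborel)"
      using phi_mem by (intro nn_integral_cong) (auto simp: dens_def \<phi>'_def indicator_def)
    also have "\<dots> = emeasure M2 A"
    proof -
      have pre: "\<phi>' -` A \<in> sets lborel" using measurable_sets[OF \<phi>'_m A] by simp
      have "emeasure M2 A = emeasure (density lborel (\<lambda>u. ennreal (dens u))) (\<phi>' -` A)"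
        unfolding M2_def using A \<phi>'_m by (subst emeasure_distr) auto
      also have "\<dots> = (\<integral>\<^sup>+u. ennreal (dens u) * indicator (\<phi>' -` A) u \<partial>lborel)"
        using pre dens_m by (subst emeasure_density) auto
      finally show ?thesis by simp
    qed
    finally show "emeasure M1 A = emeasure M2 A" .
  qed
  have W_m: "hor_W \<nu> \<in> borel_measurable \<sigma>" and h_m: "h \<in> borel_measurable \<sigma>"
    unfolding meas_\<sigma>
    by (intro borel_measurable_continuous_on_restrict continuous_on_hor_W[OF unit_normal_S] h)+
  have W_nn: "0 \<le> hor_W \<nu> q" for q by (simp add: hor_W_eq)
  let ?f = "\<lambda>q. hor_W \<nu> q * h q"
  have f_m: "?f \<in> borel_measurable \<sigma>" using W_m h_m by simp
  have ind_m: "(indicator (S \<inter> U) :: _ \<Rightarrow> real) \<in> borel_measurable \<sigma>" using SU by simp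
  have f_eq: "indicator (S \<inter> U) q *\<^sub>R ?f q = ?f q" if "q \<in> space \<sigma>" for q
    using that zero[of q] K by (auto simp: sp indicator_def)
  have pull: "dens u *\<^sub>R ?f (\<phi>' u) = indicator V u * (m (\<phi> u) * h (\<phi> u))" for u
    using W_sqrt_det[of u] by (auto simp: dens_def \<phi>'_def indicator_def mult_ac)
  have fp_m: "(\<lambda>u. ?f (\<phi>' u)) \<in> borel_measurable lborel"
    using measurable_compose[OF \<phi>'_m f_m] .
  have iff1: "integrable (hor_perimeter \<nu> \<sigma>) h \<longleftrightarrow> integrable \<sigma> ?f"
    unfolding hor_perimeter_def using W_m h_m W_nn by (subst integrable_density) auto
  have iff2: "integrable \<sigma> ?f \<longleftrightarrow> integrable M1 ?f"
    unfolding M1_def using ind_m f_m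
    by (subst integrable_density) (auto intro!: Bochner_Integration.integrable_cong simp: f_eq[simplified])
  have iff3: "integrable M2 ?f \<longleftrightarrow> integrable lborel (\<lambda>u. indicator V u * (m (\<phi> u) * h (\<phi> u)))"
    unfolding M2_def pull[symmetric] using dens_m dens_nn fp_m f_m \<phi>'_m
    by (subst integrable_distr_eq) (auto simp: integrable_density)
  show int: "integrable lborel (\<lambda>u. indicator V u * (m (\<phi> u) * h (\<phi> u)))"
  proof -
    define K' where "K' = P ` (K \<inter> S)"
    have cK': "compact K'"
      unfolding K'_def using K closed
      by (intro compact_continuous_image compact_Int_closed linear_continuous_on bounded_linear_slice_proj)
    have K'V: "K' \<subseteq> V" using UV K by (auto simp: K'_def)
    have "continuous_on V (\<lambda>u. m (\<phi> u) * h (\<phi> u))"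
      by (intro continuous_intros contm continuous_on_compose2[OF h contphi]) (use phi_mem in auto)
    then have "integrable lborel (\<lambda>u. indicator K' u *\<^sub>R (m (\<phi> u) * h (\<phi> u)))"
      using K'V by (intro borel_integrable_compact cK') (auto intro: continuous_on_subset)
    moreover have "indicator K' u *\<^sub>R (m (\<phi> u) * h (\<phi> u)) = indicator V u * (m (\<phi> u) * h (\<phi> u))" for u
    proof (cases "u \<in> V - K'")
      case True
      then have "\<phi> u \<notin> K" using phi_mem[of u] P_phi[of u] unfolding K'_def by (metis DiffD1 DiffD2 IntD1 IntI image_eqI)
      then show ?thesis using zero[of "\<phi> u"] phi_mem[of u] True by auto
    qed (use K'V in \<open>auto simp: indicator_def\<close>)
    ultimately show ?thesis by (simp only:)
  qed
  show "integrable (hor_perimeter \<nu> \<sigma>) h"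
    using int iff1 iff2 iff3 \<open>M1 = M2\<close> by simp
  have "(\<integral>q. h q \<partial>hor_perimeter \<nu> \<sigma>) = (\<integral>q. ?f q \<partial>\<sigma>)"
    unfolding hor_perimeter_def using W_m h_m W_nn by (subst integral_density) auto
  also have "\<dots> = (\<integral>q. ?f q \<partial>M1)"
    unfolding M1_def using ind_m f_m
    by (subst integral_density) (auto intro!: Bochner_Integration.integral_cong simp: f_eq[simplified])
  also have "\<dots> = (\<integral>u. dens u *\<^sub>R ?f (\<phi>' u) \<partial>lborel)"
    unfolding \<open>M1 = M2\<close> M2_def using dens_m dens_nn fp_m f_m \<phi>'_m
    by (subst integral_distr) (auto simp: integral_density)
  finally show "(\<integral>q. h q \<partial>hor_perimeter \<nu> \<sigma>) = (\<integral>u. indicator V u * (m (\<phi> u) * h (\<phi> u)) \<partial>lborel)"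
    unfolding pull .
qed

text \<open>Both perimeter integrals are pulled back to the chart; since \<open>m\<close> times
  \<open>tangent_dilation\<close> is \<open>B\<close>, their combination is the integral of a
  divergence.\<close>

lemma local_first_variation:
  assumes \<sigma>: "surface_measure S \<sigma>" and \<eta>: "C1_on UNIV \<eta>" and K: "compact K" "K \<subseteq> U"
    and zero: "\<And>q. q \<notin> K \<Longrightarrow> \<eta> q = 0" and ne: "p \<in> S"
  shows "integrable (hor_perimeter \<nu> \<sigma>) \<eta>"
    and "integrable (hor_perimeter \<nu> \<sigma>) (\<lambda>q. frechet_derivative \<eta> (at q) (tangent_dilation \<nu> p0 q))"
    and "(2 * real CARD('n) + 1) * (\<integral>q. \<eta> q \<partial>hor_perimeter \<nu> \<sigma>)
      + (\<integral>q. frechet_derivative \<eta> (at q) (tangent_dilation \<nu> p0 q) \<partial>hor_perimeter \<nu> \<sigma>) = 0"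
proof -
  let ?d = "\<lambda>q. frechet_derivative \<eta> (at q) (tangent_dilation \<nu> p0 q)"
  have c1: "continuous_on S \<eta>"
    using C1_on_imp_continuous_on[OF \<eta>] continuous_on_subset by blast
  have c2: "continuous_on S ?d"
    by (intro continuous_on_frechet_derivative C1_on_subset[OF \<eta>]
      continuous_on_tangent_dilation[OF unit_normal_S nonchar]) auto
  have "?d q = 0" if "q \<notin> K" for q
  proof -
    have "(\<eta> has_derivative (\<lambda>h. 0)) (at q)"
      by (rule has_derivative_transform_within_open[OF has_derivative_const, of "- K"])
        (use K compact_imp_closed that zero in auto)
    then show ?thesis by (rule fun_cong[OF frechet_derivative_at, symmetric])
  qed
  then have z2: "q \<in> S \<Longrightarrow> q \<notin> K \<Longrightarrow> ?d q = 0" for q by blast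
  have z1: "q \<in> S \<Longrightarrow> q \<notin> K \<Longrightarrow> \<eta> q = 0" for q using zero by blast
  note i1 = perimeter_integral[OF \<sigma> K ne c1 z1]
  note i2 = perimeter_integral[OF \<sigma> K ne c2 z2]
  show "integrable (hor_perimeter \<nu> \<sigma>) \<eta>" "integrable (hor_perimeter \<nu> \<sigma>) ?d"
    using i1(1) i2(1) by auto
  have "(2 * real CARD('n) + 1) * (\<integral>q. \<eta> q \<partial>hor_perimeter \<nu> \<sigma>) + (\<integral>q. ?d q \<partial>hor_perimeter \<nu> \<sigma>)
    = (\<integral>u. (2 * real CARD('n) + 1) * (indicator V u * (m (\<phi> u) * \<eta> (\<phi> u)))
         + indicator V u * (m (\<phi> u) * ?d (\<phi> u)) \<partial>lborel)"
    using i1(2) i2(2) by (subst Bochner_Integration.integral_add) (auto simp: i1(3) i2(3))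
  also have "\<dots> = (\<integral>u. indicator V u * ((2 * real CARD('n) + 1) * m (\<phi> u) * \<eta> (\<phi> u)
      + frechet_derivative \<eta> (at (\<phi> u)) (B p0 (\<phi> u))) \<partial>lborel)"
  proof (intro Bochner_Integration.integral_cong refl)
    fix u
    have "m q * ?d q = frechet_derivative \<eta> (at q) (B p0 q)" if "q \<in> S \<inter> U" for q
      using linear_cmul[OF linear_frechet_derivative[OF C1_on_differentiable[OF \<eta> UNIV_I]]]
      by (simp add: B_eq[OF that, symmetric])
    then show "(2 * real CARD('n) + 1) * (indicator V u * (m (\<phi> u) * \<eta> (\<phi> u)))
         + indicator V u * (m (\<phi> u) * ?d (\<phi> u))
      = indicator V u * ((2 * real CARD('n) + 1) * m (\<phi> u) * \<eta> (\<phi> u)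
      + frechet_derivative \<eta> (at (\<phi> u)) (B p0 (\<phi> u)))"
      using phi_mem[of u] by (cases "u \<in> V") (auto simp: algebra_simps)
  qed
  also have "\<dots> = 0"
    by (rule chart_integral_zero[OF \<eta> K zero])
  finally show "(2 * real CARD('n) + 1) * (\<integral>q. \<eta> q \<partial>hor_perimeter \<nu> \<sigma>)
      + (\<integral>q. ?d q \<partial>hor_perimeter \<nu> \<sigma>) = 0" .
qed

end

section \<open>First variation of the horizontal perimeter\<close>

text \<open>\<open>surf_tangent\<close> is defined by curves, so one with velocity \<open>v\<close>
  must be produced: follow the line through \<open>p\<close> and correct along a transversal
  \<open>b\<close>. As \<open>F\<close> vanishes on the curve and its derivative annihilates
  \<open>v\<close> but not \<open>b\<close>, the correction has zero velocity.\<close>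

lemma surf_tangent_of_kernel:
  fixes S :: "'n::finite heis set" and F :: "'n heis \<Rightarrow> real"
  assumes U: "open U" "p \<in> U" and F: "C2_on U F" and nz: "frechet_derivative F (at p) \<noteq> (\<lambda>v. 0)"
    and S: "S \<inter> U = {q \<in> U. F q = 0}" and p: "p \<in> S" and v: "frechet_derivative F (at p) v = 0"
  shows "v \<in> surf_tangent S p"
proof -
  let ?F' = "frechet_derivative F (at p)"
  have dF: "(F has_derivative ?F') (at p)"
    by (rule C1_on_has_derivative[OF C2_on_imp_C1_on[OF F] U(2)])
  have linF: "linear ?F'" by (rule has_derivative_linear[OF dF])
  obtain b where b: "?F' b \<noteq> 0" using nz unfolding fun_eq_iff by blast
  \<comment> \<open>An extra real variable measures the correction along \<open>b\<close>; with the
    whole space as base no complement of \<open>b\<close> has to be chosen.\<close>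
  define \<Psi> where "\<Psi> z = fst z + snd z *\<^sub>R b" for z :: "'n heis \<times> real"
  have bl: "bounded_linear \<Psi>"
    unfolding \<Psi>_def
    by (intro bounded_linear_add bounded_linear_fst bounded_linear_compose[OF bounded_linear_scaleR_left bounded_linear_snd])
  have oD: "open (\<Psi> -` U)"
    by (intro open_vimage U linear_continuous_on bl)
  have \<Psi>0: "\<Psi> (p, 0) = p" by (simp add: \<Psi>_def)
  have C2: "C2_on (\<Psi> -` U) (\<lambda>z. F (\<Psi> z))"
    by (rule C2_on_compose[OF C2_on_bounded_linear[OF bl] F]) auto
  have "((\<lambda>z. F (\<Psi> z)) has_derivative (\<lambda>h. ?F' (\<Psi> h))) (at (p, 0))"
    by (rule has_derivative_compose[OF bounded_linear_imp_has_derivative[OF bl]]) (simp add: \<Psi>0 dF)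
  then have "frechet_derivative (\<lambda>z. F (\<Psi> z)) (at (p, 0)) (0, 1) = ?F' (\<Psi> (0, 1))"
    by (rule fun_cong[OF frechet_derivative_at, symmetric])
  then have nz': "frechet_derivative (\<lambda>z. F (\<Psi> z)) (at (p, 0)) (0, 1) \<noteq> 0"
    using b by (simp add: \<Psi>_def)
  have F0: "F p = 0" using S p U by blast
  have mem: "(p, 0) \<in> \<Psi> -` U" and F0': "F (\<Psi> (p, 0)) = 0"
    by (simp_all add: \<Psi>0 U F0)
  obtain U' V g where U': "open U'" "U' \<subseteq> \<Psi> -` U" "(p, 0) \<in> U'" and V: "open V" "C2_on V g"
    and iff: "\<And>u s. (u, s) \<in> U' \<and> F (\<Psi> (u, s)) = 0 \<longleftrightarrow> u \<in> V \<and> s = g u"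
    by (rule implicit_function_C2[OF oD C2 mem nz' F0'], rule that; assumption)
  have gp: "p \<in> V" "g p = 0"
    using iff[of p 0] U' F0 \<Psi>0 by auto
  have dg: "(g has_derivative frechet_derivative g (at p)) (at p)"
    by (rule C1_on_has_derivative[OF C2_on_imp_C1_on[OF V(2)] gp(1)])
  define d where "d = frechet_derivative g (at p) v"
  have l: "((\<lambda>t. p + t *\<^sub>R v) has_derivative (\<lambda>t. t *\<^sub>R v)) (at 0)"
    by (auto intro!: derivative_eq_intros)
  have dg0: "((\<lambda>t. g (p + t *\<^sub>R v)) has_derivative (\<lambda>t. t * d)) (at 0)"
    by (rule has_derivative_eq_rhs[OF has_derivative_compose[OF l]])
      (use dg in \<open>auto simp: fun_eq_iff d_def linear_cmul[OF has_derivative_linear[OF dg]]\<close>)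
  define c where "c t = (p + t *\<^sub>R v) + g (p + t *\<^sub>R v) *\<^sub>R b" for t
  have dc: "(c has_derivative (\<lambda>t. t *\<^sub>R v + (t * d) *\<^sub>R b)) (at 0)"
    unfolding c_def by (intro has_derivative_add l bounded_linear.has_derivative[OF bounded_linear_scaleR_left dg0])
  have c0: "c 0 = p" by (simp add: c_def gp)
  have "\<forall>\<^sub>F t in at 0. p + t *\<^sub>R v \<in> V"
    using has_derivative_continuous[OF l] gp V by (intro topological_tendstoD) (auto simp: isCont_def)
  then have ev: "\<forall>\<^sub>F t in at 0. c t \<in> U \<and> F (c t) = 0"
  proof eventually_elim
    case (elim t)
    then have *: "(p + t *\<^sub>R v, g (p + t *\<^sub>R v)) \<in> U'" "F (\<Psi> (p + t *\<^sub>R v, g (p + t *\<^sub>R v))) = 0"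
      using iff[of "p + t *\<^sub>R v" "g (p + t *\<^sub>R v)"] elim by auto
    moreover have "\<Psi> (p + t *\<^sub>R v, g (p + t *\<^sub>R v)) = c t" by (simp add: \<Psi>_def c_def)
    ultimately show ?case using U' by auto
  qed
  have d1: "((\<lambda>t. F (c t)) has_derivative (\<lambda>t. ?F' (t *\<^sub>R v + (t * d) *\<^sub>R b))) (at 0)"
    by (rule has_derivative_compose[OF dc]) (simp add: c0 dF)
  have d2: "((\<lambda>t. F (c t)) has_derivative (\<lambda>t. 0)) (at 0)"
    by (intro has_derivative_transform_eventually[OF has_derivative_const])
      (use ev c0 F0 in \<open>auto elim: eventually_mono\<close>)
  have "?F' (v + d *\<^sub>R b) = 0"
    using fun_cong[OF has_derivative_unique[OF d1 d2], of 1] by simp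
  then have "d = 0"
    using v b by (simp add: linear_add[OF linF] linear_cmul[OF linF])
  then have "(c has_vector_derivative v) (at 0)"
    using dc by (simp add: has_vector_derivative_def)
  moreover have "\<forall>\<^sub>F t in at 0. c t \<in> S"
    using ev by eventually_elim (use S in auto)
  ultimately show ?thesis
    unfolding surf_tangent_def using c0 by blast
qed

text \<open>At a non-characteristic point some \<open>heis_X k p\<close> is transversal to
  \<open>S\<close>: otherwise all of them would be tangent and \<open>\<nu> p\<close> vertical. That
  vector, frozen at \<open>p\<close>, is the graph direction.\<close>

lemma heis_graph_exists:
  fixes S :: "'n::finite heis set"
  assumes min: "H_minimal S \<nu>" and nc: "non_characteristic S \<nu>" and cl: "closed S" and p: "p \<in> S"
  obtains k w V g U where "heis_graph S \<nu> k w V g U" "p \<in> U"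
proof -
  obtain U0 and F :: "'n heis \<Rightarrow> real" where U0: "open U0" "p \<in> U0" and F: "C2_on U0 F"
    and nz: "\<And>q. q \<in> U0 \<Longrightarrow> frechet_derivative F (at q) \<noteq> (\<lambda>v. 0)" and S: "S \<inter> U0 = {q \<in> U0. F q = 0}"
    using min p unfolding H_minimal_def C2_hypersurface_def by blast
  have un: "unit_normal S \<nu>" using min by (simp add: H_minimal_def)
  let ?F' = "frechet_derivative F (at p)"
  have dF: "(F has_derivative ?F') (at p)"
    by (rule C1_on_has_derivative[OF C2_on_imp_C1_on[OF F] U0(2)])
  obtain k where k: "?F' (heis_X k p) \<noteq> 0"
  proof (rule ccontr)
    assume "\<not> thesis"
    then have "?F' (heis_X k p) = 0" for k using that by blast
    then have "heis_X k p \<in> surf_tangent S p" for k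
      using surf_tangent_of_kernel[OF U0 F nz[OF U0(2)] S p] by blast
    then have "heis_metric p (\<nu> p) (heis_X k p) = 0" for k
      using un p unfolding unit_normal_def by blast
    then have "hcomp (\<nu> p) $ k = 0" for k by simp
    then have "hor_W \<nu> p = 0" by (simp add: hor_W_eq vec_eq_iff)
    then show False using nc p unfolding non_characteristic_def by fastforce
  qed
  define w where "w = heis_X k p"
  have w: "hcomp w = axis k 1" by (simp add: w_def)
  let ?P = "slice_proj k w"
  \<comment> \<open>Coordinates adapted to \<open>w\<close>: a point of the slice and the
    displacement along \<open>w\<close>. The map \<open>\<Theta>\<close> reads them off.\<close>
  define \<Psi> where "\<Psi> z = slice_lift k (fst z) + snd z *\<^sub>R w" for z :: "(real^('n + 'n)) \<times> real"
  have bl: "bounded_linear \<Psi>"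
    unfolding \<Psi>_def
    by (intro bounded_linear_add bounded_linear_compose[OF bounded_linear_slice_lift bounded_linear_fst]
        bounded_linear_compose[OF bounded_linear_scaleR_left bounded_linear_snd])
  define \<Theta> where "\<Theta> q = (?P q, hcomp q $ k)" for q
  have bl2: "bounded_linear \<Theta>"
    unfolding \<Theta>_def by (intro bounded_linear_Pair bounded_linear_slice_proj bounded_linear_hcomp_nth)
  have \<Psi>\<Theta>: "\<Psi> (\<Theta> q) = q" for q
    using slice_decomp[OF w, of q] by (simp add: \<Psi>_def \<Theta>_def)
  have oD: "open (\<Psi> -` U0)"
    by (intro open_vimage U0 linear_continuous_on bl)
  have C2: "C2_on (\<Psi> -` U0) (\<lambda>z. F (\<Psi> z))"
    by (rule C2_on_compose[OF C2_on_bounded_linear[OF bl] F]) auto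
  have "((\<lambda>z. F (\<Psi> z)) has_derivative (\<lambda>h. ?F' (\<Psi> h))) (at (\<Theta> p))"
    by (rule has_derivative_compose[OF bounded_linear_imp_has_derivative[OF bl]]) (simp add: \<Psi>\<Theta> dF)
  then have "frechet_derivative (\<lambda>z. F (\<Psi> z)) (at (\<Theta> p)) (0, 1) = ?F' (\<Psi> (0, 1))"
    by (rule fun_cong[OF frechet_derivative_at, symmetric])
  then have nz': "frechet_derivative (\<lambda>z. F (\<Psi> z)) (at (?P p, hcomp p $ k)) (0, 1) \<noteq> 0"
    using k by (simp add: \<Psi>_def \<Theta>_def w_def linear_0[OF slice_lift_linear])
  have F0: "F p = 0" using S p U0 by blast
  have mem: "(?P p, hcomp p $ k) \<in> \<Psi> -` U0" and F0': "F (\<Psi> (?P p, hcomp p $ k)) = 0"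
    using \<Psi>\<Theta>[of p] U0 F0 by (simp_all add: \<Theta>_def)
  obtain U' V0 g where U': "open U'" "U' \<subseteq> \<Psi> -` U0" "\<Theta> p \<in> U'" and V0: "open V0" "C2_on V0 g"
    and iff: "\<And>u s. (u, s) \<in> U' \<and> F (\<Psi> (u, s)) = 0 \<longleftrightarrow> u \<in> V0 \<and> s = g u"
    by (rule implicit_function_C2[OF oD C2 mem nz' F0'], rule that; (unfold \<Theta>_def)?; assumption)
  have pV0: "?P p \<in> V0" "hcomp p $ k = g (?P p)"
    using iff[of "?P p" "hcomp p $ k"] U' F0 \<Psi>\<Theta>[of p] by (auto simp: \<Theta>_def)
  define Fh where "Fh q = hcomp q $ k - g (?P q)" for q
  define U2 where "U2 = \<Theta> -` U' \<inter> ?P -` V0"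
  have oU2: "open U2"
    unfolding U2_def
    by (intro open_Int open_vimage U' V0 linear_continuous_on bl2 bounded_linear_slice_proj)
  have C2h: "C2_on U2 Fh"
  proof -
    have 1: "C2_on U2 (\<lambda>q. - g (?P q))"
      by (intro C2_on_linear_compose[OF bounded_linear_minus[OF bounded_linear_ident]]
        C2_on_compose[OF C2_on_bounded_linear[OF bounded_linear_slice_proj] V0(2)]) (auto simp: U2_def)
    show ?thesis
      unfolding Fh_def[abs_def] using C2_on_add[OF C2_on_bounded_linear[OF bounded_linear_hcomp_nth] 1] by simp
  qed
  \<comment> \<open>At \<open>p\<close> the derivative along \<open>heis_X k p = w\<close> is 1, so
    positivity along \<open>heis_X k q\<close> holds there, and it is an open condition.\<close>
  define U3 where "U3 = {q \<in> U2. frechet_derivative Fh (at q) (heis_X k q) > 0}"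
  have oU3: "open U3"
  proof -
    have "continuous_on U2 (\<lambda>q. frechet_derivative Fh (at q) (heis_X k q))"
      by (intro continuous_on_frechet_derivative C2_on_imp_C1_on[OF C2h] continuous_on_heis_X)
    from continuous_open_preimage[OF this oU2 open_greaterThan[of 0]]
    show ?thesis unfolding U3_def by (simp add: vimage_def Int_def)
  qed
  have pU3: "p \<in> U3"
  proof -
    have dg: "(g has_derivative frechet_derivative g (at (?P p))) (at (?P p))"
      by (rule C1_on_has_derivative[OF C2_on_imp_C1_on[OF V0(2)] pV0(1)])
    have "(Fh has_derivative (\<lambda>v. hcomp v $ k - frechet_derivative g (at (?P p)) (?P v))) (at p)"
      unfolding Fh_def
      by (intro has_derivative_diff bounded_linear_imp_has_derivative[OF bounded_linear_hcomp_nth]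
        has_derivative_compose[OF bounded_linear_imp_has_derivative[OF bounded_linear_slice_proj] dg])
    then have "frechet_derivative Fh (at p) w = hcomp w $ k - frechet_derivative g (at (?P p)) (?P w)"
      by (rule fun_cong[OF frechet_derivative_at, symmetric])
    also have "\<dots> = 1"
      using linear_0[OF has_derivative_linear[OF dg]] by (simp add: slice_proj_direction[OF w] w)
    finally show ?thesis
      using U' pV0 by (simp add: U3_def U2_def w_def)
  qed
  \<comment> \<open>Two shrinkings: first the base, so that the graph over it lies in
    \<open>U3\<close>, then \<open>U3\<close> to its part over the new base. Both inclusions between
    \<open>U\<close> and \<open>V\<close> asked for by the locale survive.\<close>
  define V where "V = {u \<in> V0. slice_lift k u + g u *\<^sub>R w \<in> U3}"
  have oV: "open V"
  proof -
    have "continuous_on V0 (\<lambda>u. slice_lift k u + g u *\<^sub>R w)"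
      by (intro continuous_intros linear_continuous_on bounded_linear_slice_lift
          C1_on_imp_continuous_on[OF C2_on_imp_C1_on[OF V0(2)]])
    from continuous_open_preimage[OF this V0(1) oU3]
    show ?thesis unfolding V_def by (simp add: vimage_def Int_def)
  qed
  define U where "U = U3 \<inter> ?P -` V"
  have oU: "open U"
    unfolding U_def by (intro open_Int oU3 open_vimage oV linear_continuous_on bounded_linear_slice_proj)
  have "heis_graph S \<nu> k w V g U"
  proof
    show "C2_on V g" by (rule C2_on_subset[OF V0(2)]) (auto simp: V_def)
    show "?P q \<in> V" if "q \<in> U" for q using that by (simp add: U_def)
    show "slice_lift k u + g u *\<^sub>R w \<in> U" if "u \<in> V" for u
    proof -
      have "?P (slice_lift k u + g u *\<^sub>R w) = u"
        by (simp add: linear_add[OF slice_proj_linear] linear_cmul[OF slice_proj_linear] slice_proj_direction[OF w])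
      then show ?thesis using that by (simp add: U_def V_def)
    qed
    show "q \<in> S \<longleftrightarrow> hcomp q $ k = g (?P q)" if q: "q \<in> U" for q
    proof -
      have "\<Theta> q \<in> U'" "?P q \<in> V0" using q by (auto simp: U_def U3_def U2_def)
      then have "q \<in> U0" using U' \<Psi>\<Theta>[of q] by auto
      then have "q \<in> S \<longleftrightarrow> F q = 0" using S by blast
      also have "\<dots> \<longleftrightarrow> (?P q, hcomp q $ k) \<in> U' \<and> F (\<Psi> (?P q, hcomp q $ k)) = 0"
        using \<open>\<Theta> q \<in> U'\<close> \<Psi>\<Theta>[of q] by (simp add: \<Theta>_def)
      also have "\<dots> \<longleftrightarrow> hcomp q $ k = g (?P q)"
        using iff \<open>?P q \<in> V0\<close> by auto
      finally show ?thesis .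
    qed
    show "frechet_derivative (\<lambda>q. hcomp q $ k - g (?P q)) (at q) (heis_X k q) > 0" if "q \<in> U" for q
      using that by (simp add: U_def U3_def Fh_def[abs_def])
  qed (use w oV oU min nc cl in auto)
  moreover have "p \<in> U"
    using pU3 pV0 slice_decomp[OF w, of p] by (simp add: U_def V_def)
  ultimately show thesis by (rule that)
qed

section \<open>From small supports to compact supports\<close>

definition first_variation_holds :: "('n::finite heis \<Rightarrow> 'n heis) \<Rightarrow> 'n heis measure \<Rightarrow> 'n heis \<Rightarrow> ('n heis \<Rightarrow> real) \<Rightarrow> bool" where
  "first_variation_holds \<nu> \<sigma> p0 \<eta> \<longleftrightarrow>
    integrable (hor_perimeter \<nu> \<sigma>) \<eta> \<and>
    integrable (hor_perimeter \<nu> \<sigma>) (\<lambda>q. frechet_derivative \<eta> (at q) (tangent_dilation \<nu> p0 q)) \<and>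
    (2 * real CARD('n) + 1) * (\<integral>q. \<eta> q \<partial>hor_perimeter \<nu> \<sigma>)
      + (\<integral>q. frechet_derivative \<eta> (at q) (tangent_dilation \<nu> p0 q) \<partial>hor_perimeter \<nu> \<sigma>) = 0"

text \<open>The radius must not depend on \<open>\<eta>\<close>, since the covering is chosen before
  the pieces of \<open>\<eta>\<close>. At a point off the closed set \<open>S\<close> a ball that
  misses \<open>S\<close> makes both integrals trivial.\<close>

lemma first_variation_small_support:
  fixes S :: "'n::finite heis set"
  assumes min: "H_minimal S \<nu>" and nc: "non_characteristic S \<nu>" and cl: "closed S"
    and \<sigma>: "surface_measure S \<sigma>"
  obtains e where "e > 0" "\<And>\<eta>. C1_on UNIV \<eta> \<Longrightarrow> (\<And>q. q \<notin> cball p e \<Longrightarrow> \<eta> q = 0) \<Longrightarrow>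
    first_variation_holds \<nu> \<sigma> p0 \<eta>"
proof (cases "p \<in> S")
  case True
  obtain k w V g U where G: "heis_graph S \<nu> k w V g U" "p \<in> U"
    using heis_graph_exists[OF min nc cl True] .
  interpret heis_graph S \<nu> k w V g U by fact
  obtain e where e: "e > 0" "cball p e \<subseteq> U"
    using oU G(2) open_contains_cball by blast
  show thesis
  proof (rule that[OF e(1)])
    fix \<eta> :: "'n heis \<Rightarrow> real" assume \<eta>: "C1_on UNIV \<eta>" "\<And>q. q \<notin> cball p e \<Longrightarrow> \<eta> q = 0"
    show "first_variation_holds \<nu> \<sigma> p0 \<eta>"
      unfolding first_variation_holds_def
      using local_first_variation[OF \<sigma> \<eta>(1) compact_cball e(2) \<eta>(2) True] by auto
  qed
next
  case False
  obtain e where e: "e > 0" "cball p e \<subseteq> - S"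
    using cl False open_contains_cball[of "- S"] by auto
  have sp: "space (hor_perimeter \<nu> \<sigma>) = S"
    using \<sigma> sets_eq_imp_space_eq[of \<sigma> "restrict_space borel S"]
    by (simp add: hor_perimeter_def surface_measure_def space_restrict_space)
  show thesis
  proof (rule that[OF e(1)])
    fix \<eta> :: "'n heis \<Rightarrow> real" assume \<eta>: "C1_on UNIV \<eta>" "\<And>q. q \<notin> cball p e \<Longrightarrow> \<eta> q = 0"
    have 1: "\<eta> q = 0" if "q \<in> S" for q using that e(2) by (intro \<eta>(2)) blast
    have 2: "frechet_derivative \<eta> (at q) v = 0" if "q \<in> S" for q v
    proof -
      have "(\<eta> has_derivative (\<lambda>h. 0)) (at q)"
        by (rule has_derivative_transform_within_open[OF has_derivative_const, of "- cball p e"])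
          (use e that \<eta>(2) in auto)
      then show ?thesis by (rule fun_cong[OF frechet_derivative_at, symmetric])
    qed
    have "integrable (hor_perimeter \<nu> \<sigma>) h \<and> (\<integral>q. h q \<partial>hor_perimeter \<nu> \<sigma>) = 0"
      if "\<And>q. q \<in> S \<Longrightarrow> h q = 0" for h :: "'n heis \<Rightarrow> real"
    proof -
      have "integrable (hor_perimeter \<nu> \<sigma>) h \<longleftrightarrow> integrable (hor_perimeter \<nu> \<sigma>) (\<lambda>q. 0 :: real)"
        by (rule Bochner_Integration.integrable_cong) (use that sp in auto)
      moreover have "(\<integral>q. h q \<partial>hor_perimeter \<nu> \<sigma>) = (\<integral>q. 0 \<partial>hor_perimeter \<nu> \<sigma>)"
        by (rule Bochner_Integration.integral_cong) (use that sp in auto)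
      ultimately show ?thesis by simp
    qed
    from this[of \<eta>] this[of "\<lambda>q. frechet_derivative \<eta> (at q) (tangent_dilation \<nu> p0 q)"] 1 2
    show "first_variation_holds \<nu> \<sigma> p0 \<eta>"
      unfolding first_variation_holds_def by simp
  qed
qed

text \<open>Additivity of the integrals; for its sake \<open>first_variation_holds\<close> carries
  integrability along.\<close>

lemma first_variation_holds_sum:
  fixes \<nu> :: "'n::finite heis \<Rightarrow> 'n heis"
  assumes I: "finite I" and C1: "\<And>i. i \<in> I \<Longrightarrow> C1_on UNIV (\<eta> i)"
    and fv: "\<And>i. i \<in> I \<Longrightarrow> first_variation_holds \<nu> \<sigma> p0 (\<eta> i)"
  shows "first_variation_holds \<nu> \<sigma> p0 (\<lambda>q. \<Sum>i\<in>I. \<eta> i q)"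
proof -
  have d: "frechet_derivative (\<lambda>q. \<Sum>i\<in>I. \<eta> i q) (at q) v = (\<Sum>i\<in>I. frechet_derivative (\<eta> i) (at q) v)" for q v
  proof -
    have "((\<lambda>q. \<Sum>i\<in>I. \<eta> i q) has_derivative (\<lambda>v. \<Sum>i\<in>I. frechet_derivative (\<eta> i) (at q) v)) (at q)"
      by (intro has_derivative_sum C1_on_has_derivative[OF C1]) auto
    then show ?thesis by (rule fun_cong[OF frechet_derivative_at, symmetric])
  qed
  have int: "\<And>i. i \<in> I \<Longrightarrow> integrable (hor_perimeter \<nu> \<sigma>) (\<eta> i)"
    "\<And>i. i \<in> I \<Longrightarrow> integrable (hor_perimeter \<nu> \<sigma>) (\<lambda>q. frechet_derivative (\<eta> i) (at q) (tangent_dilation \<nu> p0 q))"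
    using fv by (auto simp: first_variation_holds_def)
  show ?thesis
    unfolding first_variation_holds_def d
  proof (intro conjI Bochner_Integration.integrable_sum int)
    show "(2 * real CARD('n) + 1) * (\<integral>q. (\<Sum>i\<in>I. \<eta> i q) \<partial>hor_perimeter \<nu> \<sigma>)
      + (\<integral>q. (\<Sum>i\<in>I. frechet_derivative (\<eta> i) (at q) (tangent_dilation \<nu> p0 q)) \<partial>hor_perimeter \<nu> \<sigma>) = 0"
      using fv by (simp add: Bochner_Integration.integral_sum int sum_distrib_left sum.distrib[symmetric] first_variation_holds_def)
  qed
qed

lemma C1_on_bump: "C1_on UNIV (\<lambda>q. (max 0 (e\<^sup>2 - (q - p) \<bullet> (q - p)))\<^sup>2 :: real)"
proof (rule C1_on_compose[OF _ C1_on_positive_part_square])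
  show "C1_on UNIV (\<lambda>q. e\<^sup>2 - (q - p) \<bullet> (q - p))"
    by (intro C1_on_diff C1_on_inner C1_on_const C1_on_id)
qed simp

text \<open>Partition of unity in which the normalisation is put on \<open>\<eta>\<close>: it is
  divided by the sum \<open>s\<close> of the bumps, and each bump times the quotient has support in
  one small ball.\<close>

lemma first_variation_compact_support:
  fixes S :: "'n::finite heis set"
  assumes min: "H_minimal S \<nu>" and nc: "non_characteristic S \<nu>" and cl: "closed S"
    and \<sigma>: "surface_measure S \<sigma>"
    and \<eta>: "C1_on UNIV \<eta>" and K: "compact K" and zero: "\<And>q. q \<notin> K \<Longrightarrow> \<eta> q = 0"
  shows "first_variation_holds \<nu> \<sigma> p0 \<eta>"
proof -
  have "\<exists>e. e > 0 \<and> (\<forall>\<eta>. C1_on UNIV \<eta> \<longrightarrow> (\<forall>q. q \<notin> cball p e \<longrightarrow> \<eta> q = 0) \<longrightarrow>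
      first_variation_holds \<nu> \<sigma> p0 \<eta>)" for p
    by (rule first_variation_small_support[OF min nc cl \<sigma>, of p p0]) blast
  then have "\<forall>p. \<exists>e. e > 0 \<and> (\<forall>\<eta>. C1_on UNIV \<eta> \<longrightarrow> (\<forall>q. q \<notin> cball p e \<longrightarrow> \<eta> q = 0) \<longrightarrow>
      first_variation_holds \<nu> \<sigma> p0 \<eta>)" by (rule allI)
  from choice[OF this] obtain e where E: "\<forall>p. e p > 0 \<and> (\<forall>\<eta>. C1_on UNIV \<eta> \<longrightarrow>
      (\<forall>q. q \<notin> cball p (e p) \<longrightarrow> \<eta> q = 0) \<longrightarrow> first_variation_holds \<nu> \<sigma> p0 \<eta>)" ..
  note e = E[THEN spec, THEN conjunct1] E[THEN spec, THEN conjunct2, rule_format]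
  obtain I where I: "finite I" "K \<subseteq> (\<Union>p\<in>I. ball p (e p))"
  proof (rule compactE_image[OF K, of K "\<lambda>p. ball p (e p)"])
    show "K \<subseteq> (\<Union>p\<in>K. ball p (e p))" using e(1) by (auto intro!: bexI centre_in_ball[THEN iffD2])
  qed (use that in auto)
  define b where "b p q = (max 0 ((e p)\<^sup>2 - (q - p) \<bullet> (q - p)))\<^sup>2" for p q :: "'n heis"
  have bC1: "C1_on UNIV (b p)" for p unfolding b_def[abs_def] by (rule C1_on_bump)
  have b0: "b p q = 0" if "q \<notin> cball p (e p)" for p q
  proof -
    have "e p < norm (q - p)" using that by (simp add: dist_norm norm_minus_commute)
    then have "(e p)\<^sup>2 < (norm (q - p))\<^sup>2" using e(1)[of p] by (intro power_strict_mono) auto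
    then show ?thesis by (simp add: b_def power2_norm_eq_inner)
  qed
  have bpos: "b p q > 0" if "q \<in> ball p (e p)" for p q
  proof -
    have "norm (q - p) < e p" using that by (simp add: dist_norm norm_minus_commute)
    then have "(norm (q - p))\<^sup>2 < (e p)\<^sup>2" by (intro power_strict_mono) auto
    then show ?thesis by (simp add: b_def power2_norm_eq_inner)
  qed
  define s where "s q = (\<Sum>p\<in>I. b p q)" for q
  have sC1: "C1_on UNIV s" unfolding s_def[abs_def] by (intro C1_on_sum bC1)
  have spos: "s q > 0" if q: "q \<in> K" for q
  proof -
    obtain p where "p \<in> I" "q \<in> ball p (e p)" using I(2) q by blast
    then show ?thesis
      unfolding s_def using I bpos by (intro sum_pos2[of _ p]) (auto simp: b_def)
  qed
  \<comment> \<open>\<open>s\<close> may vanish off \<open>K\<close>, but there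
    \<open>\<eta>\<close> is 0 and so is the quotient. Since \<open>s\<close> is positive on
    \<open>K\<close>, the open sets where \<open>s\<close> is nonzero and where
    \<open>\<eta>1\<close> vanishes identically cover the space.\<close>
  define \<eta>1 where "\<eta>1 q = \<eta> q / s q" for q
  have \<eta>1C1: "C1_on UNIV \<eta>1"
  proof -
    have o1: "open {q. s q \<noteq> 0}"
      using C1_on_imp_continuous_on[OF sC1] by (intro open_Collect_neq continuous_on_const)
    have o2: "open (- K)" using K compact_imp_closed by auto
    have "C1_on {q. s q \<noteq> 0} \<eta>1"
      unfolding \<eta>1_def[abs_def] by (intro C1_on_divide C1_on_subset[OF \<eta>] C1_on_subset[OF sC1]) auto
    moreover have "C1_on (- K) \<eta>1"
      by (rule C1_on_cong[OF C1_on_const[of _ 0] o2]) (simp add: \<eta>1_def zero)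
    ultimately have "C1_on ({q. s q \<noteq> 0} \<union> - K) \<eta>1"
      using o1 o2 by (rule C1_on_Un)
    moreover have "{q. s q \<noteq> 0} \<union> - K = UNIV" using spos by fastforce
    ultimately show ?thesis by simp
  qed
  have "first_variation_holds \<nu> \<sigma> p0 (\<lambda>q. \<Sum>p\<in>I. b p q * \<eta>1 q)"
  proof (rule first_variation_holds_sum[OF I(1)])
    fix p assume "p \<in> I"
    show C: "C1_on UNIV (\<lambda>q. b p q * \<eta>1 q)" by (intro C1_on_mult bC1 \<eta>1C1)
    show "first_variation_holds \<nu> \<sigma> p0 (\<lambda>q. b p q * \<eta>1 q)"
      by (rule e(2)[OF C, of p]) (simp add: b0)
  qed
  moreover have "(\<lambda>q. \<Sum>p\<in>I. b p q * \<eta>1 q) = \<eta>"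
  proof
    fix q
    have "(\<Sum>p\<in>I. b p q * \<eta>1 q) = s q * \<eta>1 q" by (simp add: s_def sum_distrib_right)
    also have "\<dots> = \<eta> q" using spos[of q] zero[of q] by (cases "q \<in> K") (auto simp: \<eta>1_def)
    finally show "(\<Sum>p\<in>I. b p q * \<eta>1 q) = \<eta> q" .
  qed
  ultimately show ?thesis by simp
qed

theorem theorem3p6:
  fixes S :: "'n::finite heis set"
    and \<nu> :: "'n heis \<Rightarrow> 'n heis"
    and \<sigma> :: "'n heis measure"
    and \<rho> :: "'n heis \<Rightarrow> real"
    and lam :: "real \<Rightarrow> real"
    and p0 :: "'n heis"
    and Q :: nat
    and r :: real
  assumes Q: "Q = 2 * CARD('n) + 2"
    and minimal: "H_minimal S \<nu>"
    and nonchar: "non_characteristic S \<nu>"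
    and closed: "closed S"
    and sigma: "surface_measure S \<sigma>"
    and rho_C1: "C1_on UNIV \<rho>"
    and rho_compact: "\<And>c. compact {p. \<rho> p \<le> c}"
    and lam_C1: "C1_on UNIV lam"
    and lam_mono: "mono lam"
    and lam_0: "\<And>s. s \<le> 0 \<Longrightarrow> lam s = 0"
    and r: "r > 0"
  shows "(real Q - 1) * (\<integral>p. lam (r - \<rho> p) \<partial>hor_perimeter \<nu> \<sigma>)
       - (\<integral>p. deriv lam (r - \<rho> p) *
            (heis_metric p (zeta_field p0 p) (tan_hor_grad \<nu> \<rho> p)
             + f_coeff p0 p * (dir_deriv heis_T \<rho> p - omega_bar \<nu> p * Y_deriv \<nu> \<rho> p))
          \<partial>hor_perimeter \<nu> \<sigma>) \<le> 0"
proof -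
  define \<eta> where "\<eta> p = lam (r - \<rho> p)" for p
  have C1: "C1_on UNIV \<eta>"
    unfolding \<eta>_def by (intro C1_on_compose[OF _ lam_C1] C1_on_diff C1_on_const rho_C1) auto
  \<comment> \<open>\<open>lam\<close> vanishes on the non-positive reals, so \<open>\<eta>\<close>
    vanishes off the compact sublevel set of \<open>\<rho>\<close> at height
    \<open>r\<close>.\<close>
  have fv: "first_variation_holds \<nu> \<sigma> p0 \<eta>"
    by (rule first_variation_compact_support[OF minimal nonchar closed sigma C1 rho_compact[of r]])
      (simp add: \<eta>_def lam_0)
  have d: "frechet_derivative \<eta> (at p) v = - (deriv lam (r - \<rho> p) * frechet_derivative \<rho> (at p) v)" for p v
  proof -
    have "lam field_differentiable at (r - \<rho> p)"
      using C1_on_differentiable[OF lam_C1] by (simp add: field_differentiable_def real_differentiable_def)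
    then have dl: "(lam has_derivative (*) (deriv lam (r - \<rho> p))) (at (r - \<rho> p))"
      by (simp add: field_differentiable_derivI has_field_derivative_imp_has_derivative)
    have "((\<lambda>p. r - \<rho> p) has_derivative (\<lambda>v. - frechet_derivative \<rho> (at p) v)) (at p)"
      using C1_on_has_derivative[OF rho_C1 UNIV_I, of p] by (auto intro!: derivative_eq_intros)
    from has_derivative_compose[OF this dl]
    have "(\<eta> has_derivative (\<lambda>v. deriv lam (r - \<rho> p) * - frechet_derivative \<rho> (at p) v)) (at p)"
      unfolding \<eta>_def .
    from fun_cong[OF frechet_derivative_at[OF this]] show ?thesis by simp
  qed
  \<comment> \<open>The minus sign from differentiating \<open>r - \<rho> p\<close> is the one in
    front of the second integral of the claim.\<close>
  have int: "deriv lam (r - \<rho> p) *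
            (heis_metric p (zeta_field p0 p) (tan_hor_grad \<nu> \<rho> p)
             + f_coeff p0 p * (dir_deriv heis_T \<rho> p - omega_bar \<nu> p * Y_deriv \<nu> \<rho> p))
     = - frechet_derivative \<eta> (at p) (tangent_dilation \<nu> p0 p)" for p
    unfolding d integrand_eq[OF C1_on_differentiable[OF rho_C1 UNIV_I]] tangent_dilation_def by simp
  show ?thesis
    unfolding int using fv Q by (simp add: first_variation_holds_def \<eta>_def algebra_simps)
qed

end
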